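(* Let $h\in L^0(M,N)$ and $p\in[1,\infty)$. Suppose that $N$ is complete. Then the isometry $$i_p:=\operatorname{sec}_{M,p}\circ\operatorname{sec}_{I,p}^{-1}: E(I,E_h(M,N)\cap L^p_h(M,N))\to E_{\underline h}(M,E(I,N))\cap L^p_{\underline h}(M,L^p(I,N))$$ extends uniquely to the isometry $$\bar i_p:=\overline{\operatorname{sec}}_{M,p}\circ\overline{\operatorname{sec}}_{I,p}^{-1}: L^p(I,L^p_h(M,N))\to L^p_{\underline h}(M,L^p(I,N)).$$
   Context: Setting: $(M,\Sigma_M,\mu_M)$ is a measure space with $M$ nonempty (no $\sigma$-finiteness assumed), $(N,d_N)$ is a nonempty metric space with finite metric, and $I=[a,b]\subset\mathbb{R}$ with $a<b$, equipped with Lebesgue measure $\mathscr{L}^1$. "Isometry" means surjective distance-preserving map. For a measure space $(Y,\Sigma_Y,\mu_Y)$ and a nonempty metric space $(Z,d_Z)$: $\mathcal{L}^0_{\mathrm s}(Y,Z)$ is the set of measurable maps $Y\to Z$ (Borel $\sigma$-algebra on $Z$) with separable range; $f\sim_Y f'$ means $f=f'$ $\mu_Y$-a.e.; $[f]_Y$ is the class of $f$; $L^0(Y,Z)$ is the set of classes admitting a representative in $\mathcal{L}^0_{\mathrm s}(Y,Z)$. For $g\in L^0(Y,Z)$ and $p\in[1,\infty)$, $L^p_g(Y,Z)$ is the set of $f\in L^0(Y,Z)$ with $\int_Y d_Z(f,g)^p\,d\mu_Y<\infty$, with the metric $(f,f')\mapsto(\int_Y d_Z(f,f')^p\,d\mu_Y)^{1/p}$.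 $L^p(I,Z)$ denotes $L^p_g(I,Z)$ with $g$ constant (all constants give the same space when $d_Z$ is finite). Classes and representatives are not distinguished when clear from context. $E(Y,Z)$ is the set of classes admitting a simple representative (measurable with finite range). For $g\in L^0(Y,Z)$, $E_g(Y,Z)$ is the set of classes admitting an almost simple representative, i.e. $f\in\mathcal{L}^0_{\mathrm s}(Y,Z)$ for which there is a measurable $B\subset Y$ with $\mu_Y(B)<\infty$, $f|_B$ of finite range and $f=g$ $\mu_Y$-a.e. on $Y\setminus B$. $I\times M$ carries the product measure $\mathscr{L}^1\otimes\mu_M$ obtained by Carathéodory's process from measurable rectangles. Given $h\in L^0(M,N)$: $\hat h:I\times M\to N$ is $\hat h(t,x)=h(x)$, and $\underline h:M\to L^p(I,N)$ sends $x$ to the class of the constant map $t\mapsto h(x)$. Metrics: $D_p$ on $L^p_h(M,N)$; $d_p$ on $L^p(I,N)$ (and on its subset $E(I,N)$); $\hat D_p$ on $L^p_{\hat h}(I\times M,N)$; $d_{p,p}(c,c')=(\int_I D_p(c(t),c'(t))^p dt)^{1/p}$ on $L^p(I,L^p_h(M,N))$; $D_{p,p}(f,f')=(\int_M d_p(f(x),f'(x))^p d\mu_M(x))^{1/p}$ on $L^p_{\underline h}(M,L^p(I,N))$; subsets carry the restricted metrics. $E_{\hat h,\sigma}(I\times M,N)$ is the set of classes admitting a rectangular almost simple representative, i.e. a measurable $\hat c:I\times M\to N$ for which there are finitely many points $(y_j)_{j\in J}$ of $N$ and finitely many disjoint measurable rectangles $(I_j\times M_j)_{j\in J}$ of finite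 measure such that $\hat c\equiv y_j$ on $I_j\times M_j$ for all $j$ and $\hat c=\hat h$ a.e. outside $\bigcup_{j\in J}I_j\times M_j$. The section maps $\operatorname{sec}_{I,p}:[\hat c]_{I\times M}\mapsto[t\mapsto[\hat c(t,\cdot)]_M]_I$ and $\operatorname{sec}_{M,p}:[\hat c]_{I\times M}\mapsto[x\mapsto[\hat c(\cdot,x)]_I]_M$ are isometries from $E_{\hat h,\sigma}(I\times M,N)\cap L^p_{\hat h}(I\times M,N)$ onto $E(I,E_h(M,N)\cap L^p_h(M,N))$ and onto $E_{\underline h}(M,E(I,N))\cap L^p_{\underline h}(M,L^p(I,N))$, respectively. When $N$ is complete, $\overline{\operatorname{sec}}_{I,p}:L^p_{\hat h}(I\times M,N)\to L^p(I,L^p_h(M,N))$ and $\overline{\operatorname{sec}}_{M,p}:L^p_{\hat h}(I\times M,N)\to L^p_{\underline h}(M,L^p(I,N))$ denote their unique isometric extensions, which are surjective and given by the same formulas.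
   Formalization: That i_p maps into (hence isometrically onto) E_{h̲}(M,E(I,N)) ∩ L^p_{h̲} fails for some h, so it is stated only when sec_{M,p} takes values there; in general i_p is shown distance-preserving into L^p_{h̲}(M,L^p(I,N)) with image containing that set. The rest is unconditional. *)

theory Defs
  imports "HOL-Analysis.Analysis"
begin

text \<open>
  A metric space is a carrier \<open>Z\<close> with a distance \<open>d\<close>, as in the locale \<^locale>\<open>Metric_space\<close>;
  explicit carriers are needed because the values of a map may themselves be \<open>L\<^sup>p\<close> classes.
\<close>

section \<open>Isometries and extensions\<close>

definition distance_preserving ::
    "'a set \<Rightarrow> ('a \<Rightarrow> 'a \<Rightarrow> real) \<Rightarrow> 'b set \<Rightarrow> ('b \<Rightarrow> 'b \<Rightarrow> real) \<Rightarrow> ('a \<Rightarrow> 'b) \<Rightarrow> bool"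
  where "distance_preserving X d Y e \<phi> \<longleftrightarrow>
    \<phi> \<in> X \<rightarrow> Y \<and> (\<forall>x\<in>X. \<forall>x'\<in>X. e (\<phi> x) (\<phi> x') = d x x')"

definition isometry ::
    "'a set \<Rightarrow> ('a \<Rightarrow> 'a \<Rightarrow> real) \<Rightarrow> 'b set \<Rightarrow> ('b \<Rightarrow> 'b \<Rightarrow> real) \<Rightarrow> ('a \<Rightarrow> 'b) \<Rightarrow> bool"
  where "isometry X d Y e \<phi> \<longleftrightarrow> distance_preserving X d Y e \<phi> \<and> \<phi> ` X = Y"

definition extends_map :: "'a set \<Rightarrow> ('a \<Rightarrow> 'b) \<Rightarrow> 'a set \<Rightarrow> ('a \<Rightarrow> 'b) \<Rightarrow> bool"
  where "extends_map A \<phi> X \<psi> \<longleftrightarrow> A \<subseteq> X \<and> (\<forall>x\<in>A. \<psi> x = \<phi> x)"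

text \<open>The unique distance-preserving extension to \<open>X\<close> of a map \<open>\<phi>\<close> on \<open>A \<subseteq> X\<close>;
  \<^const>\<open>extensional\<close> fixes the irrelevant values outside \<open>X\<close>.\<close>

definition isometric_extension ::
    "'a set \<Rightarrow> ('a \<Rightarrow> 'b) \<Rightarrow> 'a set \<Rightarrow> ('a \<Rightarrow> 'a \<Rightarrow> real) \<Rightarrow> 'b set \<Rightarrow> ('b \<Rightarrow> 'b \<Rightarrow> real) \<Rightarrow> 'a \<Rightarrow> 'b"
  where "isometric_extension A \<phi> X d Y e =
    (THE \<psi>. \<psi> \<in> extensional X \<and> distance_preserving X d Y e \<psi> \<and> extends_map A \<phi> X \<psi>)"

section \<open>Almost everywhere classes\<close>

text \<open>
  The class of \<open>f\<close> consists of all functions equal to \<open>f\<close> almost everywhere, with no restriction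
  on their codomain. So a class of maps into \<open>Z' \<subseteq> Z\<close> is literally a class of maps into \<open>Z\<close>, and
  the class of a map that is meaningful only almost everywhere makes sense.
\<close>

definition ae_class :: "'y measure \<Rightarrow> ('y \<Rightarrow> 'z) \<Rightarrow> ('y \<Rightarrow> 'z) set"
  where "ae_class Y f = {f'. AE y in Y. f' y = f y}"

definition class_rep :: "('y \<Rightarrow> 'z) set \<Rightarrow> 'y \<Rightarrow> 'z"
  where "class_rep C = (SOME f. f \<in> C)"

lemma ae_class_eq_iff: "ae_class Y f = ae_class Y g \<longleftrightarrow> (AE y in Y. f y = g y)"
proof
  assume "ae_class Y f = ae_class Y g"
  then have "f \<in> ae_class Y g" by (auto simp: ae_class_def)
  then show "AE y in Y. f y = g y" by (simp add: ae_class_def)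
next
  assume *: "AE y in Y. f y = g y"
  have "(AE y in Y. k y = f y) \<longleftrightarrow> (AE y in Y. k y = g y)" for k
    by (rule eventually_cong[OF *]) simp
  then show "ae_class Y f = ae_class Y g" by (simp add: ae_class_def)
qed

lemma AE_class_rep: "AE y in Y. class_rep (ae_class Y f) y = f y"
proof -
  have "f \<in> ae_class Y f" by (simp add: ae_class_def)
  then have "class_rep (ae_class Y f) \<in> ae_class Y f"
    unfolding class_rep_def by (rule someI[where P = "\<lambda>g. g \<in> ae_class Y f"])
  then show ?thesis by (simp add: ae_class_def)
qed

section \<open>Spaces of metric space valued maps\<close>

definition mborel :: "'z set \<Rightarrow> ('z \<Rightarrow> 'z \<Rightarrow> real) \<Rightarrow> 'z measure"
  where "mborel Z d = sigma Z {U. openin (Metric_space.mtopology Z d) U}"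

definition L0_maps :: "'y measure \<Rightarrow> 'z set \<Rightarrow> ('z \<Rightarrow> 'z \<Rightarrow> real) \<Rightarrow> ('y \<Rightarrow> 'z) set"
  where "L0_maps Y Z d = {f \<in> Y \<rightarrow>\<^sub>M mborel Z d.
    separable_space (subtopology (Metric_space.mtopology Z d) (f ` space Y))}"

definition L0 :: "'y measure \<Rightarrow> 'z set \<Rightarrow> ('z \<Rightarrow> 'z \<Rightarrow> real) \<Rightarrow> ('y \<Rightarrow> 'z) set set"
  where "L0 Y Z d = ae_class Y ` L0_maps Y Z d"

definition Lp_int :: "'y measure \<Rightarrow> ('z \<Rightarrow> 'z \<Rightarrow> real) \<Rightarrow> real \<Rightarrow> ('y \<Rightarrow> 'z) set \<Rightarrow> ('y \<Rightarrow> 'z) set \<Rightarrow> ennreal"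
  where "Lp_int Y d p F G = (\<integral>\<^sup>+ y. ennreal (d (class_rep F y) (class_rep G y) powr p) \<partial>Y)"

definition Lp :: "'y measure \<Rightarrow> 'z set \<Rightarrow> ('z \<Rightarrow> 'z \<Rightarrow> real) \<Rightarrow> real \<Rightarrow> ('y \<Rightarrow> 'z) set \<Rightarrow> ('y \<Rightarrow> 'z) set set"
  where "Lp Y Z d p G = {F \<in> L0 Y Z d. Lp_int Y d p F G < \<infinity>}"

definition Lp_dist :: "'y measure \<Rightarrow> ('z \<Rightarrow> 'z \<Rightarrow> real) \<Rightarrow> real \<Rightarrow> ('y \<Rightarrow> 'z) set \<Rightarrow> ('y \<Rightarrow> 'z) set \<Rightarrow> real"
  where "Lp_dist Y d p F F' = enn2real (Lp_int Y d p F F') powr (1 / p)"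

text \<open>The space \<open>L\<^sup>p(Y,Z)\<close> with constant base map, for a finite measure \<open>Y\<close>: all constants give the
  same space, so the union is over equal sets.\<close>

definition Lp_const :: "'y measure \<Rightarrow> 'z set \<Rightarrow> ('z \<Rightarrow> 'z \<Rightarrow> real) \<Rightarrow> real \<Rightarrow> ('y \<Rightarrow> 'z) set set"
  where "Lp_const Y Z d p = (\<Union>z\<in>Z. Lp Y Z d p (ae_class Y (\<lambda>_. z)))"

definition simple_classes :: "'y measure \<Rightarrow> 'z set \<Rightarrow> ('z \<Rightarrow> 'z \<Rightarrow> real) \<Rightarrow> ('y \<Rightarrow> 'z) set set"
  where "simple_classes Y Z d = ae_class Y ` {f \<in> Y \<rightarrow>\<^sub>M mborel Z d. finite (f ` space Y)}"

definition almost_simple_classes ::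
    "'y measure \<Rightarrow> 'z set \<Rightarrow> ('z \<Rightarrow> 'z \<Rightarrow> real) \<Rightarrow> ('y \<Rightarrow> 'z) set \<Rightarrow> ('y \<Rightarrow> 'z) set set"
  where "almost_simple_classes Y Z d G = ae_class Y ` {f \<in> L0_maps Y Z d.
    \<exists>B\<in>sets Y. emeasure Y B < \<infinity> \<and> finite (f ` B) \<and> (AE y in Y. y \<notin> B \<longrightarrow> f y = class_rep G y)}"

lemma Lp_int_ae_class:
  "Lp_int Y d p (ae_class Y f) (ae_class Y g) = (\<integral>\<^sup>+ y. ennreal (d (f y) (g y) powr p) \<partial>Y)"
  unfolding Lp_int_def
  by (rule nn_integral_cong_AE) (use AE_class_rep[of Y f] AE_class_rep[of Y g] in eventually_elim, simp)

section \<open>The Caratheodory product\<close>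

text \<open>
  \<^const>\<open>pair_measure\<close> is not used because it is not the Caratheodory product (and its defining
  iterated integral may fail to be a measure) when a factor is not \<open>\<sigma>\<close>-finite.
\<close>

definition rect_outer :: "'a measure \<Rightarrow> 'b measure \<Rightarrow> ('a \<times> 'b) set \<Rightarrow> ennreal"
  where "rect_outer A B E =
    (INF (S, T) \<in> {(S, T). range S \<subseteq> sets A \<and> range T \<subseteq> sets B \<and> E \<subseteq> (\<Union>i::nat. S i \<times> T i)}.
      \<Sum>i. emeasure A (S i) * emeasure B (T i))"

definition cprod :: "'a measure \<Rightarrow> 'b measure \<Rightarrow> ('a \<times> 'b) measure"
  where "cprod A B = measure_of (space A \<times> space B)
    (lambda_system (space A \<times> space B) (Pow (space A \<times> space B)) (rect_outer A B)) (rect_outer A B)"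

lemma rect_outer_le:
  assumes "\<And>i::nat. S i \<in> sets A" "\<And>i. T i \<in> sets B" "E \<subseteq> (\<Union>i. S i \<times> T i)"
  shows "rect_outer A B E \<le> (\<Sum>i. emeasure A (S i) * emeasure B (T i))"
  unfolding rect_outer_def by (rule INF_lower2[of "(S, T)"]) (use assms in auto)

lemma rect_outer_lessE:
  assumes "rect_outer A B E < c"
  obtains S T where "\<And>i::nat. S i \<in> sets A" "\<And>i. T i \<in> sets B" "E \<subseteq> (\<Union>i. S i \<times> T i)"
    "(\<Sum>i. emeasure A (S i) * emeasure B (T i)) < c"
proof -
  obtain ST where "ST \<in> {(S, T). range S \<subseteq> sets A \<and> range T \<subseteq> sets B \<and> E \<subseteq> (\<Union>i::nat. S i \<times> T i)}"
    and "(case ST of (S, T) \<Rightarrow> \<Sum>i. emeasure A (S i) * emeasure B (T i)) < c"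
    using assms unfolding rect_outer_def INF_less_iff by blast
  then show thesis by (intro that[of "fst ST" "snd ST"]) (auto split: prod.splits)
qed

lemma outer_measure_space_rect_outer:
  fixes A :: "'a measure" and B :: "'b measure"
  shows "outer_measure_space (Pow \<Omega>) (rect_outer A B)"
  unfolding outer_measure_space_def
proof (intro conjI)
  have "rect_outer A B {} \<le> (\<Sum>i::nat. emeasure A {} * emeasure B {})"
    by (rule rect_outer_le) auto
  then show "positive (Pow \<Omega>) (rect_outer A B)" by (simp add: positive_def)
  show "increasing (Pow \<Omega>) (rect_outer A B)"
    unfolding increasing_def
  proof (intro ballI impI)
    fix E F :: "('a \<times> 'b) set" assume "E \<subseteq> F"
    show "rect_outer A B E \<le> rect_outer A B F"
    proof (rule dense_ge)
      fix c assume "rect_outer A B F < c"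
      then show "rect_outer A B E \<le> c"
      proof (rule rect_outer_lessE)
        fix S T assume *: "\<And>i::nat. S i \<in> sets A" "\<And>i. T i \<in> sets B" "F \<subseteq> (\<Union>i. S i \<times> T i)"
          "(\<Sum>i. emeasure A (S i) * emeasure B (T i)) < c"
        have "rect_outer A B E \<le> (\<Sum>i. emeasure A (S i) * emeasure B (T i))"
          by (rule rect_outer_le[OF *(1,2) order_trans[OF \<open>E \<subseteq> F\<close> *(3)]])
        then show ?thesis using *(4) by simp
      qed
    qed
  qed
  show "countably_subadditive (Pow \<Omega>) (rect_outer A B)"
    unfolding countably_subadditive_def
  proof (intro allI impI, rule ennreal_le_epsilon)
    fix E :: "nat \<Rightarrow> _" and e :: real
    assume fin: "(\<Sum>i. rect_outer A B (E i)) < top" and e: "0 < e"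
    have "\<exists>S T. (\<forall>i::nat. S i \<in> sets A) \<and> (\<forall>i. T i \<in> sets B) \<and> E n \<subseteq> (\<Union>i. S i \<times> T i) \<and>
      (\<Sum>i. emeasure A (S i) * emeasure B (T i)) \<le> rect_outer A B (E n) + e * (1/2)^Suc n"
      (is "\<exists>S T. ?Q n S T") for n
    proof -
      have "rect_outer A B (E n) < top"
        using ennreal_suminf_lessD[OF fin] .
      then have "rect_outer A B (E n) < rect_outer A B (E n) + e * (1/2)^Suc n"
        using e by (simp add: ennreal_add_left_cancel_less ennreal_zero_less_mult_iff less_top)
      then show ?thesis
      proof (rule rect_outer_lessE, goal_cases)
        case (1 S T)
        then show ?case by (intro exI[of _ S] exI[of _ T]) (simp add: less_imp_le)
      qed
    qed
    then have "\<forall>n. \<exists>S T. ?Q n S T" by blast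
    from choice[OF this] obtain S where "\<forall>n. \<exists>T. ?Q n (S n) T" ..
    from choice[OF this] obtain T where "\<forall>n. ?Q n (S n) (T n)" ..
    then have ST: "\<And>n i::nat. S n i \<in> sets A" "\<And>n i. T n i \<in> sets B"
      "\<And>n. E n \<subseteq> (\<Union>i. S n i \<times> T n i)"
      "\<And>n. (\<Sum>i. emeasure A (S n i) * emeasure B (T n i)) \<le> rect_outer A B (E n) + e * (1/2)^Suc n"
      by simp_all
    let ?f = "\<lambda>k. prod_decode k"
    have "rect_outer A B (\<Union>i. E i)
        \<le> (\<Sum>k. emeasure A (S (fst (?f k)) (snd (?f k))) * emeasure B (T (fst (?f k)) (snd (?f k))))"
    proof (rule rect_outer_le)
      show "\<Union> (range E) \<subseteq> (\<Union>k. S (fst (?f k)) (snd (?f k)) \<times> T (fst (?f k)) (snd (?f k)))"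
      proof
        fix x assume "x \<in> \<Union> (range E)"
        then obtain n i where "x \<in> S n i \<times> T n i" using ST(3) by blast
        then show "x \<in> (\<Union>k. S (fst (?f k)) (snd (?f k)) \<times> T (fst (?f k)) (snd (?f k)))"
          by (intro UN_I[of "prod_encode (n, i)"]) auto
      qed
    qed (use ST in auto)
    also have "\<dots> = (\<Sum>n. \<Sum>i. emeasure A (S n i) * emeasure B (T n i))"
      using suminf_ennreal_2dimen[of "\<lambda>n. \<Sum>i. emeasure A (S n i) * emeasure B (T n i)"
          "\<lambda>(n, i). emeasure A (S n i) * emeasure B (T n i)"]
      by (simp add: case_prod_beta o_def)
    also have "\<dots> \<le> (\<Sum>n. rect_outer A B (E n) + e * (1/2)^Suc n)"
      by (intro suminf_le ST(4)) auto
    also have "\<dots> = (\<Sum>n. rect_outer A B (E n)) + (\<Sum>n. ennreal (e * (1/2)^Suc n))"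
      by (subst suminf_add) (auto)
    also have "(\<Sum>n. ennreal (e * (1/2)^Suc n)) = ennreal e"
      using e power_half_series
      by (intro suminf_ennreal_eq) (auto intro!: sums_mult[where a="1::real", simplified] dest: sums_mult[of _ _ e])
    finally show "rect_outer A B (\<Union>i. E i) \<le> (\<Sum>i. rect_outer A B (E i)) + ennreal e" .
  qed
qed

lemma measure_space_cprod:
  "measure_space (space A \<times> space B)
    (lambda_system (space A \<times> space B) (Pow (space A \<times> space B)) (rect_outer A B)) (rect_outer A B)"
  by (intro sigma_algebra.caratheodory_lemma sigma_algebra_Pow outer_measure_space_rect_outer)

lemma space_cprod: "space (cprod A B) = space A \<times> space B"
  and sets_cprod: "sets (cprod A B) =
    lambda_system (space A \<times> space B) (Pow (space A \<times> space B)) (rect_outer A B)"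
  and emeasure_cprod: "E \<in> sets (cprod A B) \<Longrightarrow> emeasure (cprod A B) E = rect_outer A B E"
proof -
  have *: "sigma_algebra (space A \<times> space B)
      (lambda_system (space A \<times> space B) (Pow (space A \<times> space B)) (rect_outer A B))"
    using measure_space_cprod[of A B] by (simp add: measure_space_def)
  have sub: "lambda_system (space A \<times> space B) (Pow (space A \<times> space B)) (rect_outer A B)
      \<subseteq> Pow (space A \<times> space B)"
    using lambda_system_sets by blast
  show "space (cprod A B) = space A \<times> space B"
    unfolding cprod_def using sub by (rule space_measure_of)
  show s: "sets (cprod A B) =
      lambda_system (space A \<times> space B) (Pow (space A \<times> space B)) (rect_outer A B)"
    unfolding cprod_def using sigma_algebra.sets_measure_of_eq[OF *] .
  show "emeasure (cprod A B) E = rect_outer A B E" if "E \<in> sets (cprod A B)"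
    using that measure_space_cprod[of A B] unfolding s unfolding cprod_def measure_space_def
    by (intro emeasure_measure_of_sigma) auto
qed

text \<open>Sections of null sets are almost all null, so the section maps below do not depend on the
  chosen representatives.\<close>

lemma rect_outer_null_sections:
  assumes "rect_outer A B E = 0"
  shows "AE x in A. AE y in B. (x, y) \<notin> E"
proof -
  have "\<exists>S T. (\<forall>i::nat. S i \<in> sets A) \<and> (\<forall>i. T i \<in> sets B) \<and> E \<subseteq> (\<Union>i. S i \<times> T i) \<and>
      (\<Sum>i. emeasure A (S i) * emeasure B (T i)) < ennreal (1 / Suc n)"
    (is "\<exists>S T. ?Q n S T") for n :: nat
  proof -
    have "rect_outer A B E < ennreal (1 / Suc n)" by (simp add: assms)
    then show ?thesis
    proof (rule rect_outer_lessE, goal_cases)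
      case (1 S T)
      then show ?case by (intro exI[of _ S] exI[of _ T]) simp
    qed
  qed
  then have "\<forall>n. \<exists>S T. ?Q n S T" by blast
  from choice[OF this] obtain S where "\<forall>n. \<exists>T. ?Q n (S n) T" ..
  from choice[OF this] obtain T where "\<forall>n. ?Q n (S n) (T n)" ..
  then have ST: "\<And>n i::nat. S n i \<in> sets A" "\<And>n i. T n i \<in> sets B"
    "\<And>n. E \<subseteq> (\<Union>i. S n i \<times> T n i)"
    "\<And>n::nat. (\<Sum>i. emeasure A (S n i) * emeasure B (T n i)) < ennreal (1 / Suc n)"
    by simp_all
  note [measurable] = ST(1)
  define g where "g n x = (\<Sum>i. emeasure B (T n i) * indicator (S n i) x)" for n x
  have gm [measurable]: "g n \<in> borel_measurable A" for n
    unfolding g_def by measurable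
  have gi: "(\<integral>\<^sup>+x. g n x \<partial>A) = (\<Sum>i. emeasure A (S n i) * emeasure B (T n i))" for n
    unfolding g_def
    by (subst nn_integral_suminf) (simp_all add: nn_integral_cmult_indicator ST, simp add: mult.commute)
  have "(\<integral>\<^sup>+x. (INF n. g n x) \<partial>A) \<le> ennreal (1 / Suc n)" for n
  proof -
    have "(\<integral>\<^sup>+x. (INF n. g n x) \<partial>A) \<le> (\<integral>\<^sup>+x. g n x \<partial>A)"
      by (intro nn_integral_mono INF_lower) auto
    then show ?thesis using ST(4)[of n] gi[of n] by simp
  qed
  moreover have "(\<lambda>n. ennreal (1 / Suc n)) \<longlonglongrightarrow> ennreal 0"
    using LIMSEQ_inverse_real_of_nat by (intro tendsto_ennrealI) (simp add: divide_inverse)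
  ultimately have "(\<integral>\<^sup>+x. (INF n. g n x) \<partial>A) \<le> ennreal 0"
    by (intro LIMSEQ_le_const) auto
  then have "(\<integral>\<^sup>+x. (INF n. g n x) \<partial>A) = 0" by simp
  then have "AE x in A. (INF n. g n x) = 0"
    by (subst (asm) nn_integral_0_iff_AE) auto
  then show ?thesis
  proof eventually_elim
    fix x assume x: "(INF n. g n x) = 0"
    define U where "U n = (\<Union>i\<in>{i. x \<in> S n i}. T n i)" for n
    have Us: "U n \<in> sets B" for n unfolding U_def using ST(2) by blast
    have "emeasure B (U n) \<le> g n x" for n
    proof -
      have "U n = (\<Union>i. if x \<in> S n i then T n i else {})" by (auto simp: U_def split: if_splits)
      also have "emeasure B \<dots> \<le> (\<Sum>i. emeasure B (if x \<in> S n i then T n i else {}))"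
        by (rule emeasure_subadditive_countably) (use ST(2) in auto)
      also have "\<dots> = g n x" unfolding g_def by (intro suminf_cong) auto
      finally show ?thesis .
    qed
    moreover have "emeasure B (\<Inter>n. U n) \<le> emeasure B (U n)" for n
      by (rule emeasure_mono) (use Us in auto)
    ultimately have "emeasure B (\<Inter>n. U n) \<le> (INF n. g n x)"
      by (intro INF_greatest) (meson order_trans)
    then have "(\<Inter>n. U n) \<in> null_sets B" using x Us by (intro null_setsI) auto
    moreover have "(x, y) \<notin> E" if "y \<notin> (\<Inter>n. U n)" for y
      using that ST(3) by (fastforce simp: U_def)
    ultimately show "AE y in B. (x, y) \<notin> E"
      by (intro AE_I'[of "\<Inter>n. U n"]) auto
  qed
qed

lemma rect_outer_swap_le: "rect_outer B A (prod.swap ` E) \<le> rect_outer A B E"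
proof (rule dense_ge)
  fix c assume "rect_outer A B E < c"
  then show "rect_outer B A (prod.swap ` E) \<le> c"
  proof (rule rect_outer_lessE)
    fix S T assume *: "\<And>i::nat. S i \<in> sets A" "\<And>i. T i \<in> sets B" "E \<subseteq> (\<Union>i. S i \<times> T i)"
      "(\<Sum>i. emeasure A (S i) * emeasure B (T i)) < c"
    have "rect_outer B A (prod.swap ` E) \<le> (\<Sum>i. emeasure B (T i) * emeasure A (S i))"
      by (rule rect_outer_le[OF *(2,1)]) (use *(3) in fastforce)
    then show ?thesis using *(4) by (simp add: mult.commute)
  qed
qed

lemma AE_cprod_sections:
  assumes "AE z in cprod A B. P z"
  shows "AE x in A. AE y in B. P (x, y)" and "AE y in B. AE x in A. P (x, y)"
proof -
  obtain E where E: "E \<in> null_sets (cprod A B)" "{z \<in> space (cprod A B). \<not> P z} \<subseteq> E"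
    using assms by (auto simp: eventually_ae_filter)
  then have 0: "rect_outer A B E = 0" using emeasure_cprod[of E A B] null_setsD1 null_setsD2 by metis
  have P: "x \<in> space A \<Longrightarrow> y \<in> space B \<Longrightarrow> (x, y) \<notin> E \<Longrightarrow> P (x, y)" for x y
    using E(2) by (auto simp: space_cprod)
  show "AE x in A. AE y in B. P (x, y)"
    using rect_outer_null_sections[OF 0] AE_space
  proof eventually_elim
    fix x assume "AE y in B. (x, y) \<notin> E" and x: "x \<in> space A"
    from this(1) AE_space[of B] show "AE y in B. P (x, y)"
      by eventually_elim (use P x in blast)
  qed
  have "rect_outer B A (prod.swap ` E) = 0" using 0 rect_outer_swap_le[of B A E] by simp
  from rect_outer_null_sections[OF this] AE_space
  show "AE y in B. AE x in A. P (x, y)"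
  proof eventually_elim
    fix y assume "AE x in A. (y, x) \<notin> prod.swap ` E" and y: "y \<in> space B"
    from this(1) AE_space[of A] show "AE x in A. P (x, y)"
      by eventually_elim (use P y in force)
  qed
qed

section \<open>Section maps\<close>

definition hat_class :: "'t measure \<Rightarrow> 'm measure \<Rightarrow> ('m \<Rightarrow> 'n) set \<Rightarrow> ('t \<times> 'm \<Rightarrow> 'n) set"
  where "hat_class I M h = ae_class (cprod I M) (\<lambda>(t, x). class_rep h x)"

definition under_class :: "'t measure \<Rightarrow> 'm measure \<Rightarrow> ('m \<Rightarrow> 'n) set \<Rightarrow> ('m \<Rightarrow> ('t \<Rightarrow> 'n) set) set"
  where "under_class I M h = ae_class M (\<lambda>x. ae_class I (\<lambda>t. class_rep h x))"

definition rect_almost_simple_classes ::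
    "'t measure \<Rightarrow> 'm measure \<Rightarrow> 'n set \<Rightarrow> ('n \<Rightarrow> 'n \<Rightarrow> real) \<Rightarrow> ('m \<Rightarrow> 'n) set \<Rightarrow> ('t \<times> 'm \<Rightarrow> 'n) set set"
  where "rect_almost_simple_classes I M N d h = ae_class (cprod I M) `
    {c \<in> cprod I M \<rightarrow>\<^sub>M mborel N d. \<exists>(J :: nat set) y S T.
      finite J \<and>
      (\<forall>j\<in>J. y j \<in> N \<and> S j \<in> sets I \<and> T j \<in> sets M \<and> emeasure (cprod I M) (S j \<times> T j) < \<infinity> \<and>
        (\<forall>z\<in>S j \<times> T j. c z = y j)) \<and>
      disjoint_family_on (\<lambda>j. S j \<times> T j) J \<and>
      (AE z in cprod I M. z \<notin> (\<Union>j\<in>J. S j \<times> T j) \<longrightarrow> c z = class_rep (hat_class I M h) z)}"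

definition sec_fst :: "'t measure \<Rightarrow> 'm measure \<Rightarrow> ('t \<times> 'm \<Rightarrow> 'n) set \<Rightarrow> ('t \<Rightarrow> ('m \<Rightarrow> 'n) set) set"
  where "sec_fst I M C = ae_class I (\<lambda>t. ae_class M (\<lambda>x. class_rep C (t, x)))"

definition sec_snd :: "'t measure \<Rightarrow> 'm measure \<Rightarrow> ('t \<times> 'm \<Rightarrow> 'n) set \<Rightarrow> ('m \<Rightarrow> ('t \<Rightarrow> 'n) set) set"
  where "sec_snd I M C = ae_class M (\<lambda>x. ae_class I (\<lambda>t. class_rep C (t, x)))"

lemma sec_fst_ae_class:
  "sec_fst I M (ae_class (cprod I M) c) = ae_class I (\<lambda>t. ae_class M (\<lambda>x. c (t, x)))"
  unfolding sec_fst_def ae_class_eq_iff by (rule AE_cprod_sections(1)[OF AE_class_rep])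

lemma sec_snd_ae_class:
  "sec_snd I M (ae_class (cprod I M) c) = ae_class M (\<lambda>x. ae_class I (\<lambda>t. c (t, x)))"
  unfolding sec_snd_def ae_class_eq_iff by (rule AE_cprod_sections(2)[OF AE_class_rep])

section \<open>The spaces and maps on both sides\<close>

definition rect_simple_Lp ::
    "'t measure \<Rightarrow> 'm measure \<Rightarrow> 'n set \<Rightarrow> ('n \<Rightarrow> 'n \<Rightarrow> real) \<Rightarrow> real \<Rightarrow> ('m \<Rightarrow> 'n) set \<Rightarrow> ('t \<times> 'm \<Rightarrow> 'n) set set"
  where "rect_simple_Lp I M N d p h =
    rect_almost_simple_classes I M N d h \<inter> Lp (cprod I M) N d p (hat_class I M h)"

text \<open>\<open>E(I, E\<^sub>h(M,N) \<inter> L\<^sup>p\<^sub>h(M,N))\<close>\<close>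

definition simple_curves ::
    "'t measure \<Rightarrow> 'm measure \<Rightarrow> 'n set \<Rightarrow> ('n \<Rightarrow> 'n \<Rightarrow> real) \<Rightarrow> real \<Rightarrow> ('m \<Rightarrow> 'n) set
      \<Rightarrow> ('t \<Rightarrow> ('m \<Rightarrow> 'n) set) set set"
  where "simple_curves I M N d p h =
    simple_classes I (almost_simple_classes M N d h \<inter> Lp M N d p h) (Lp_dist M d p)"

text \<open>\<open>L\<^sup>p(I, L\<^sup>p\<^sub>h(M,N))\<close>\<close>

definition Lp_curves ::
    "'t measure \<Rightarrow> 'm measure \<Rightarrow> 'n set \<Rightarrow> ('n \<Rightarrow> 'n \<Rightarrow> real) \<Rightarrow> real \<Rightarrow> ('m \<Rightarrow> 'n) set
      \<Rightarrow> ('t \<Rightarrow> ('m \<Rightarrow> 'n) set) set set"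
  where "Lp_curves I M N d p h = Lp_const I (Lp M N d p h) (Lp_dist M d p) p"

text \<open>\<open>L\<^sup>p\<close> maps from \<open>M\<close> to \<open>L\<^sup>p(I,N)\<close>, with base map the constant curves given by \<open>h\<close>\<close>

definition Lp_fields ::
    "'t measure \<Rightarrow> 'm measure \<Rightarrow> 'n set \<Rightarrow> ('n \<Rightarrow> 'n \<Rightarrow> real) \<Rightarrow> real \<Rightarrow> ('m \<Rightarrow> 'n) set
      \<Rightarrow> ('m \<Rightarrow> ('t \<Rightarrow> 'n) set) set set"
  where "Lp_fields I M N d p h = Lp M (Lp_const I N d p) (Lp_dist I d p) p (under_class I M h)"

text \<open>
  Almost simple such maps with values in \<open>E(I,N)\<close>. Pitfall: every element of this set is the image
  under \<^const>\<open>sec_snd\<close> of an element of \<^const>\<open>rect_simple_Lp\<close>, but \<^const>\<open>sec_snd\<close> need not map all of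
  \<^const>\<open>rect_simple_Lp\<close> into it when \<open>h\<close> takes infinitely many values. For instance, take
  \<open>I = M = [0,1]\<close>, \<open>N = \<real>\<close>, \<open>h x = x\<close>, and let \<open>c (t, x)\<close> be \<open>0\<close> for \<open>t \<le> 1/2\<close> and \<open>h x\<close> otherwise:
  distinct \<open>x\<close> give distinct sections, none of them constant for \<open>x \<noteq> 0\<close>.
\<close>

definition simple_fields ::
    "'t measure \<Rightarrow> 'm measure \<Rightarrow> 'n set \<Rightarrow> ('n \<Rightarrow> 'n \<Rightarrow> real) \<Rightarrow> real \<Rightarrow> ('m \<Rightarrow> 'n) set
      \<Rightarrow> ('m \<Rightarrow> ('t \<Rightarrow> 'n) set) set set"
  where "simple_fields I M N d p h =
    almost_simple_classes M (simple_classes I N d) (Lp_dist I d p) (under_class I M h)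
      \<inter> Lp_fields I M N d p h"

definition curve_dist ::
    "'t measure \<Rightarrow> 'm measure \<Rightarrow> ('n \<Rightarrow> 'n \<Rightarrow> real) \<Rightarrow> real
      \<Rightarrow> ('t \<Rightarrow> ('m \<Rightarrow> 'n) set) set \<Rightarrow> ('t \<Rightarrow> ('m \<Rightarrow> 'n) set) set \<Rightarrow> real"
  where "curve_dist I M d p = Lp_dist I (Lp_dist M d p) p"

definition field_dist ::
    "'t measure \<Rightarrow> 'm measure \<Rightarrow> ('n \<Rightarrow> 'n \<Rightarrow> real) \<Rightarrow> real
      \<Rightarrow> ('m \<Rightarrow> ('t \<Rightarrow> 'n) set) set \<Rightarrow> ('m \<Rightarrow> ('t \<Rightarrow> 'n) set) set \<Rightarrow> real"
  where "field_dist I M d p = Lp_dist M (Lp_dist I d p) p"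

definition sec_fst_ext ::
    "'t measure \<Rightarrow> 'm measure \<Rightarrow> 'n set \<Rightarrow> ('n \<Rightarrow> 'n \<Rightarrow> real) \<Rightarrow> real \<Rightarrow> ('m \<Rightarrow> 'n) set
      \<Rightarrow> ('t \<times> 'm \<Rightarrow> 'n) set \<Rightarrow> ('t \<Rightarrow> ('m \<Rightarrow> 'n) set) set"
  where "sec_fst_ext I M N d p h =
    isometric_extension (rect_simple_Lp I M N d p h) (sec_fst I M)
      (Lp (cprod I M) N d p (hat_class I M h)) (Lp_dist (cprod I M) d p)
      (Lp_curves I M N d p h) (curve_dist I M d p)"

definition sec_snd_ext ::
    "'t measure \<Rightarrow> 'm measure \<Rightarrow> 'n set \<Rightarrow> ('n \<Rightarrow> 'n \<Rightarrow> real) \<Rightarrow> real \<Rightarrow> ('m \<Rightarrow> 'n) set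
      \<Rightarrow> ('t \<times> 'm \<Rightarrow> 'n) set \<Rightarrow> ('m \<Rightarrow> ('t \<Rightarrow> 'n) set) set"
  where "sec_snd_ext I M N d p h =
    isometric_extension (rect_simple_Lp I M N d p h) (sec_snd I M)
      (Lp (cprod I M) N d p (hat_class I M h)) (Lp_dist (cprod I M) d p)
      (Lp_fields I M N d p h) (field_dist I M d p)"

definition i_map ::
    "'t measure \<Rightarrow> 'm measure \<Rightarrow> 'n set \<Rightarrow> ('n \<Rightarrow> 'n \<Rightarrow> real) \<Rightarrow> real \<Rightarrow> ('m \<Rightarrow> 'n) set
      \<Rightarrow> ('t \<Rightarrow> ('m \<Rightarrow> 'n) set) set \<Rightarrow> ('m \<Rightarrow> ('t \<Rightarrow> 'n) set) set"
  where "i_map I M N d p h =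
    sec_snd I M \<circ> inv_into (rect_simple_Lp I M N d p h) (sec_fst I M)"

definition i_ext ::
    "'t measure \<Rightarrow> 'm measure \<Rightarrow> 'n set \<Rightarrow> ('n \<Rightarrow> 'n \<Rightarrow> real) \<Rightarrow> real \<Rightarrow> ('m \<Rightarrow> 'n) set
      \<Rightarrow> ('t \<Rightarrow> ('m \<Rightarrow> 'n) set) set \<Rightarrow> ('m \<Rightarrow> ('t \<Rightarrow> 'n) set) set"
  where "i_ext I M N d p h =
    sec_snd_ext I M N d p h \<circ>
      inv_into (Lp (cprod I M) N d p (hat_class I M h)) (sec_fst_ext I M N d p h)"

end

theory Submission
  imports Defs
begin

text \<open>
  Both section maps preserve distances on the rectangular almost simple classes, because for maps
  with finitely many different sections \<open>c (t, _)\<close> Fubini's theorem is a finite sum of products and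
  needs no \<open>\<sigma>\<close>-finiteness. These classes are dense in \<open>L\<^sup>p\<close> of the product, and their images contain the
  simple curves and the almost simple fields, which are dense in the two target spaces. As \<open>L\<^sup>p\<close>
  spaces over a complete space are complete, each section map extends uniquely to an isometry onto
  its target, and the extension of \<open>i\<^sub>p\<close> is the composite of one extension with the inverse of the other.
\<close>

section \<open>Measurable maps with separable range\<close>

text \<open>The obstacle is that \<open>M\<close> need not be \<sigma>-finite, so Fubini cannot be
  applied to an arbitrary map on the product. The section maps are therefore computed only on step
  maps, where both iterated integrals are explicit, and the rest is density and completeness. Step
  maps must be rich enough to be dense and to produce all simple curves and all simple fields.

  The two sides are not symmetric: \<open>sec_snd\<close> may send a step map outside the almost
  simple fields when \<open>h\<close> takes infinitely many values. So its image is only known to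
  contain the simple fields and to lie in the full space of fields. A dense image is all that the
  extension argument uses.

  A second obstacle is that \<open>h\<close> may be unbounded. Approximating level sets by
  rectangles leaves a small exceptional set, and the error there is controlled only after truncating
  to points where \<open>h\<close> stays near a fixed point of \<open>N\<close>.

  Separable ranges serve to make the distance between two maps measurable.\<close>

context Metric_space
begin

lemma space_mborel: "space (mborel M d) = M"
  unfolding mborel_def by (rule space_measure_of) (auto simp: openin_mtopology)

lemma sets_mborel: "sets (mborel M d) = sigma_sets M {U. openin mtopology U}"
  unfolding mborel_def by (rule sets_measure_of) (auto simp: openin_mtopology)

lemma mball_in_mborel: "mball x r \<in> sets (mborel M d)"
  unfolding sets_mborel by (intro sigma_sets.Basic) simp

lemma singleton_in_mborel:
  assumes "z \<in> M" shows "{z} \<in> sets (mborel M d)"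
proof -
  have "{z} = (\<Inter>n. mball z (1 / Suc n))"
  proof (intro equalityI subsetI)
    fix y assume y: "y \<in> (\<Inter>n. mball z (1 / Suc n))"
    then have "y \<in> M" "\<And>n. d z y < 1 / Suc n" by auto
    then have "d z y = 0"
      using nat_approx_posE[of "d z y"] nonneg[of z y] by (metis less_asym' order_le_less)
    then show "y \<in> {z}" using assms \<open>y \<in> M\<close> by simp
  qed (use assms in auto)
  also have "\<dots> \<in> sets (mborel M d)"
    using mball_in_mborel by (intro sets.countable_INT) auto
  finally show ?thesis .
qed

lemma measurable_mborel_dist:
  assumes f: "f \<in> Y \<rightarrow>\<^sub>M mborel M d" and z: "z \<in> M"
  shows "(\<lambda>y. d (f y) z) \<in> borel_measurable Y"
  unfolding borel_measurable_iff_less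
proof
  fix r
  have "{y \<in> space Y. d (f y) z < r} = f -` mball z r \<inter> space Y"
    using measurable_space[OF f] z by (auto simp: space_mborel commute)
  then show "{y \<in> space Y. d (f y) z < r} \<in> sets Y"
    using measurable_sets[OF f mball_in_mborel] by simp
qed

text \<open>The preimage of an open set \<open>U\<close> is the countable union of the sets
  \<open>{y. d (f y) z < q}\<close> over \<open>z\<close> in \<open>D\<close> and rational
  \<open>q\<close> with \<open>mball z q\<close> inside \<open>U\<close>, so distances to
  \<open>D\<close> decide measurability. Being stated through distances alone, the criterion suits
  maps into L^p spaces, whose open sets are not accessible directly.\<close>

lemma L0_mapsI:
  assumes f: "f \<in> space Y \<rightarrow> M" and D: "countable D" "D \<subseteq> M"
    and near: "\<And>y e. y \<in> space Y \<Longrightarrow> 0 < e \<Longrightarrow> \<exists>z\<in>D. d (f y) z < e"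
    and meas: "\<And>z. z \<in> D \<Longrightarrow> (\<lambda>y. d (f y) z) \<in> borel_measurable Y"
  shows "f \<in> L0_maps Y M d"
proof -
  have "f -` U \<inter> space Y \<in> sets Y" if U: "openin mtopology U" for U
  proof -
    define P where "P = {(z, q). z \<in> D \<and> q \<in> \<rat> \<and> mball z q \<subseteq> U}"
    have "f -` U \<inter> space Y = (\<Union>(z, q)\<in>P. {y \<in> space Y. d (f y) z < q})"
    proof (intro equalityI subsetI)
      fix y assume y: "y \<in> f -` U \<inter> space Y"
      then obtain r where r: "r > 0" "mball (f y) r \<subseteq> U"
        using U by (auto simp: openin_mtopology)
      obtain z where z: "z \<in> D" "d (f y) z < r / 2" using near[of y "r/2"] y r by auto
      obtain q where q: "q \<in> \<rat>" "d (f y) z < q" "q < r / 2" using Rats_dense_in_real[OF z(2)] by auto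
      have "mball z q \<subseteq> mball (f y) r"
        by (rule mball_subset) (use q z y f in \<open>auto simp: commute\<close>)
      then show "y \<in> (\<Union>(z, q)\<in>P. {y \<in> space Y. d (f y) z < q})"
        using r q z y by (intro UN_I[of "(z, q)"]) (auto simp: P_def)
    next
      fix y assume "y \<in> (\<Union>(z, q)\<in>P. {y \<in> space Y. d (f y) z < q})"
      then obtain z q where "z \<in> D" "mball z q \<subseteq> U" "y \<in> space Y" "d (f y) z < q" by (auto simp: P_def)
      moreover from this have "f y \<in> mball z q" using f D by (auto simp: commute)
      ultimately show "y \<in> f -` U \<inter> space Y" by auto
    qed
    also have "\<dots> \<in> sets Y"
    proof (rule sets.countable_UN'')
      have "P \<subseteq> D \<times> \<rat>" by (auto simp: P_def)
      then show "countable P" using D countable_rat by (meson countable_SIGMA countable_subset)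
    qed (use meas in \<open>auto simp: P_def\<close>)
    finally show ?thesis .
  qed
  then have m: "f \<in> Y \<rightarrow>\<^sub>M mborel M d"
    unfolding mborel_def by (intro measurable_measure_of) (use f in \<open>auto simp: openin_mtopology\<close>)
  \<comment> \<open>\<open>D\<close> need not lie in the range of \<open>f\<close>, whereas
    separability of the subspace asks for range points. Each \<open>z\<close> in \<open>D\<close> is
    replaced, at every scale \<open>1 / Suc n\<close>, by a range point that close to it whenever
    one exists.\<close>
  define s where "s = (\<lambda>(z, n::nat). SOME w. w \<in> f ` space Y \<and> d w z < 1 / Suc n)"
  define C where "C = s ` {(z, n). z \<in> D \<and> (\<exists>w \<in> f ` space Y. d w z < 1 / Suc n)}"
  have s: "s (z, n) \<in> f ` space Y \<and> d (s (z, n)) z < 1 / Suc n"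
    if "\<exists>w \<in> f ` space Y. d w z < 1 / Suc n" for z n
    unfolding s_def prod.case by (rule someI_ex) (use that in blast)
  have C: "C \<subseteq> f ` space Y" using s by (auto simp: C_def)
  have "countable C" unfolding C_def
    by (intro countable_image countable_subset[OF _ countable_SIGMA[of D "\<lambda>_. UNIV"]]) (use D in auto)
  have "\<exists>w\<in>C. d (f y) w < e" if y: "y \<in> space Y" and e: "0 < e" for y e
  proof -
    obtain n where n: "1 / Suc n < e / 2" using nat_approx_posE[of "e/2"] e by auto
    obtain z where z: "z \<in> D" "d (f y) z < 1 / Suc n" using near[of y "1 / Suc n"] y by auto
    have ex: "\<exists>w \<in> f ` space Y. d w z < 1 / Suc n" using z y by blast
    have "d (f y) (s (z, n)) \<le> d (f y) z + d (s (z, n)) z"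
      using s[OF ex] f y z D by (intro triangle') auto
    also have "\<dots> < e" using s[OF ex] z n by simp
    finally show ?thesis using ex z by (auto simp: C_def)
  qed
  note near_C = this
  have "f ` space Y \<subseteq> mtopology closure_of C"
    unfolding metric_closure_of
  proof (intro subsetI CollectI conjI allI impI)
    fix v assume "v \<in> f ` space Y"
    then obtain y where y: "y \<in> space Y" "v = f y" by auto
    then show "v \<in> M" using f by auto
    fix r :: real assume r: "0 < r"
    obtain w where "w \<in> C" "d (f y) w < r" using near_C[OF y(1) r] by blast
    then show "\<exists>w\<in>C. w \<in> mball v r" using C f y by auto
  qed
  then have "subtopology mtopology (f ` space Y) closure_of C = f ` space Y"
    using C by (simp add: closure_of_subtopology Int_absorb1 Int_absorb2)
  with \<open>countable C\<close> have "separable_space (subtopology mtopology (f ` space Y))"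
    unfolding separable_space_def using f C by (intro exI[of _ C]) auto
  then show ?thesis using m by (simp add: L0_maps_def)
qed

lemma L0_mapsD:
  assumes "f \<in> L0_maps Y M d"
  shows L0_maps_funcset: "f \<in> space Y \<rightarrow> M"
    and L0_maps_dist: "z \<in> M \<Longrightarrow> (\<lambda>y. d (f y) z) \<in> borel_measurable Y"
    and L0_maps_measurable: "f \<in> Y \<rightarrow>\<^sub>M mborel M d"
proof -
  show f: "f \<in> Y \<rightarrow>\<^sub>M mborel M d" using assms by (simp add: L0_maps_def)
  show "f \<in> space Y \<rightarrow> M" using measurable_space[OF f] by (auto simp: space_mborel)
  show "z \<in> M \<Longrightarrow> (\<lambda>y. d (f y) z) \<in> borel_measurable Y"
    using measurable_mborel_dist[OF f] .
qed

lemma L0_maps_dense: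
  assumes f: "f \<in> L0_maps Y M d"
  obtains D where "countable D" "D \<subseteq> f ` space Y" "D \<subseteq> M"
    "\<And>y e. y \<in> space Y \<Longrightarrow> 0 < e \<Longrightarrow> \<exists>z\<in>D. d (f y) z < e"
proof -
  have "separable_space (subtopology mtopology (f ` space Y))" using f by (simp add: L0_maps_def)
  moreover have fM: "f ` space Y \<subseteq> M" using L0_maps_funcset[OF f] by auto
  ultimately obtain C where C: "countable C" "C \<subseteq> f ` space Y"
      "subtopology mtopology (f ` space Y) closure_of C = f ` space Y"
    unfolding separable_space_def by (auto simp: Int_absorb1)
  then have "f ` space Y \<subseteq> mtopology closure_of C"
    by (metis closure_of_subtopology_subset)
  then have "f ` space Y \<subseteq> {x \<in> M. \<forall>r>0. \<exists>y\<in>C. y \<in> mball x r}"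
    unfolding metric_closure_of .
  then have "\<exists>z\<in>C. d (f y) z < e" if "y \<in> space Y" "0 < e" for y e
    using that by fastforce
  then show thesis using that[OF C(1,2)] C(2) fM by blast
qed

text \<open>\<open>L0_mapsI\<close> sees only distances to countably many points, and these are the
  same in a subspace. Together with the next lemma this moves a map between a space and a subset of
  it without comparing Borel sets.\<close>

lemma L0_maps_subset:
  assumes f: "f \<in> L0_maps Y M d" and W: "f \<in> space Y \<rightarrow> W" and WM: "W \<subseteq> M"
  shows "f \<in> L0_maps Y W d"
proof -
  interpret W: Metric_space W d using subspace[OF WM] .
  obtain D where D: "countable D" "D \<subseteq> f ` space Y" "D \<subseteq> M"
    "\<And>y e. y \<in> space Y \<Longrightarrow> 0 < e \<Longrightarrow> \<exists>z\<in>D. d (f y) z < e" by (rule L0_maps_dense[OF f]) blast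
  show ?thesis
  proof (rule W.L0_mapsI[OF W D(1) _ D(4)])
    show "D \<subseteq> W" using D W by auto
  qed (use L0_maps_dist[OF f] D in auto)
qed

lemma L0_maps_superset:
  assumes f: "f \<in> L0_maps Y W d" and WM: "W \<subseteq> M"
  shows "f \<in> L0_maps Y M d"
proof -
  interpret W: Metric_space W d using subspace[OF WM] .
  obtain D where D: "countable D" "D \<subseteq> f ` space Y" "D \<subseteq> W"
    "\<And>y e. y \<in> space Y \<Longrightarrow> 0 < e \<Longrightarrow> \<exists>z\<in>D. d (f y) z < e" by (rule W.L0_maps_dense[OF f]) blast
  show ?thesis
    by (rule L0_mapsI[OF _ D(1) _ D(4)]) (use W.L0_maps_funcset[OF f] W.L0_maps_dist[OF f] D WM in auto)
qed

lemma L0_maps_finite_range: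
  assumes f: "f \<in> Y \<rightarrow>\<^sub>M mborel M d" and fin: "finite (f ` space Y)"
  shows "f \<in> L0_maps Y M d"
proof (rule L0_mapsI[OF _ countable_finite[OF fin]])
  show fM: "f \<in> space Y \<rightarrow> M" using measurable_space[OF f] by (auto simp: space_mborel)
  show sub: "f ` space Y \<subseteq> M" using fM by auto
  show "\<exists>z\<in>f ` space Y. d (f y) z < e" if "y \<in> space Y" "0 < e" for y e
    using that sub by (intro bexI[of _ "f y"]) auto
qed (use measurable_mborel_dist[OF f] measurable_space[OF f] in \<open>auto simp: space_mborel\<close>)

text \<open>\<open>simple_function\<close> requires only that each value be taken on a measurable
  set and ignores the metric on the target. With its converse below it allows composing with
  arbitrary functions on values, such as passing from functions to classes.\<close>

lemma L0_maps_simple_function: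
  assumes "simple_function Y f" "f \<in> space Y \<rightarrow> M"
  shows "f \<in> L0_maps Y M d"
proof (rule L0_maps_finite_range)
  show "f \<in> Y \<rightarrow>\<^sub>M mborel M d"
  proof (rule measurableI)
    fix U assume "U \<in> sets (mborel M d)"
    show "f -` U \<inter> space Y \<in> sets Y"
      using measurable_simple_function[OF assms(1)] by (auto intro: measurable_sets)
  qed (use assms(2) space_mborel in auto)
qed (use assms(1) in \<open>simp add: simple_function_def\<close>)

lemma L0_maps_simple_functionD:
  assumes f: "f \<in> Y \<rightarrow>\<^sub>M mborel M d" and fin: "finite (f ` space Y)"
  shows "simple_function Y f"
  unfolding simple_function_def
  using fin measurable_sets[OF f singleton_in_mborel] measurable_space[OF f]
  by (auto simp: space_mborel)

lemma L0_maps_const: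
  assumes "z \<in> M" shows "(\<lambda>_. z) \<in> L0_maps Y M d"
  by (rule L0_maps_simple_function) (use assms in auto)

section \<open>Closure properties of measurable maps with separable range\<close>

lemma L0_maps_compose:
  assumes f: "f \<in> L0_maps Y M d" and g: "g \<in> X \<rightarrow>\<^sub>M Y"
  shows "(\<lambda>x. f (g x)) \<in> L0_maps X M d"
proof -
  obtain D where D: "countable D" "D \<subseteq> f ` space Y" "D \<subseteq> M"
    "\<And>y e. y \<in> space Y \<Longrightarrow> 0 < e \<Longrightarrow> \<exists>z\<in>D. d (f y) z < e" by (rule L0_maps_dense[OF f]) blast
  show ?thesis
  proof (rule L0_mapsI[OF _ D(1,3)])
    show "(\<lambda>x. d (f (g x)) z) \<in> borel_measurable X" if "z \<in> D" for z
      using measurable_compose[OF g L0_maps_dist[OF f]] that D(3) by auto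
  qed (use L0_maps_funcset[OF f] measurable_space[OF g] D(4) in auto)
qed

lemma L0_maps_If:
  assumes f: "f \<in> L0_maps Y M d" and g: "g \<in> L0_maps Y M d" and A: "{y \<in> space Y. P y} \<in> sets Y"
  shows "(\<lambda>y. if P y then f y else g y) \<in> L0_maps Y M d"
proof -
  obtain D where D: "countable D" "D \<subseteq> f ` space Y" "D \<subseteq> M"
    "\<And>y e. y \<in> space Y \<Longrightarrow> 0 < e \<Longrightarrow> \<exists>z\<in>D. d (f y) z < e" by (rule L0_maps_dense[OF f]) blast
  obtain E where E: "countable E" "E \<subseteq> g ` space Y" "E \<subseteq> M"
    "\<And>y e. y \<in> space Y \<Longrightarrow> 0 < e \<Longrightarrow> \<exists>z\<in>E. d (g y) z < e" by (rule L0_maps_dense[OF g]) blast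
  show ?thesis
  proof (rule L0_mapsI[of _ _ "D \<union> E"])
    fix z assume "z \<in> D \<union> E"
    then have "z \<in> M" using D E by auto
    then have "(\<lambda>y. if P y then d (f y) z else d (g y) z) \<in> borel_measurable Y"
      using A L0_maps_dist[OF f] L0_maps_dist[OF g] by (intro measurable_If) auto
    then show "(\<lambda>y. d (if P y then f y else g y) z) \<in> borel_measurable Y"
      by (simp add: if_distrib[of "\<lambda>w. d w z"])
  next
    fix y e assume y: "y \<in> space Y" and e: "0 < (e::real)"
    show "\<exists>z\<in>D \<union> E. d (if P y then f y else g y) z < e"
      using D(4)[OF y e] E(4)[OF y e] by auto
  qed (use D(1,3) E(1,3) L0_maps_funcset[OF f] L0_maps_funcset[OF g] in auto)
qed

text \<open>The union of countable sets approximating the terms approximates the limit, and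
  distances to a fixed point pass to the pointwise limit.\<close>

lemma L0_maps_LIMSEQ:
  assumes f: "\<And>n::nat. f n \<in> L0_maps Y M d" and g: "g \<in> space Y \<rightarrow> M"
    and lim: "\<And>y. y \<in> space Y \<Longrightarrow> (\<lambda>n. d (f n y) (g y)) \<longlonglongrightarrow> 0"
  shows "g \<in> L0_maps Y M d"
proof -
  have "\<forall>n. \<exists>D. countable D \<and> D \<subseteq> M \<and> (\<forall>y\<in>space Y. \<forall>e>0. \<exists>z\<in>D. d (f n y) z < e)"
    using L0_maps_dense[OF f] by metis
  then obtain D where D: "\<And>n. countable (D n)" "\<And>n. D n \<subseteq> M"
    "\<And>n y e. y \<in> space Y \<Longrightarrow> 0 < e \<Longrightarrow> \<exists>z\<in>D n. d (f n y) z < e" by metis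
  have fM: "f n y \<in> M" if "y \<in> space Y" for n y using L0_maps_funcset[OF f] that by auto
  show ?thesis
  proof (rule L0_mapsI[of _ _ "\<Union>n. D n"])
    fix y e assume y: "y \<in> space Y" and e: "0 < (e::real)"
    have "eventually (\<lambda>n. d (f n y) (g y) < e / 2) sequentially"
      using order_tendstoD(2)[OF lim[OF y], of "e/2"] e by simp
    then obtain n where n: "d (f n y) (g y) < e / 2" by (auto simp: eventually_sequentially)
    obtain z where z: "z \<in> D n" "d (f n y) z < e / 2" using D(3)[OF y, of "e/2"] e by auto
    have "d (g y) z \<le> d (f n y) (g y) + d (f n y) z"
      using fM[OF y] y g z D(2) by (intro triangle'') blast+
    then show "\<exists>z\<in>\<Union>n. D n. d (g y) z < e" using z n by (intro bexI[of _ z]) auto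
  next
    fix z assume "z \<in> (\<Union>n. D n)"
    then have z: "z \<in> M" using D(2) by auto
    show "(\<lambda>y. d (g y) z) \<in> borel_measurable Y"
    proof (rule borel_measurable_LIMSEQ_real)
      fix y assume y: "y \<in> space Y"
      show "(\<lambda>n. d (f n y) z) \<longlonglongrightarrow> d (g y) z"
      proof (rule LIM_zero_cancel, rule Lim_null_comparison[OF _ lim[OF y]])
        have "\<bar>d (f n y) z - d z (g y)\<bar> \<le> d (f n y) (g y)" for n
          by (rule mdist_reverse_triangle) (use fM y g z in auto)
        then show "\<forall>\<^sub>F n in sequentially. norm (d (f n y) z - d (g y) z) \<le> d (f n y) (g y)"
          by (simp add: commute)
      qed
    qed (use L0_maps_dist[OF f z] in auto)
  qed (use g D in auto)
qed

text \<open>Separability of the range of \<open>f\<close> lets the triangle inequality be tested on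
  countably many points: \<open>d (f y) (g y) < r\<close> holds iff some \<open>z\<close> in
  \<open>D\<close> and some rational \<open>q\<close> satisfy \<open>d (f y) z < q\<close> and
  \<open>d (g y) z < r - q\<close>.\<close>

lemma borel_measurable_L0_dist:
  assumes f: "f \<in> L0_maps Y M d" and g: "g \<in> L0_maps Y M d"
  shows "(\<lambda>y. d (f y) (g y)) \<in> borel_measurable Y"
proof -
  obtain D where D: "countable D" "D \<subseteq> f ` space Y" "D \<subseteq> M"
    "\<And>y e. y \<in> space Y \<Longrightarrow> 0 < e \<Longrightarrow> \<exists>z\<in>D. d (f y) z < e" by (rule L0_maps_dense[OF f]) blast
  have fM: "f y \<in> M" "g y \<in> M" if "y \<in> space Y" for y
    using L0_maps_funcset[OF f] L0_maps_funcset[OF g] that by auto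
  show ?thesis
    unfolding borel_measurable_iff_less
  proof
    fix r
    have "{y \<in> space Y. d (f y) (g y) < r}
        = (\<Union>(z, q)\<in>D \<times> \<rat>. {y \<in> space Y. d (f y) z < q} \<inter> {y \<in> space Y. d (g y) z < r - q})"
    proof (intro equalityI subsetI)
      fix y assume "y \<in> {y \<in> space Y. d (f y) (g y) < r}"
      then have y: "y \<in> space Y" and r: "0 < (r - d (f y) (g y)) / 2" by auto
      obtain z where z: "z \<in> D" "d (f y) z < (r - d (f y) (g y)) / 2" using D(4)[OF y r] by auto
      obtain q where q: "q \<in> \<rat>" "d (f y) z < q" "q < (r - d (f y) (g y)) / 2"
        using Rats_dense_in_real[OF z(2)] by auto
      have "d (g y) z \<le> d (f y) (g y) + d (f y) z"
        using fM[OF y] z D by (intro triangle'') auto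
      then have "d (g y) z < r - q" using q z(2) by argo
      then show "y \<in> (\<Union>(z, q)\<in>D \<times> \<rat>. {y \<in> space Y. d (f y) z < q} \<inter> {y \<in> space Y. d (g y) z < r - q})"
        using y z q by (intro UN_I[of "(z, q)"]) auto
    next
      fix y assume "y \<in> (\<Union>(z, q)\<in>D \<times> \<rat>. {y \<in> space Y. d (f y) z < q} \<inter> {y \<in> space Y. d (g y) z < r - q})"
      then obtain z q where zq: "z \<in> D" "y \<in> space Y" "d (f y) z < q" "d (g y) z < r - q" by auto
      have "d (f y) (g y) \<le> d (f y) z + d (g y) z"
        using fM[OF zq(2)] zq D by (intro triangle') auto
      then show "y \<in> {y \<in> space Y. d (f y) (g y) < r}" using zq by auto
    qed
    also have "\<dots> \<in> sets Y"
    proof (rule sets.countable_UN'')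
      show "countable (D \<times> \<rat>)" using D(1) countable_rat by blast
      fix zq assume "zq \<in> D \<times> (\<rat> :: real set)"
      then have "fst zq \<in> M" using D(3) by auto
      from L0_maps_dist[OF f this] L0_maps_dist[OF g this]
      show "(case zq of (z, q) \<Rightarrow> {y \<in> space Y. d (f y) z < q} \<inter> {y \<in> space Y. d (g y) z < r - q}) \<in> sets Y"
        by (auto split: prod.splits)
    qed
    finally show "{y \<in> space Y. d (f y) (g y) < r} \<in> sets Y" .
  qed
qed

end

section \<open>The metric of \<open>L\<^sup>p\<close> spaces\<close>

text \<open>Convexity up to the boundary point 0: when one argument vanishes the claim reduces to
  \<open>k powr p \<le> k\<close> for \<open>k\<close> in the unit interval.\<close>

lemma powr_convex_nonneg:
  fixes u v l p :: real
  assumes "0 \<le> u" "0 \<le> v" "0 < l" "l < 1" "1 \<le> p"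
  shows "(l * u + (1 - l) * v) powr p \<le> l * u powr p + (1 - l) * v powr p"
proof -
  have scale: "(k * w) powr p \<le> k * w powr p" if "0 \<le> k" "k \<le> 1" "0 \<le> w" for k w
  proof -
    have "k powr p \<le> k powr 1" by (rule powr_mono'[OF assms(5) that(1,2)])
    also have "\<dots> = k" using that(1) by simp
    finally have "k powr p * w powr p \<le> k * w powr p" by (rule mult_right_mono) simp
    then show ?thesis using that by (simp add: powr_mult)
  qed
  consider "u = 0" | "v = 0" | "0 < u" "0 < v" using assms by fastforce
  then show ?thesis
  proof cases
    case 1 then show ?thesis using scale[of "1 - l" v] assms by simp
  next
    case 2 then show ?thesis using scale[of l u] assms by simp
  next
    case 3
    from convex_onD[OF powr_convex[OF assms(5)], of "1 - l" u v] show ?thesis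
      using 3 assms by simp
  qed
qed

text \<open>Convexity of \<open>t\<^sup>p\<close>, applied to \<open>(x + y) / (a + b)\<close> as a convex combination of \<open>x / a\<close> and \<open>y / b\<close>.\<close>

lemma powr_add_le_weighted:
  fixes x y a b p :: real
  assumes "0 \<le> x" "0 \<le> y" "0 < a" "0 < b" "1 \<le> p"
  shows "(x + y) powr p \<le> (a + b) powr p * (a / (a + b) / a powr p * x powr p + b / (a + b) / b powr p * y powr p)"
proof -
  define l where "l = a / (a + b)"
  have l: "0 < l" "l < 1" "1 - l = b / (a + b)" using assms by (auto simp: l_def field_simps)
  have "l * (x / a) = x / (a + b)" "(1 - l) * (y / b) = y / (a + b)"
    using assms unfolding l(3) by (simp_all add: l_def)
  then have "l * (x / a) + (1 - l) * (y / b) = (x + y) / (a + b)"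
    by (simp add: add_divide_distrib)
  then have "((x + y) / (a + b)) powr p \<le> l * (x / a) powr p + (1 - l) * (y / b) powr p"
    using powr_convex_nonneg[of "x / a" "y / b" l p] assms l by simp
  then have "(x + y) powr p / (a + b) powr p \<le> l / a powr p * x powr p + (1 - l) / b powr p * y powr p"
    using assms by (simp add: powr_divide)
  then show ?thesis
    using assms unfolding l(3) by (simp add: l_def pos_divide_le_eq mult.commute)
qed

text \<open>The weights \<open>s\<close> and \<open>t\<close> of the pointwise convexity bound
  satisfy \<open>s * a powr p + t * b powr p = (a + b) powr p\<close>, so integrating that bound
  finishes. Positive upper bounds \<open>a\<close> and \<open>b\<close> in place of the norms avoid
  dividing by a norm that is zero.\<close>

lemma nn_integral_Minkowski:
  fixes f g :: "'y \<Rightarrow> real"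
  assumes [measurable]: "f \<in> borel_measurable Y" "g \<in> borel_measurable Y"
    and nn: "\<And>y. 0 \<le> f y" "\<And>y. 0 \<le> g y" and "0 < a" "0 < b" "1 \<le> p"
    and fa: "(\<integral>\<^sup>+y. ennreal (f y powr p) \<partial>Y) \<le> ennreal (a powr p)"
    and gb: "(\<integral>\<^sup>+y. ennreal (g y powr p) \<partial>Y) \<le> ennreal (b powr p)"
  shows "(\<integral>\<^sup>+y. ennreal ((f y + g y) powr p) \<partial>Y) \<le> ennreal ((a + b) powr p)"
proof -
  define s t where "s = (a + b) powr p * (a / (a + b) / a powr p)"
    and "t = (a + b) powr p * (b / (a + b) / b powr p)"
  have st: "0 \<le> s" "0 \<le> t" using assms(5,6) by (auto simp: s_def t_def)
  have "(\<integral>\<^sup>+y. ennreal ((f y + g y) powr p) \<partial>Y)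
      \<le> (\<integral>\<^sup>+y. ennreal s * ennreal (f y powr p) + ennreal t * ennreal (g y powr p) \<partial>Y)"
  proof (rule nn_integral_mono)
    fix y
    have "(f y + g y) powr p \<le> s * f y powr p + t * g y powr p"
      using powr_add_le_weighted[OF nn(1)[of y] nn(2)[of y] assms(5,6,7)]
      by (simp add: s_def t_def algebra_simps)
    then show "ennreal ((f y + g y) powr p) \<le> ennreal s * ennreal (f y powr p) + ennreal t * ennreal (g y powr p)"
      using st by (simp flip: ennreal_mult ennreal_plus add: ennreal_leI)
  qed
  also have "\<dots> = ennreal s * (\<integral>\<^sup>+y. ennreal (f y powr p) \<partial>Y) + ennreal t * (\<integral>\<^sup>+y. ennreal (g y powr p) \<partial>Y)"
    by (simp add: nn_integral_add nn_integral_cmult)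
  also have "\<dots> \<le> ennreal s * ennreal (a powr p) + ennreal t * ennreal (b powr p)"
    by (intro add_mono mult_left_mono fa gb) auto
  also have "\<dots> = ennreal (s * a powr p + t * b powr p)"
    using st by (simp flip: ennreal_mult ennreal_plus)
  also have "s * a powr p + t * b powr p = (a + b) powr p"
  proof -
    have "s * a powr p = (a + b) powr p * (a / (a + b))" "t * b powr p = (a + b) powr p * (b / (a + b))"
      using assms(5,6) by (simp_all add: s_def t_def)
    then have "s * a powr p + t * b powr p = (a + b) powr p * (a / (a + b) + b / (a + b))"
      by (simp add: distrib_left)
    also have "a / (a + b) + b / (a + b) = 1" using assms(5,6) by (simp add: add_divide_distrib[symmetric])
    finally show ?thesis by simp
  qed
  finally show ?thesis .
qed

lemma ennreal_le_powr_bound: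
  assumes "x < \<infinity>" "1 \<le> p"
  obtains a :: real where "0 < a" "x \<le> ennreal (a powr p)"
proof -
  define r where "r = enn2real x + 1"
  have r: "0 < r" by (simp add: r_def add_nonneg_pos)
  have "x = ennreal (enn2real x)" using assms(1) by simp
  also have "\<dots> \<le> ennreal ((r powr (1 / p)) powr p)"
    using r assms(2) by (intro ennreal_leI) (simp add: powr_powr r_def)
  finally show thesis using r by (intro that[of "r powr (1 / p)"]) auto
qed

text \<open>Dominated convergence with \<open>\<phi>\<close> itself as the dominating function. It
  drives both truncations: exhausting the set where a map differs from the base map, and discarding
  the points where the base map is far away.\<close>

lemma nn_integral_vanishing_indicators:
  fixes \<phi> :: "'y \<Rightarrow> ennreal"
  assumes [measurable]: "\<phi> \<in> borel_measurable Y" "\<And>n. B n \<in> sets Y"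
    and fin: "(\<integral>\<^sup>+y. \<phi> y \<partial>Y) < \<infinity>"
    and ev: "\<And>y. y \<in> space Y \<Longrightarrow> \<phi> y \<noteq> 0 \<Longrightarrow> eventually (\<lambda>n. y \<notin> B n) sequentially"
  shows "(\<lambda>n. \<integral>\<^sup>+y. \<phi> y * indicator (B n) y \<partial>Y) \<longlonglongrightarrow> 0"
proof -
  have "(\<lambda>n. \<integral>\<^sup>+y. \<phi> y * indicator (B n) y \<partial>Y) \<longlonglongrightarrow> (\<integral>\<^sup>+y. 0 \<partial>Y)"
  proof (rule nn_integral_dominated_convergence[where w = \<phi>])
    show "AE y in Y. (\<lambda>n. \<phi> y * indicator (B n) y) \<longlonglongrightarrow> 0"
    proof (rule AE_I2)
      fix y assume y: "y \<in> space Y"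
      show "(\<lambda>n. \<phi> y * indicator (B n) y) \<longlonglongrightarrow> 0"
      proof (cases "\<phi> y = 0")
        case False
        have "eventually (\<lambda>n. \<phi> y * indicator (B n) y = 0) sequentially"
          using ev[OF y False] by eventually_elim simp
        then show ?thesis by (rule tendsto_eventually)
      qed simp
    qed
  qed (use fin in \<open>auto split: split_indicator\<close>)
  then show ?thesis by simp
qed

text \<open>The carrier is a parameter so that the locale can be instantiated again with an L^p
  space, or a set of simple classes, as the target. The nested spaces of curves and fields then need
  no theory of their own.\<close>

locale Lp_space = Metric_space Z d for Z :: "'z set" and d :: "'z \<Rightarrow> 'z \<Rightarrow> real" +
  fixes p :: real
  assumes p: "1 \<le> p"
begin

lemma L0I: "f \<in> L0_maps Y Z d \<Longrightarrow> ae_class Y f \<in> L0 Y Z d"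
  by (simp add: L0_def)

lemma L0E:
  assumes "F \<in> L0 Y Z d"
  obtains f where "f \<in> L0_maps Y Z d" "F = ae_class Y f"
  using assms by (auto simp: L0_def)

lemma Lp_int_commute: "Lp_int Y d p F G = Lp_int Y d p G F"
  by (simp add: Lp_int_def commute)

lemma Lp_dist_commute: "Lp_dist Y d p F G = Lp_dist Y d p G F"
  by (simp add: Lp_dist_def Lp_int_commute)

lemma Lp_dist_nonneg: "0 \<le> Lp_dist Y d p F G"
  by (simp add: Lp_dist_def)

lemma Lp_int_refl:
  assumes "F \<in> L0 Y Z d" shows "Lp_int Y d p F F = 0"
proof -
  obtain f where f: "f \<in> L0_maps Y Z d" "F = ae_class Y f" using assms by (rule L0E)
  have "Lp_int Y d p F F = (\<integral>\<^sup>+y. 0 \<partial>Y)"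
    unfolding f Lp_int_ae_class by (rule nn_integral_cong) (use L0_maps_funcset[OF f(1)] in \<open>simp add: Pi_iff\<close>)
  then show ?thesis by simp
qed

lemma Lp_int_0_iff:
  assumes "F \<in> L0 Y Z d" "G \<in> L0 Y Z d"
  shows "Lp_int Y d p F G = 0 \<longleftrightarrow> F = G"
proof
  obtain f where f: "f \<in> L0_maps Y Z d" "F = ae_class Y f" using assms(1) by (rule L0E)
  obtain g where g: "g \<in> L0_maps Y Z d" "G = ae_class Y g" using assms(2) by (rule L0E)
  note [measurable] = borel_measurable_L0_dist[OF f(1) g(1)]
  assume "Lp_int Y d p F G = 0"
  then have "AE y in Y. ennreal (d (f y) (g y) powr p) = 0"
    unfolding f g Lp_int_ae_class by (subst (asm) nn_integral_0_iff_AE) auto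
  then have "AE y in Y. f y = g y"
    using AE_space
  proof eventually_elim
    fix y assume y: "y \<in> space Y" and "ennreal (d (f y) (g y) powr p) = 0"
    then have "d (f y) (g y) = 0" by (simp add: ennreal_eq_0_iff)
    then show "f y = g y" using y L0_maps_funcset[OF f(1)] L0_maps_funcset[OF g(1)] by (simp add: Pi_iff)
  qed
  then show "F = G" by (simp add: f g ae_class_eq_iff)
qed (use Lp_int_refl assms in auto)

lemma Lp_int_triangle:
  assumes F: "F \<in> L0 Y Z d" and G: "G \<in> L0 Y Z d" and H: "H \<in> L0 Y Z d"
    and ab: "0 < a" "0 < b"
    and FG: "Lp_int Y d p F G \<le> ennreal (a powr p)" and GH: "Lp_int Y d p G H \<le> ennreal (b powr p)"
  shows "Lp_int Y d p F H \<le> ennreal ((a + b) powr p)"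
proof -
  obtain f where f: "f \<in> L0_maps Y Z d" "F = ae_class Y f" using F by (rule L0E)
  obtain g where g: "g \<in> L0_maps Y Z d" "G = ae_class Y g" using G by (rule L0E)
  obtain h where h: "h \<in> L0_maps Y Z d" "H = ae_class Y h" using H by (rule L0E)
  have "Lp_int Y d p F H \<le> (\<integral>\<^sup>+y. ennreal ((d (f y) (g y) + d (g y) (h y)) powr p) \<partial>Y)"
    unfolding f h Lp_int_ae_class
  proof (rule nn_integral_mono)
    fix y assume "y \<in> space Y"
    then have "d (f y) (h y) \<le> d (f y) (g y) + d (g y) (h y)"
      using L0_maps_funcset[OF f(1)] L0_maps_funcset[OF g(1)] L0_maps_funcset[OF h(1)]
      by (intro triangle) auto
    then show "ennreal (d (f y) (h y) powr p) \<le> ennreal ((d (f y) (g y) + d (g y) (h y)) powr p)"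
      using p by (intro ennreal_leI powr_mono2) auto
  qed
  also have "\<dots> \<le> ennreal ((a + b) powr p)"
    by (rule nn_integral_Minkowski[OF borel_measurable_L0_dist[OF f(1) g(1)] borel_measurable_L0_dist[OF g(1) h(1)]])
      (use ab p FG GH in \<open>auto simp: f g h Lp_int_ae_class\<close>)
  finally show ?thesis .
qed

lemma Lp_int_finite_trans:
  assumes "F \<in> L0 Y Z d" "G \<in> L0 Y Z d" "H \<in> L0 Y Z d"
    and FG: "Lp_int Y d p F G < \<infinity>" and GH: "Lp_int Y d p G H < \<infinity>"
  shows "Lp_int Y d p F H < \<infinity>"
proof -
  obtain a where a: "0 < a" "Lp_int Y d p F G \<le> ennreal (a powr p)" by (rule ennreal_le_powr_bound[OF FG p])
  obtain b where b: "0 < b" "Lp_int Y d p G H \<le> ennreal (b powr p)" by (rule ennreal_le_powr_bound[OF GH p])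
  show ?thesis
    using Lp_int_triangle[OF assms(1-3) a(1) b(1) a(2) b(2)] by (metis ennreal_less_top infinity_ennreal_def order_le_less_trans)
qed

text \<open>Finiteness matters because \<open>enn2real\<close> sends infinity to 0. In the nested
  spaces this identity turns the outer integrand, a power of a distance of sections, back into the
  inner integral.\<close>

lemma Lp_int_eq_dist:
  assumes "Lp_int Y d p F G < \<infinity>"
  shows "Lp_int Y d p F G = ennreal (Lp_dist Y d p F G powr p)"
  using assms p by (simp add: Lp_dist_def powr_powr)

lemma Lp_dist_le:
  assumes "0 \<le> a" "Lp_int Y d p F G \<le> ennreal (a powr p)"
  shows "Lp_dist Y d p F G \<le> a"
proof -
  have "enn2real (Lp_int Y d p F G) \<le> a powr p" using assms by (simp add: enn2real_leI)
  then have "Lp_dist Y d p F G \<le> (a powr p) powr (1 / p)"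
    unfolding Lp_dist_def using p by (intro powr_mono2) auto
  then show ?thesis using assms p by (simp add: powr_powr)
qed

lemma Lp_int_le:
  assumes "Lp_int Y d p F G < \<infinity>" "Lp_dist Y d p F G \<le> a"
  shows "Lp_int Y d p F G \<le> ennreal (a powr p)"
  unfolding Lp_int_eq_dist[OF assms(1)]
  using assms(2) p Lp_dist_nonneg by (intro ennreal_leI powr_mono2) auto

lemma Lp_subset_L0: "Lp Y Z d p G \<subseteq> L0 Y Z d"
  by (auto simp: Lp_def)

lemma Lp_int_finite:
  assumes "G \<in> L0 Y Z d" "F \<in> Lp Y Z d p G" "F' \<in> Lp Y Z d p G"
  shows "Lp_int Y d p F F' < \<infinity>"
  by (rule Lp_int_finite_trans[of F Y G F'])
    (use assms in \<open>simp_all add: Lp_def Lp_int_commute[of Y G F']\<close>)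

lemma Lp_dist_triangle_L0:
  assumes "F \<in> L0 Y Z d" "G \<in> L0 Y Z d" "H \<in> L0 Y Z d"
    and fin: "Lp_int Y d p F G < \<infinity>" "Lp_int Y d p G H < \<infinity>"
  shows "Lp_dist Y d p F H \<le> Lp_dist Y d p F G + Lp_dist Y d p G H"
proof (rule field_le_epsilon)
  fix e :: real assume e: "0 < e"
  \<comment> \<open>Adding \<open>e/2\<close> to each distance keeps the bounds positive, as
    Minkowski demands, even when a distance is 0.\<close>
  have "Lp_int Y d p F H \<le> ennreal (((Lp_dist Y d p F G + e/2) + (Lp_dist Y d p G H + e/2)) powr p)"
    using e Lp_dist_nonneg by (intro Lp_int_triangle[OF assms(1-3)] Lp_int_le fin add_nonneg_pos) auto
  then have "Lp_dist Y d p F H \<le> (Lp_dist Y d p F G + e/2) + (Lp_dist Y d p G H + e/2)"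
    using e Lp_dist_nonneg by (intro Lp_dist_le add_nonneg_nonneg) auto
  then show "Lp_dist Y d p F H \<le> Lp_dist Y d p F G + Lp_dist Y d p G H + e" by simp
qed

lemma Metric_space_Lp:
  assumes G: "G \<in> L0 Y Z d"
  shows "Metric_space (Lp Y Z d p G) (Lp_dist Y d p)"
proof
  show "0 \<le> Lp_dist Y d p F F'" for F F' by (rule Lp_dist_nonneg)
  show "Lp_dist Y d p F F' = Lp_dist Y d p F' F" for F F' by (rule Lp_dist_commute)
  fix F F' assume F: "F \<in> Lp Y Z d p G" "F' \<in> Lp Y Z d p G"
  have "Lp_dist Y d p F F' = 0 \<longleftrightarrow> Lp_int Y d p F F' = 0"
  proof
    assume "Lp_dist Y d p F F' = 0"
    then show "Lp_int Y d p F F' = 0" using Lp_int_eq_dist[OF Lp_int_finite[OF G F]] by simp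
  qed (simp add: Lp_dist_def)
  then show "Lp_dist Y d p F F' = 0 \<longleftrightarrow> F = F'"
    using Lp_int_0_iff F by (auto simp: Lp_def)
  fix F'' assume F'': "F'' \<in> Lp Y Z d p G"
  show "Lp_dist Y d p F F'' \<le> Lp_dist Y d p F F' + Lp_dist Y d p F' F''"
    using F F'' Lp_int_finite[OF G] by (intro Lp_dist_triangle_L0) (auto simp: Lp_def)
qed

lemma base_in_Lp: "G \<in> L0 Y Z d \<Longrightarrow> G \<in> Lp Y Z d p G"
  by (simp add: Lp_def Lp_int_refl)

lemma Lp_change_base:
  assumes "G \<in> L0 Y Z d" "G' \<in> L0 Y Z d" "Lp_int Y d p G G' < \<infinity>"
  shows "Lp Y Z d p G = Lp Y Z d p G'"
proof -
  have "Lp_int Y d p G' G < \<infinity>" using assms(3) by (simp only: Lp_int_commute[of Y G' G])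
  then have "Lp_int Y d p F G < \<infinity> \<longleftrightarrow> Lp_int Y d p F G' < \<infinity>" if "F \<in> L0 Y Z d" for F
    using Lp_int_finite_trans[OF that assms(1,2)] Lp_int_finite_trans[OF that assms(2,1)] assms(3) by blast
  then show ?thesis unfolding Lp_def by blast
qed

lemma Lp_int_const:
  "Lp_int Y d p (ae_class Y (\<lambda>_. z)) (ae_class Y (\<lambda>_. w)) = ennreal (d z w powr p) * emeasure Y (space Y)"
  unfolding Lp_int_ae_class by simp

lemma Lp_const_eq:
  assumes "finite_measure Y" "z \<in> Z"
  shows "Lp_const Y Z d p = Lp Y Z d p (ae_class Y (\<lambda>_. z))"
proof -
  have "Lp Y Z d p (ae_class Y (\<lambda>_. w)) = Lp Y Z d p (ae_class Y (\<lambda>_. z))" if "w \<in> Z" for w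
  proof (rule Lp_change_base)
    show "Lp_int Y d p (ae_class Y (\<lambda>_. w)) (ae_class Y (\<lambda>_. z)) < \<infinity>"
      unfolding Lp_int_const using finite_measure.emeasure_finite[OF assms(1), of "space Y"]
      by (simp add: ennreal_mult_less_top less_top)
  qed (use that assms(2) in \<open>auto intro: L0I L0_maps_const\<close>)
  then have "Lp_const Y Z d p = (\<Union>w\<in>Z. Lp Y Z d p (ae_class Y (\<lambda>_. z)))"
    unfolding Lp_const_def by (intro SUP_cong refl)
  also have "\<dots> = Lp Y Z d p (ae_class Y (\<lambda>_. z))" using assms(2) by auto
  finally show ?thesis .
qed

lemma simple_function_in_Lp_const:
  assumes "finite_measure Y" "simple_function Y f" "f \<in> space Y \<rightarrow> Z" "Z \<noteq> {}"
  shows "ae_class Y f \<in> Lp_const Y Z d p"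
proof -
  interpret finite_measure Y by fact
  obtain z where z: "z \<in> Z" using assms(4) by auto
  \<comment> \<open>Inserting 0 keeps the maximum meaningful when the domain is empty.\<close>
  define C where "C = Max (insert 0 ((\<lambda>w. d w z powr p) ` f ` space Y))"
  have fin: "finite (f ` space Y)" using assms(2) by (simp add: simple_function_def)
  have "Lp_int Y d p (ae_class Y f) (ae_class Y (\<lambda>_. z)) \<le> ennreal C * emeasure Y (space Y)"
    unfolding nn_integral_const[symmetric]
    unfolding Lp_int_ae_class
    by (intro nn_integral_mono ennreal_leI) (use fin in \<open>auto simp: C_def\<close>)
  also have "\<dots> < \<infinity>" using emeasure_finite[of "space Y"] unfolding infinity_ennreal_def ennreal_mult_less_top by (simp add: less_top[symmetric])
  finally show ?thesis
    using assms(2,3) unfolding Lp_const_eq[OF assms(1) z] by (simp add: Lp_def L0I L0_maps_simple_function)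
qed

end

section \<open>Completeness\<close>

lemma geometric_MCauchy:
  assumes ms: "Metric_space Z d" and x: "range x \<subseteq> Z"
    and step: "\<And>n. K \<le> n \<Longrightarrow> d (x n) (x (Suc n)) \<le> (1/2) ^ n"
  shows "Metric_space.MCauchy Z d x"
proof -
  interpret Metric_space Z d by fact
  have xZ: "x n \<in> Z" for n using x by auto
  \<comment> \<open>The bound is the exact value of the partial geometric sum, which is what makes
    the induction close.\<close>
  have le: "d (x n) (x (n + j)) \<le> 2 * (1/2) ^ n - 2 * (1/2) ^ (n + j)" if "K \<le> n" for n j
  proof (induction j)
    case 0 then show ?case using xZ by simp
  next
    case (Suc j)
    have "d (x n) (x (n + Suc j)) \<le> d (x n) (x (n + j)) + d (x (n + j)) (x (Suc (n + j)))"
      using triangle[OF xZ xZ xZ, of n "n + Suc j" "n + j"] by simp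
    also have "\<dots> \<le> 2 * (1/2) ^ n - 2 * (1/2) ^ (n + j) + (1/2) ^ (n + j)"
      using Suc step[of "n + j"] that by auto
    finally show ?case by simp
  qed
  show ?thesis
    unfolding MCauchy_def
  proof (intro conjI allI impI x)
    fix e :: real assume "0 < e"
    then obtain k where k: "(1/2) ^ k < e / 2" using real_arch_pow_inv[of "e / 2" "1 / 2"] by auto
    have close: "d (x n) (x n') < e" if "max K k \<le> n" "n \<le> n'" for n n'
    proof -
      have "d (x n) (x n') \<le> 2 * (1/2) ^ n - 2 * (1/2) ^ n'" using le[of n "n' - n"] that by simp
      also have "\<dots> < 2 * (1/2) ^ n" by simp
      also have "\<dots> \<le> 2 * (1/2) ^ k" using that by (simp add: power_decreasing)
      also have "\<dots> < e" using k by simp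
      finally show ?thesis .
    qed
    have "d (x n) (x n') < e" if "max K k \<le> n" "max K k \<le> n'" for n n'
      using close[of n n'] close[of n' n] that by (cases "n \<le> n'") (auto simp: commute)
    then show "\<exists>N. \<forall>n n'. N \<le> n \<longrightarrow> N \<le> n' \<longrightarrow> d (x n) (x n') < e" by blast
  qed
qed

context Lp_space
begin

text \<open>Riesz-Fischer for metric values. Since the distances are at most
  \<open>(1/4) ^ n\<close>, the functions \<open>D n\<close>, weighted by \<open>2 ^ n\<close>, have
  integrals at most \<open>(1/2) ^ n\<close>. Their sum is finite almost everywhere, so eventually
  \<open>d (f n y) (f (Suc n) y) \<le> (1/2) ^ n\<close> and the values at \<open>y\<close>
  converge. No Minkowski inequality for infinite sums is involved.\<close>

lemma Lp_mcomplete_aux: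
  assumes Z: "mcomplete" and f: "\<And>n. f n \<in> L0_maps Y Z d"
    and fin: "\<And>n m. n \<le> m \<Longrightarrow> (\<integral>\<^sup>+y. ennreal (d (f n y) (f m y) powr p) \<partial>Y) \<le> ennreal (((1/4) ^ n) powr p)"
  obtains g where "g \<in> L0_maps Y Z d"
    "\<And>n. (\<integral>\<^sup>+y. ennreal (d (f n y) (g y) powr p) \<partial>Y) \<le> ennreal (((1/4) ^ n) powr p)"
proof -
  note [measurable] = borel_measurable_L0_dist[OF f f]
  have fZ: "f n y \<in> Z" if "y \<in> space Y" for n y using L0_maps_funcset[OF f] that by auto
  define D where "D n y = ennreal ((2 ^ n * d (f n y) (f (Suc n) y)) powr p)" for n y
  have [measurable]: "D n \<in> borel_measurable Y" for n unfolding D_def by measurable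
  have D: "(\<integral>\<^sup>+y. D n y \<partial>Y) \<le> ennreal ((1/2) ^ n)" for n
  proof -
    have "(\<integral>\<^sup>+y. D n y \<partial>Y) = ennreal ((2 ^ n) powr p) * (\<integral>\<^sup>+y. ennreal (d (f n y) (f (Suc n) y) powr p) \<partial>Y)"
      unfolding D_def by (simp add: powr_mult ennreal_mult nn_integral_cmult)
    also have "\<dots> \<le> ennreal ((2 ^ n) powr p) * ennreal (((1/4) ^ n) powr p)"
      by (intro mult_left_mono fin) auto
    also have "\<dots> = ennreal (((1/2) ^ n) powr p)"
      by (simp flip: ennreal_mult powr_mult power_mult_distrib)
    also have "\<dots> \<le> ennreal ((1/2) ^ n)"
      using powr_mono'[OF p, of "(1/2)^n"] by (intro ennreal_leI) (auto simp: power_le_one)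
    finally show ?thesis .
  qed
  have "(\<integral>\<^sup>+y. (\<Sum>n. D n y) \<partial>Y) = (\<Sum>n. \<integral>\<^sup>+y. D n y \<partial>Y)"
    by (rule nn_integral_suminf) simp
  also have "\<dots> \<le> (\<Sum>n. ennreal ((1/2) ^ n))" by (intro suminf_le D) auto
  also have "\<dots> = ennreal (\<Sum>n. (1/2) ^ n)"
    by (intro suminf_ennreal2) (auto intro: summable_geometric)
  also have "\<dots> < \<infinity>" by simp
  finally have "(\<integral>\<^sup>+y. (\<Sum>n. D n y) \<partial>Y) \<noteq> \<infinity>" by simp
  then have fin_AE: "AE y in Y. (\<Sum>n. D n y) \<noteq> \<infinity>" by (intro nn_integral_PInf_AE) auto
  define S where "S = {y \<in> space Y. (\<Sum>n. D n y) \<noteq> \<infinity>}"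
  have S [measurable]: "S \<in> sets Y" unfolding S_def by measurable
  have "\<exists>z. limitin mtopology (\<lambda>n. f n y) z sequentially" if y: "y \<in> S" for y
  proof -
    have yY: "y \<in> space Y" using y by (simp add: S_def)
    have "summable (\<lambda>n. (2 ^ n * d (f n y) (f (Suc n) y)) powr p)"
      using y by (intro summable_suminf_not_top) (auto simp: S_def D_def)
    then have "(\<lambda>n. (2 ^ n * d (f n y) (f (Suc n) y)) powr p) \<longlonglongrightarrow> 0" by (rule summable_LIMSEQ_zero)
    then have "eventually (\<lambda>n. (2 ^ n * d (f n y) (f (Suc n) y)) powr p < 1) sequentially"
      by (rule order_tendstoD) simp
    then obtain K where K: "\<And>n. K \<le> n \<Longrightarrow> (2 ^ n * d (f n y) (f (Suc n) y)) powr p < 1"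
      by (auto simp: eventually_sequentially)
    have "MCauchy (\<lambda>n. f n y)"
    proof (rule geometric_MCauchy)
      show "d (f n y) (f (Suc n) y) \<le> (1/2) ^ n" if "K \<le> n" for n
      proof (rule ccontr)
        assume "\<not> d (f n y) (f (Suc n) y) \<le> (1/2) ^ n"
        then have "1 \<le> 2 ^ n * d (f n y) (f (Suc n) y)" by (simp add: field_simps)
        then have "1 \<le> (2 ^ n * d (f n y) (f (Suc n) y)) powr p" using p by (intro ge_one_powr_ge_zero) auto
        then show False using K[OF that] by simp
      qed
    qed (use fZ[OF yY] Metric_space_axioms in auto)
    then show ?thesis using Z by (simp add: mcomplete_def)
  qed
  then obtain g0 where g0: "\<And>y. y \<in> S \<Longrightarrow> limitin mtopology (\<lambda>n. f n y) (g0 y) sequentially" by metis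
  \<comment> \<open>Off the set \<open>S\<close> of convergence both the limit and the terms are
    replaced by \<open>f 0\<close>, so that convergence holds at every point and yields
    measurability of \<open>g\<close>.\<close>
  define g where "g y = (if y \<in> S then g0 y else f 0 y)" for y
  have lim: "(\<lambda>n. d (if y \<in> S then f n y else f 0 y) (g y)) \<longlonglongrightarrow> 0" if "y \<in> space Y" for y
    using g0[of y] fZ[OF that] by (auto simp: g_def limitin_metric_dist_null)
  have g: "g \<in> L0_maps Y Z d"
  proof (rule L0_maps_LIMSEQ[OF _ _ lim])
    show "(\<lambda>y. if y \<in> S then f n y else f 0 y) \<in> L0_maps Y Z d" for n
      by (intro L0_maps_If f) (use S sets.sets_into_space[OF S] in \<open>simp add: Collect_conj_eq Int_absorb1\<close>)
    show "g \<in> space Y \<rightarrow> Z" using g0 fZ by (auto simp: g_def limitin_metric_dist_null)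
  qed
  have AE_S: "AE y in Y. y \<in> S" using fin_AE AE_space by eventually_elim (simp add: S_def)
  show thesis
  proof (rule that[OF g])
    fix n
    \<comment> \<open>Fatou's lemma in \<open>m\<close> carries the bound between \<open>f n\<close>
      and \<open>f m\<close> over to the limit.\<close>
    have "(\<integral>\<^sup>+y. ennreal (d (f n y) (g y) powr p) \<partial>Y)
        \<le> (\<integral>\<^sup>+y. liminf (\<lambda>m. ennreal (d (f n y) (f m y) powr p)) \<partial>Y)"
    proof (rule nn_integral_mono_AE)
      show "AE y in Y. ennreal (d (f n y) (g y) powr p) \<le> liminf (\<lambda>m. ennreal (d (f n y) (f m y) powr p))"
        using AE_S AE_space
      proof eventually_elim
        fix y assume y: "y \<in> S" "y \<in> space Y"
        have gZ: "g y \<in> Z" using L0_maps_funcset[OF g] y by auto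
        have l: "(\<lambda>m. d (f m y) (g y)) \<longlonglongrightarrow> 0" using lim[OF y(2)] y(1) by simp
        have "(\<lambda>m. d (f n y) (f m y)) \<longlonglongrightarrow> d (f n y) (g y)"
        proof (rule LIM_zero_cancel, rule Lim_null_comparison[OF _ l])
          have "\<bar>d (f m y) (f n y) - d (f n y) (g y)\<bar> \<le> d (f m y) (g y)" for m
            by (rule mdist_reverse_triangle) (use fZ[OF y(2)] gZ in auto)
          then show "\<forall>\<^sub>F m in sequentially. norm (d (f n y) (f m y) - d (f n y) (g y)) \<le> d (f m y) (g y)"
            by (simp add: commute)
        qed
        then have "(\<lambda>m. ennreal (d (f n y) (f m y) powr p)) \<longlonglongrightarrow> ennreal (d (f n y) (g y) powr p)"
          using p by (intro tendsto_ennrealI tendsto_powr2 tendsto_const) auto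
        then have "liminf (\<lambda>m. ennreal (d (f n y) (f m y) powr p)) = ennreal (d (f n y) (g y) powr p)"
          by (rule lim_imp_Liminf[OF sequentially_bot])
        then show "ennreal (d (f n y) (g y) powr p) \<le> liminf (\<lambda>m. ennreal (d (f n y) (f m y) powr p))"
          by simp
      qed
    qed
    also have "\<dots> \<le> liminf (\<lambda>m. \<integral>\<^sup>+y. ennreal (d (f n y) (f m y) powr p) \<partial>Y)"
      by (rule nn_integral_liminf) simp
    also have "\<dots> \<le> ennreal (((1/4) ^ n) powr p)"
      by (rule Liminf_le) (use fin[of n] in \<open>auto simp: eventually_sequentially\<close>)
    finally show "(\<integral>\<^sup>+y. ennreal (d (f n y) (g y) powr p) \<partial>Y) \<le> ennreal (((1/4) ^ n) powr p)" .
  qed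
qed

theorem mcomplete_Lp:
  assumes Z: "mcomplete" and G: "G \<in> L0 Y Z d"
  shows "Metric_space.mcomplete (Lp Y Z d p G) (Lp_dist Y d p)"
proof -
  interpret L: Metric_space "Lp Y Z d p G" "Lp_dist Y d p" by (rule Metric_space_Lp[OF G])
  show ?thesis
    unfolding L.mcomplete_def
  proof (intro allI impI)
    fix F assume "L.MCauchy F"
    then have FL: "\<And>n. F n \<in> Lp Y Z d p G" and
      cauchy: "\<And>e. 0 < e \<Longrightarrow> \<exists>N. \<forall>n n'. N \<le> n \<longrightarrow> N \<le> n' \<longrightarrow> Lp_dist Y d p (F n) (F n') < e"
      by (auto simp: L.MCauchy_def)
    have "\<forall>k. \<exists>N. \<forall>n n'. N \<le> n \<longrightarrow> N \<le> n' \<longrightarrow> Lp_dist Y d p (F n) (F n') < (1/4) ^ k"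
      using cauchy by simp
    then obtain N where N: "\<And>k n n'. N k \<le> n \<Longrightarrow> N k \<le> n' \<Longrightarrow> Lp_dist Y d p (F n) (F n') < (1/4) ^ k"
      by metis
    \<comment> \<open>Summing the thresholds gives indices \<open>r m\<close> that are beyond
      \<open>N k\<close> for every \<open>k \<le> m\<close>, without assuming that \<open>N\<close>
      is monotone.\<close>
    define r where "r k = (\<Sum>i\<le>k. N i)" for k
    have r: "N k \<le> r m" if "k \<le> m" for k m
      unfolding r_def using that by (intro member_le_sum) auto
    have "\<forall>k. \<exists>f. f \<in> L0_maps Y Z d \<and> F (r k) = ae_class Y f"
      using FL Lp_subset_L0 L0E by (metis subsetD)
    then obtain f where f: "\<And>k. f k \<in> L0_maps Y Z d" "\<And>k. F (r k) = ae_class Y (f k)" by metis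
    obtain g where g: "g \<in> L0_maps Y Z d"
      "\<And>k. (\<integral>\<^sup>+y. ennreal (d (f k y) (g y) powr p) \<partial>Y) \<le> ennreal (((1/4) ^ k) powr p)"
    proof (rule Lp_mcomplete_aux[OF Z f(1)])
      fix k m :: nat assume km: "k \<le> m"
      have "Lp_int Y d p (F (r k)) (F (r m)) \<le> ennreal (((1/4) ^ k) powr p)"
        using N[of k "r k" "r m"] r km by (intro Lp_int_le Lp_int_finite[OF G] FL) (auto intro: less_imp_le)
      then show "(\<integral>\<^sup>+y. ennreal (d (f k y) (f m y) powr p) \<partial>Y) \<le> ennreal (((1/4) ^ k) powr p)"
        by (simp only: f(2) Lp_int_ae_class)
    qed blast
    have int: "Lp_int Y d p (F (r k)) (ae_class Y g) \<le> ennreal (((1/4) ^ k) powr p)" for k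
      using g(2) by (simp only: f(2) Lp_int_ae_class)
    have gL0: "ae_class Y g \<in> L0 Y Z d" by (rule L0I[OF g(1)])
    have "Lp_int Y d p (ae_class Y g) (F (r 0)) < \<infinity>"
      using int[of 0] by (subst Lp_int_commute) (auto intro: le_less_trans)
    then have gL: "ae_class Y g \<in> Lp Y Z d p G"
      using Lp_int_finite_trans[OF gL0, of "F (r 0)" G] FL[of "r 0"] G gL0 by (auto simp: Lp_def)
    have "limitin L.mtopology F (ae_class Y g) sequentially"
      unfolding L.limit_metric_sequentially
    proof (intro conjI gL allI impI)
      fix e :: real assume "0 < e"
      then obtain k where k: "(1/4) ^ k < e / 2" using real_arch_pow_inv[of "e / 2" "1 / 4"] by auto
      have "Lp_dist Y d p (F n) (ae_class Y g) < e" if n: "N k \<le> n" for n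
      proof -
        have "Lp_dist Y d p (F n) (ae_class Y g) \<le> Lp_dist Y d p (F n) (F (r k)) + Lp_dist Y d p (F (r k)) (ae_class Y g)"
          using FL gL by (intro L.triangle)
        also have "\<dots> < (1/4) ^ k + (1/4) ^ k"
          using N[OF n r[OF order_refl]] int[of k] by (intro add_less_le_mono Lp_dist_le) auto
        also have "\<dots> < e" using k by simp
        finally show ?thesis .
      qed
      then show "\<exists>N. \<forall>n\<ge>N. F n \<in> Lp Y Z d p G \<and> Lp_dist Y d p (F n) (ae_class Y g) < e"
        using FL by blast
    qed
    then show "\<exists>x. limitin L.mtopology F x sequentially" ..
  qed
qed

section \<open>Density of almost simple classes\<close>

text \<open>The approximant of \<open>f\<close> takes the value \<open>w\<^sub>k\<close> where \<open>w\<^sub>k\<close> is closer to \<open>f\<close> than \<open>d (f, g) / m\<close>: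
  measuring the error relative to \<open>d (f, g)\<close> makes it integrable even though the domain may have
  infinite measure.\<close>

lemma almost_simple_approx:
  assumes f: "f \<in> L0_maps Y Z d" and g: "g \<in> L0_maps Y W d" and WZ: "W \<subseteq> Z"
    and dense: "\<And>z e. z \<in> Z \<Longrightarrow> 0 < e \<Longrightarrow> \<exists>w\<in>W. d z w < e"
    and fin: "(\<integral>\<^sup>+y. ennreal (d (f y) (g y) powr p) \<partial>Y) < \<infinity>" and e: "0 < (e::real)"
  obtains u B where "u \<in> L0_maps Y W d" "B \<in> sets Y" "emeasure Y B < \<infinity>" "finite (u ` B)"
    "\<forall>y. y \<notin> B \<longrightarrow> u y = g y" "(\<integral>\<^sup>+y. ennreal (d (f y) (u y) powr p) \<partial>Y) < ennreal e"
proof -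
  interpret W: Metric_space W d using subspace[OF WZ] .
  have gZ: "g \<in> L0_maps Y Z d" by (rule L0_maps_superset[OF g WZ])
  have fy: "f y \<in> Z" and gy: "g y \<in> W" if "y \<in> space Y" for y
    using L0_maps_funcset[OF f] W.L0_maps_funcset[OF g] that by auto
  define \<delta> where "\<delta> y = d (f y) (g y)" for y
  have [measurable]: "\<delta> \<in> borel_measurable Y"
    unfolding \<delta>_def by (rule borel_measurable_L0_dist[OF f gZ])
  have \<delta>0: "0 \<le> \<delta> y" for y by (simp add: \<delta>_def)
  have fin\<delta>: "(\<integral>\<^sup>+y. ennreal (\<delta> y powr p) \<partial>Y) < \<infinity>" using fin by (simp add: \<delta>_def)
  show thesis
  proof (cases "space Y = {}")
    case True
    then show thesis using e by (intro that[OF g, of "{}"]) (auto simp: nn_integral_empty)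
  next
    case False
    obtain D where D: "countable D" "D \<subseteq> f ` space Y" "D \<subseteq> Z"
      "\<And>y e. y \<in> space Y \<Longrightarrow> 0 < e \<Longrightarrow> \<exists>z\<in>D. d (f y) z < e" by (rule L0_maps_dense[OF f]) blast
    have "\<forall>z\<in>Z. \<forall>n::nat. \<exists>w\<in>W. d z w < 1 / Suc n" using dense by simp
    then obtain s where s: "\<And>z n. z \<in> Z \<Longrightarrow> s z n \<in> W" "\<And>z n. z \<in> Z \<Longrightarrow> d z (s z n) < 1 / Suc (n::nat)"
      by metis
    \<comment> \<open>\<open>E\<close> is countable, lies in \<open>W\<close>, and still comes
      arbitrarily close to every value of \<open>f\<close>: it collects points of \<open>W\<close>
      near the points of \<open>D\<close>.\<close>
    define E where "E = (\<lambda>(z, n). s z n) ` (D \<times> UNIV)"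
    have "countable E" "E \<noteq> {}" unfolding E_def using D(1) D(4)[of _ 1] False by auto
    then obtain w' :: "nat \<Rightarrow> 'z" where w': "range w' = E" using uncountable_def by metis
    define w where "w k = w' (fst (prod_decode k))" for k
    \<comment> \<open>Decoding \<open>k\<close> as a pair attaches every threshold
      \<open>1 / Suc j\<close> to every point of \<open>E\<close>, so a single index carries an
      approximating value and a lower bound for \<open>\<delta>\<close>.\<close>
    define q where "q k = 1 / Suc (snd (prod_decode k))" for k
    have "E \<subseteq> W" using D(3) s(1) by (auto simp: E_def)
    then have wW: "w k \<in> W" for k using w' unfolding w_def by blast
    have near: "\<exists>k. d (f y) (w k) < r \<and> q k < r'" if y: "y \<in> space Y" and r: "0 < r" "0 < r'" for y r r'
    proof -
      obtain n where n: "1 / Suc n < r / 2" using nat_approx_posE[of "r / 2"] r by auto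
      obtain z where z: "z \<in> D" "d (f y) z < r / 2" using D(4)[OF y, of "r / 2"] r by auto
      have zZ: "z \<in> Z" using z D by auto
      have "d (f y) (s z n) \<le> d (f y) z + d z (s z n)"
        using fy[OF y] zZ s(1)[OF zZ] WZ by (intro triangle) auto
      also have "\<dots> < r" using z(2) s(2)[OF zZ, of n] n by simp
      finally have "d (f y) (s z n) < r" .
      moreover have "s z n \<in> range w'" unfolding w' E_def using z(1) by force
      then obtain i where "w' i = s z n" by auto
      moreover obtain j where "1 / Suc j < r'" using nat_approx_posE[OF r(2)] by auto
      ultimately show ?thesis by (intro exI[of _ "prod_encode (i, j)"]) (simp add: w_def q_def)
    qed
    obtain c where c: "0 \<le> c" "(\<integral>\<^sup>+y. ennreal (\<delta> y powr p) \<partial>Y) = ennreal c"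
      using fin\<delta> by (cases "\<integral>\<^sup>+y. ennreal (\<delta> y powr p) \<partial>Y") auto
    \<comment> \<open>The relative error \<open>\<delta> / m\<close> contributes
      \<open>m powr - p\<close> times the integral \<open>c\<close>, which is at most
      \<open>c / m\<close> because \<open>1 \<le> p\<close>; hence the choice
      \<open>m > 2 * c / e\<close>.\<close>
    obtain m :: nat where m: "0 < m" "ennreal (1 / m powr p) * (\<integral>\<^sup>+y. ennreal (\<delta> y powr p) \<partial>Y) < ennreal (e / 2)"
    proof -
      obtain m :: nat where m: "2 * c / e < m" using reals_Archimedean2 by blast
      then have m0: "0 < m" using c e by (cases m) (auto simp: divide_less_0_iff)
      have "real m powr 1 \<le> m powr p" using m0 p by (intro powr_mono) auto
      then have "1 / m powr p * c \<le> 1 / m * c" using m0 c by (intro mult_right_mono divide_left_mono) auto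
      also have "\<dots> < e / 2" using m e m0 by (simp add: field_simps)
      finally have "ennreal (1 / m powr p * c) < ennreal (e / 2)" using e by (simp add: ennreal_lessI)
      then show thesis using that[OF m0] c unfolding c(2) by (simp only: ennreal_mult''[OF c(1)])
    qed
    \<comment> \<open>The condition \<open>q k < \<delta> y\<close> is what makes \<open>H k\<close>
      of finite measure, by Markov's inequality.\<close>
    define H where "H k = {y \<in> space Y. d (f y) (w k) < \<delta> y / m \<and> q k < \<delta> y}" for k
    have H [measurable]: "H k \<in> sets Y" for k
    proof -
      have [measurable]: "(\<lambda>y. d (f y) (w k)) \<in> borel_measurable Y"
        using L0_maps_dist[OF f, of "w k"] wW WZ by auto
      show ?thesis unfolding H_def by measurable
    qed
    \<comment> \<open>A later index may overwrite an earlier value. This is harmless, since every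
      value assigned on \<open>H k\<close> is within \<open>\<delta> y / m\<close> of
      \<open>f y\<close>.\<close>
    define u where "u = rec_nat g (\<lambda>k u y. if y \<in> H k then w k else u y)"
    have u0: "u 0 = g" and uS: "u (Suc k) = (\<lambda>y. if y \<in> H k then w k else u k y)" for k
      unfolding u_def by (rule nat.rec)+
    have uL: "u n \<in> L0_maps Y W d" for n
    proof (induction n)
      case (Suc n)
      show ?case unfolding uS
        by (intro W.L0_maps_If Suc.IH W.L0_maps_const wW)
          (use H[of n] sets.sets_into_space[OF H[of n]] in \<open>simp add: Collect_conj_eq Int_absorb1\<close>)
    qed (simp add: u0 g)
    define B where "B n = (\<Union>k<n. H k)" for n
    have BY [measurable]: "B n \<in> sets Y" for n unfolding B_def by measurable
    have u_out: "u n y = g y" if "y \<notin> B n" for n y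
      using that by (induction n) (auto simp: u0 uS B_def less_Suc_eq)
    have u_in: "\<exists>k<n. u n y = w k \<and> y \<in> H k" if "y \<in> B n" for n y
      using that
    proof (induction n)
      case (Suc n)
      show ?case
      proof (cases "y \<in> H n")
        case True then show ?thesis by (intro exI[of _ n]) (simp add: uS)
      next
        case False
        then have "y \<in> B n" using Suc.prems by (auto simp: B_def less_Suc_eq)
        from Suc.IH[OF this] show ?thesis using False by (auto simp: uS less_Suc_eq)
      qed
    qed (simp add: B_def)
    have "emeasure Y (H k) < \<infinity>" for k
    proof -
      define a where "a = real (Suc (snd (prod_decode k)))"
      have "emeasure Y (H k) \<le> (\<integral>\<^sup>+y. ennreal (a powr p) * ennreal (\<delta> y powr p) \<partial>Y)"
        unfolding nn_integral_indicator[OF H, symmetric]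
      proof (rule nn_integral_mono)
        fix y
        show "indicator (H k) y \<le> ennreal (a powr p) * ennreal (\<delta> y powr p)"
        proof (cases "y \<in> H k")
          case True
          then have "1 \<le> a * \<delta> y" by (simp add: H_def q_def a_def field_simps)
          then have "1 \<le> (a * \<delta> y) powr p" using p by (intro ge_one_powr_ge_zero) auto
          also have "\<dots> = a powr p * \<delta> y powr p" using \<delta>0[of y] by (simp add: powr_mult a_def)
          finally have "ennreal 1 \<le> ennreal (a powr p * \<delta> y powr p)" by (rule ennreal_leI)
          then show ?thesis using True by (simp add: ennreal_mult)
        qed simp
      qed
      also have "\<dots> = ennreal (a powr p) * (\<integral>\<^sup>+y. ennreal (\<delta> y powr p) \<partial>Y)"
        by (rule nn_integral_cmult) simp
      also have "\<dots> < \<infinity>" using fin\<delta> by (simp add: ennreal_mult_less_top)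
      finally show ?thesis .
    qed
    then have Bfin: "emeasure Y (B n) < \<infinity>" for n
      unfolding B_def using emeasure_subadditive_finite[of "{..<n}" H Y] H
      by (auto intro: le_less_trans simp: image_subset_iff)
    \<comment> \<open>Every point with \<open>\<delta> y > 0\<close> eventually enters
      \<open>B n\<close>; where \<open>\<delta> y = 0\<close> the integrand vanishes anyway.\<close>
    have "(\<lambda>n. \<integral>\<^sup>+y. ennreal (\<delta> y powr p) * indicator (space Y - B n) y \<partial>Y) \<longlonglongrightarrow> 0"
    proof (rule nn_integral_vanishing_indicators)
      fix y assume y: "y \<in> space Y" "ennreal (\<delta> y powr p) \<noteq> 0"
      then have pos: "0 < \<delta> y" using \<delta>0[of y] by (cases "\<delta> y = 0") auto
      show "eventually (\<lambda>n. y \<notin> space Y - B n) sequentially"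
      proof -
        obtain k where "d (f y) (w k) < \<delta> y / m" "q k < \<delta> y"
          using near[OF y(1), of "\<delta> y / m" "\<delta> y"] pos m(1) by auto
        then have "y \<in> B n" if "k < n" for n using that y(1) by (auto simp: B_def H_def)
        then show ?thesis by (auto simp: eventually_sequentially intro!: exI[of _ "Suc k"])
      qed
    qed (use fin\<delta> in auto)
    then have "eventually (\<lambda>n. (\<integral>\<^sup>+y. ennreal (\<delta> y powr p) * indicator (space Y - B n) y \<partial>Y) < ennreal (e / 2)) sequentially"
      using e by (intro order_tendstoD(2)) (auto simp: ennreal_zero_less_divide)
    then obtain n where n: "(\<integral>\<^sup>+y. ennreal (\<delta> y powr p) * indicator (space Y - B n) y \<partial>Y) < ennreal (e / 2)"
      by (auto simp: eventually_sequentially)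
    show thesis
    proof (rule that[OF uL BY Bfin])
      show "finite (u n ` B n)"
        by (rule finite_subset[of _ "w ` {..<n}"]) (use u_in in fastforce)+
      show "\<forall>y. y \<notin> B n \<longrightarrow> u n y = g y" using u_out by blast
      have "(\<integral>\<^sup>+y. ennreal (d (f y) (u n y) powr p) \<partial>Y)
          \<le> (\<integral>\<^sup>+y. ennreal (1 / m powr p) * ennreal (\<delta> y powr p) + ennreal (\<delta> y powr p) * indicator (space Y - B n) y \<partial>Y)"
      proof (rule nn_integral_mono)
        fix y assume y: "y \<in> space Y"
        show "ennreal (d (f y) (u n y) powr p)
          \<le> ennreal (1 / m powr p) * ennreal (\<delta> y powr p) + ennreal (\<delta> y powr p) * indicator (space Y - B n) y"
        proof (cases "y \<in> B n")
          case True
          then obtain k where "u n y = w k" "y \<in> H k" using u_in by blast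
          then have "d (f y) (u n y) powr p \<le> (\<delta> y / m) powr p" using p by (intro powr_mono2) (auto simp: H_def)
          also have "\<dots> = 1 / m powr p * \<delta> y powr p" using \<delta>0 by (simp add: powr_divide)
          finally have "ennreal (d (f y) (u n y) powr p) \<le> ennreal (1 / m powr p * \<delta> y powr p)" by (rule ennreal_leI)
          then show ?thesis using True by (simp flip: ennreal_mult)
        next
          case False
          then show ?thesis using y by (simp add: u_out \<delta>_def)
        qed
      qed
      also have "\<dots> = ennreal (1 / m powr p) * (\<integral>\<^sup>+y. ennreal (\<delta> y powr p) \<partial>Y)
          + (\<integral>\<^sup>+y. ennreal (\<delta> y powr p) * indicator (space Y - B n) y \<partial>Y)"
        by (subst nn_integral_add) (auto simp: nn_integral_cmult)
      also have "\<dots> < ennreal (e / 2) + ennreal (e / 2)" by (intro add_strict_mono m n)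
      also have "\<dots> = ennreal e" using e by (simp flip: ennreal_plus)
      finally show "(\<integral>\<^sup>+y. ennreal (d (f y) (u n y) powr p) \<partial>Y) < ennreal e" .
    qed
  qed
qed

text \<open>\<open>W\<close> may be a proper dense subset of \<open>Z\<close>. This is the case for
  fields, whose approximants take values in the simple curves \<open>E(I,N)\<close> while the limits
  take values in L^p(I,N).\<close>

lemma almost_simple_dense:
  assumes g: "g \<in> L0_maps Y W d" and WZ: "W \<subseteq> Z"
    and dense: "\<And>z e. z \<in> Z \<Longrightarrow> 0 < e \<Longrightarrow> \<exists>w\<in>W. d z w < e"
    and G: "G = ae_class Y g" and F: "F \<in> Lp Y Z d p G" and e: "0 < e"
  shows "\<exists>F'\<in>almost_simple_classes Y W d G \<inter> Lp Y Z d p G. Lp_dist Y d p F F' < e"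
proof -
  obtain f where f: "f \<in> L0_maps Y Z d" "F = ae_class Y f" using F by (auto simp: Lp_def elim: L0E)
  have gZ: "g \<in> L0_maps Y Z d" by (rule L0_maps_superset[OF g WZ])
  then have GL: "G \<in> L0 Y Z d" unfolding G by (rule L0I)
  have fin: "(\<integral>\<^sup>+y. ennreal (d (f y) (g y) powr p) \<partial>Y) < \<infinity>"
    using F by (simp add: Lp_def f G Lp_int_ae_class)
  have pos: "0 < (e / 2) powr p" using e by simp
  obtain u B where u: "u \<in> L0_maps Y W d" "B \<in> sets Y" "emeasure Y B < \<infinity>" "finite (u ` B)"
    "\<forall>y. y \<notin> B \<longrightarrow> u y = g y" "(\<integral>\<^sup>+y. ennreal (d (f y) (u y) powr p) \<partial>Y) < ennreal ((e / 2) powr p)"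
    by (rule almost_simple_approx[OF f(1) g WZ dense fin pos]) blast
  have uL: "ae_class Y u \<in> L0 Y Z d" by (rule L0I[OF L0_maps_superset[OF u(1) WZ]])
  have int: "Lp_int Y d p F (ae_class Y u) \<le> ennreal ((e / 2) powr p)"
    using u(6) by (simp add: f Lp_int_ae_class less_imp_le)
  have "AE y in Y. y \<notin> B \<longrightarrow> u y = class_rep G y"
    using AE_class_rep[of Y g] by (rule AE_mp) (simp add: G u(5))
  then have "ae_class Y u \<in> almost_simple_classes Y W d G"
    unfolding almost_simple_classes_def using u by blast
  moreover have "Lp_int Y d p (ae_class Y u) F < \<infinity>"
    using int by (subst Lp_int_commute) (auto intro: le_less_trans)
  then have "ae_class Y u \<in> Lp Y Z d p G"
    using Lp_int_finite_trans[OF uL _ GL, of F] F uL by (auto simp: Lp_def)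
  moreover have "Lp_dist Y d p F (ae_class Y u) \<le> e / 2" using int e by (intro Lp_dist_le) auto
  then have "Lp_dist Y d p F (ae_class Y u) < e" using e by simp
  ultimately show ?thesis by blast
qed

text \<open>Off \<open>B\<close> the map agrees almost everywhere with the constant, so redefining
  it there on a null set leaves a finite range.\<close>

lemma almost_simple_const_subset:
  assumes "w \<in> W" and WZ: "W \<subseteq> Z"
  shows "almost_simple_classes Y W d (ae_class Y (\<lambda>_. w)) \<subseteq> simple_classes Y W d"
proof
  interpret W: Metric_space W d using subspace[OF WZ] .
  fix F assume "F \<in> almost_simple_classes Y W d (ae_class Y (\<lambda>_. w))"
  then obtain u B where u: "u \<in> L0_maps Y W d" "B \<in> sets Y" "finite (u ` B)"
    "AE y in Y. y \<notin> B \<longrightarrow> u y = class_rep (ae_class Y (\<lambda>_. w)) y" and F: "F = ae_class Y u"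
    unfolding almost_simple_classes_def by blast
  define v where "v y = (if y \<in> B then u y else w)" for y
  have "v \<in> L0_maps Y W d" unfolding v_def
    by (intro W.L0_maps_If u W.L0_maps_const assms)
      (use u(2) sets.sets_into_space[OF u(2)] in \<open>simp add: Collect_conj_eq Int_absorb1\<close>)
  moreover have "finite (v ` space Y)"
    by (rule finite_subset[of _ "insert w (u ` B)"]) (use u(3) in \<open>auto simp: v_def\<close>)
  moreover have "F = ae_class Y v"
    unfolding F ae_class_eq_iff using u(4) AE_class_rep[of Y "\<lambda>_. w"]
    by eventually_elim (simp add: v_def)
  ultimately show "F \<in> simple_classes Y W d" by (auto simp: simple_classes_def W.L0_maps_measurable)
qed

lemma simple_classes_subset_Lp_const:
  assumes "finite_measure Y" "W \<subseteq> Z" "Z \<noteq> {}"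
  shows "simple_classes Y W d \<subseteq> Lp_const Y Z d p"
proof
  interpret W: Metric_space W d using subspace[OF assms(2)] .
  fix F assume "F \<in> simple_classes Y W d"
  then obtain u where u: "u \<in> Y \<rightarrow>\<^sub>M mborel W d" "finite (u ` space Y)" "F = ae_class Y u"
    unfolding simple_classes_def by blast
  show "F \<in> Lp_const Y Z d p"
    unfolding u(3)
  proof (rule simple_function_in_Lp_const[OF assms(1) W.L0_maps_simple_functionD[OF u(1,2)] _ assms(3)])
    show "u \<in> space Y \<rightarrow> Z" using measurable_space[OF u(1)] assms(2) by (auto simp: W.space_mborel)
  qed
qed

text \<open>Over a finite measure all constants are equivalent as base maps, so the base can be
  chosen in \<open>W\<close>; almost simple approximants relative to such a base are simple.\<close>

lemma simple_classes_dense: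
  assumes Y: "finite_measure Y" and WZ: "W \<subseteq> Z"
    and dense: "\<And>z e. z \<in> Z \<Longrightarrow> 0 < e \<Longrightarrow> \<exists>w\<in>W. d z w < e"
    and F: "F \<in> Lp_const Y Z d p" and e: "0 < e"
  shows "\<exists>F'\<in>simple_classes Y W d. Lp_dist Y d p F F' < e"
proof -
  interpret W: Metric_space W d using subspace[OF WZ] .
  obtain w where w: "w \<in> W" using F dense[of _ 1] by (auto simp: Lp_const_def)
  have "F \<in> Lp Y Z d p (ae_class Y (\<lambda>_. w))" using F Lp_const_eq[OF Y, of w] w WZ by auto
  from almost_simple_dense[OF W.L0_maps_const[OF w] WZ dense refl this e]
  show ?thesis using almost_simple_const_subset[OF w WZ] by blast
qed

end

section \<open>Rectangles in the Caratheodory product\<close>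

lemma suminf_single_ennreal:
  fixes c :: ennreal
  shows "(\<Sum>i::nat. if i = 0 then c else 0) = c"
  using sums_single[of 0 "\<lambda>_. c"] by (simp add: sums_iff cong: if_cong)

text \<open>If rectangles \<open>F i \<times> G i\<close> cover \<open>S \<times> T\<close>, then
  for each \<open>x\<close> in \<open>S\<close> the sets \<open>G i\<close> with \<open>x\<close> in
  \<open>F i\<close> cover \<open>T\<close>. Integrating the resulting inequality for
  \<open>emeasure B T\<close> over \<open>A\<close> gives the lower bound; only a single integral
  occurs, so no \<sigma>-finiteness enters.\<close>

lemma rect_outer_rect:
  assumes S: "S \<in> sets A" and T: "T \<in> sets B"
  shows "rect_outer A B (S \<times> T) = emeasure A S * emeasure B T"
proof (rule antisym)
  have "rect_outer A B (S \<times> T) \<le> (\<Sum>i::nat. emeasure A (if i = 0 then S else {}) * emeasure B T)"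
    by (rule rect_outer_le) (use assms in \<open>auto split: if_splits\<close>)
  also have "(\<lambda>i::nat. emeasure A (if i = 0 then S else {}) * emeasure B T)
      = (\<lambda>i. if i = 0 then emeasure A S * emeasure B T else 0)"
    by auto
  finally show "rect_outer A B (S \<times> T) \<le> emeasure A S * emeasure B T"
    by (simp only: suminf_single_ennreal)
  show "emeasure A S * emeasure B T \<le> rect_outer A B (S \<times> T)"
    unfolding rect_outer_def
  proof (rule INF_greatest, clarify)
    fix F G assume FG: "range F \<subseteq> sets A" "range G \<subseteq> sets B" "S \<times> T \<subseteq> (\<Union>i::nat. F i \<times> G i)"
    have F [measurable]: "F i \<in> sets A" and G: "G i \<in> sets B" for i using FG by auto
    have "emeasure A S * emeasure B T = (\<integral>\<^sup>+x. emeasure B T * indicator S x \<partial>A)"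
      using S by (subst nn_integral_cmult_indicator) (simp_all add: mult.commute)
    also have "\<dots> \<le> (\<integral>\<^sup>+x. (\<Sum>i. emeasure B (G i) * indicator (F i) x) \<partial>A)"
    proof (rule nn_integral_mono)
      fix x
      show "emeasure B T * indicator S x \<le> (\<Sum>i. emeasure B (G i) * indicator (F i) x)"
      proof (cases "x \<in> S")
        case True
        have "emeasure B T \<le> emeasure B (\<Union>i. if x \<in> F i then G i else {})"
        proof (rule emeasure_mono)
          show "T \<subseteq> (\<Union>i. if x \<in> F i then G i else {})"
          proof
            fix y assume "y \<in> T"
            with True FG(3) obtain i where "x \<in> F i" "y \<in> G i" by blast
            then show "y \<in> (\<Union>i. if x \<in> F i then G i else {})" by (intro UN_I[of i]) auto
          qed
        qed (use G in auto)
        also have "\<dots> \<le> (\<Sum>i. emeasure B (if x \<in> F i then G i else {}))"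
          by (rule emeasure_subadditive_countably) (use G in auto)
        also have "\<dots> = (\<Sum>i. emeasure B (G i) * indicator (F i) x)"
          by (intro suminf_cong) auto
        finally show ?thesis using True by simp
      qed simp
    qed
    also have "\<dots> = (\<Sum>i. emeasure A (F i) * emeasure B (G i))"
      by (subst nn_integral_suminf) (simp_all add: nn_integral_cmult_indicator F, simp add: mult.commute)
    finally show "emeasure A S * emeasure B T \<le> (\<Sum>i. emeasure A (F i) * emeasure B (G i))" .
  qed
qed

lemma rect_outer_Un_le: "rect_outer A B (E \<union> F) \<le> rect_outer A B E + rect_outer A B F"
proof -
  have os: "outer_measure_space (Pow UNIV) (rect_outer A B)" by (rule outer_measure_space_rect_outer)
  have e: "rect_outer A B {} = 0" using os by (simp add: outer_measure_space_def positive_def)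
  have mono: "rect_outer A B X \<le> rect_outer A B X'" if "X \<subseteq> X'" for X X'
    using os that by (simp add: outer_measure_space_def increasing_def)
  have "subadditive (Pow UNIV) (rect_outer A B)"
    using os algebra.axioms(1)[OF sigma_algebra.axioms(1)[OF sigma_algebra_Pow]]
    unfolding outer_measure_space_def by (blast intro: ring_of_sets.countably_subadditive_subadditive)
  \<comment> \<open>\<open>subadditive\<close> speaks of disjoint sets only, hence the difference
    \<open>F - E\<close>.\<close>
  then have "rect_outer A B (E \<union> (F - E)) \<le> rect_outer A B E + rect_outer A B (F - E)"
    unfolding subadditive_def by blast
  also have "\<dots> \<le> rect_outer A B E + rect_outer A B F" by (intro add_left_mono mono) auto
  finally show ?thesis by simp
qed

text \<open>Caratheodory's criterion is checked on covers of the test set: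
  \<open>S \<times> T\<close> cuts each covering rectangle into three, one inside and two outside,
  and their products of measures add up to the original one.\<close>

lemma rect_in_sets_cprod [measurable (raw)]:
  assumes S: "S \<in> sets A" and T: "T \<in> sets B"
  shows "S \<times> T \<in> sets (cprod A B)"
  unfolding sets_cprod lambda_system_def
proof (intro CollectI conjI ballI antisym)
  show "S \<times> T \<in> Pow (space A \<times> space B)"
    using sets.sets_into_space[OF S] sets.sets_into_space[OF T] by auto
  fix E assume E: "E \<in> Pow (space A \<times> space B)"
  let ?C = "space A \<times> space B - S \<times> T"
  have "E = S \<times> T \<inter> E \<union> ?C \<inter> E" using E by auto
  then show "rect_outer A B E \<le> rect_outer A B (S \<times> T \<inter> E) + rect_outer A B (?C \<inter> E)"
    using rect_outer_Un_le[of A B "S \<times> T \<inter> E" "?C \<inter> E"] by simp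
  show "rect_outer A B (S \<times> T \<inter> E) + rect_outer A B (?C \<inter> E) \<le> rect_outer A B E"
  proof (rule dense_ge)
    fix c assume "rect_outer A B E < c"
    then show "rect_outer A B (S \<times> T \<inter> E) + rect_outer A B (?C \<inter> E) \<le> c"
    proof (rule rect_outer_lessE)
      fix F G assume FG: "\<And>i::nat. F i \<in> sets A" "\<And>i. G i \<in> sets B" "E \<subseteq> (\<Union>i. F i \<times> G i)"
        "(\<Sum>i. emeasure A (F i) * emeasure B (G i)) < c"
      let ?m = "\<lambda>X Y. emeasure A X * emeasure B Y"
      have 1: "rect_outer A B (S \<times> T \<inter> E) \<le> (\<Sum>i. ?m (F i \<inter> S) (G i \<inter> T))"
        by (rule rect_outer_le) (use FG(1-3) S T in auto)
      have 2: "rect_outer A B ((?C \<inter> E) \<inter> - (S \<times> UNIV)) \<le> (\<Sum>i. ?m (F i - S) (G i))"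
        by (rule rect_outer_le) (use FG(1-3) S T in auto)
      have 3: "rect_outer A B ((?C \<inter> E) \<inter> (S \<times> UNIV)) \<le> (\<Sum>i. ?m (F i \<inter> S) (G i - T))"
        by (rule rect_outer_le) (use FG(1-3) S T in auto)
      have "?C \<inter> E = ((?C \<inter> E) \<inter> - (S \<times> UNIV)) \<union> ((?C \<inter> E) \<inter> (S \<times> UNIV))" by blast
      then have "rect_outer A B (?C \<inter> E) \<le> (\<Sum>i. ?m (F i - S) (G i)) + (\<Sum>i. ?m (F i \<inter> S) (G i - T))"
        using order_trans[OF rect_outer_Un_le add_mono[OF 2 3]] by simp
      then have "rect_outer A B (S \<times> T \<inter> E) + rect_outer A B (?C \<inter> E)
          \<le> (\<Sum>i. ?m (F i \<inter> S) (G i \<inter> T)) + ((\<Sum>i. ?m (F i - S) (G i)) + (\<Sum>i. ?m (F i \<inter> S) (G i - T)))"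
        using 1 by (rule add_mono[rotated])
      also have "\<dots> = (\<Sum>i. ?m (F i \<inter> S) (G i \<inter> T) + (?m (F i - S) (G i) + ?m (F i \<inter> S) (G i - T)))"
        by (simp add: suminf_add)
      also have "\<dots> = (\<Sum>i. ?m (F i) (G i))"
      proof (rule suminf_cong)
        fix i
        have a: "emeasure A (F i) = emeasure A (F i \<inter> S) + emeasure A (F i - S)"
          using plus_emeasure[of "F i \<inter> S" A "F i - S"] FG(1) S by (simp add: Int_Diff_Un Int_Diff_disjoint)
        have b: "emeasure B (G i) = emeasure B (G i \<inter> T) + emeasure B (G i - T)"
          using plus_emeasure[of "G i \<inter> T" B "G i - T"] FG(2) T by (simp add: Int_Diff_Un Int_Diff_disjoint)
        show "?m (F i \<inter> S) (G i \<inter> T) + (?m (F i - S) (G i) + ?m (F i \<inter> S) (G i - T)) = ?m (F i) (G i)"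
          unfolding a b by (simp add: distrib_left distrib_right ac_simps)
      qed
      finally show ?thesis using FG(4) by simp
    qed
  qed
qed

lemma emeasure_cprod_rect:
  assumes "S \<in> sets A" "T \<in> sets B"
  shows "emeasure (cprod A B) (S \<times> T) = emeasure A S * emeasure B T"
  by (simp add: emeasure_cprod rect_in_sets_cprod rect_outer_rect assms)

section \<open>Projections and null sets of the Caratheodory product\<close>

lemma measurable_fst_cprod [measurable]: "fst \<in> cprod A B \<rightarrow>\<^sub>M A"
proof (rule measurableI)
  fix S assume S: "S \<in> sets A"
  have "fst -` S \<inter> space (cprod A B) = S \<times> space B"
    using sets.sets_into_space[OF S] by (auto simp: space_cprod)
  then show "fst -` S \<inter> space (cprod A B) \<in> sets (cprod A B)" using S by (simp add: rect_in_sets_cprod)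
qed (auto simp: space_cprod)

lemma measurable_snd_cprod [measurable]: "snd \<in> cprod A B \<rightarrow>\<^sub>M B"
proof (rule measurableI)
  fix S assume S: "S \<in> sets B"
  have "snd -` S \<inter> space (cprod A B) = space A \<times> S"
    using sets.sets_into_space[OF S] by (auto simp: space_cprod)
  then show "snd -` S \<inter> space (cprod A B) \<in> sets (cprod A B)" using S by (simp add: rect_in_sets_cprod)
qed (auto simp: space_cprod)

lemma AE_cprod_fst:
  assumes "AE x in A. P x" shows "AE z in cprod A B. P (fst z)"
proof -
  obtain E where E: "E \<in> null_sets A" "{x \<in> space A. \<not> P x} \<subseteq> E"
    using assms by (auto simp: eventually_ae_filter)
  have "E \<times> space B \<in> null_sets (cprod A B)"
    using E(1) by (auto simp: null_sets_def rect_in_sets_cprod emeasure_cprod_rect)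
  then show ?thesis by (rule AE_I') (use E(2) in \<open>auto simp: space_cprod\<close>)
qed

lemma AE_cprod_snd:
  assumes "AE y in B. P y" shows "AE z in cprod A B. P (snd z)"
proof -
  obtain E where E: "E \<in> null_sets B" "{x \<in> space B. \<not> P x} \<subseteq> E"
    using assms by (auto simp: eventually_ae_filter)
  have "space A \<times> E \<in> null_sets (cprod A B)"
    using E(1) by (auto simp: null_sets_def rect_in_sets_cprod emeasure_cprod_rect)
  then show ?thesis by (rule AE_I') (use E(2) in \<open>auto simp: space_cprod\<close>)
qed

text \<open>A nearly optimal countable cover differs little from \<open>E\<close>, and continuity
  from above on the finite-measure union allows cutting it to finitely many rectangles. Finite
  measure of the sides \<open>T i\<close> is required later, because a section may deviate from the
  base map only on a set of finite measure.\<close>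

lemma cprod_approx_rectangles:
  assumes E: "E \<in> sets (cprod A B)" and fin: "emeasure (cprod A B) E < \<infinity>" and e: "0 < (e::real)"
  obtains n :: nat and S T where "\<And>i. S i \<in> sets A" "\<And>i. T i \<in> sets B" "\<And>i. emeasure B (T i) < \<infinity>"
    "emeasure (cprod A B) ((E - (\<Union>i<n. S i \<times> T i)) \<union> ((\<Union>i<n. S i \<times> T i) - E)) < ennreal e"
proof -
  let ?\<mu> = "emeasure (cprod A B)"
  have lt: "rect_outer A B E < ?\<mu> E + ennreal (e / 2)"
    using fin e by (simp add: emeasure_cprod[OF E, symmetric] ennreal_add_left_cancel_less)
  obtain S T where ST: "\<And>i::nat. S i \<in> sets A" "\<And>i. T i \<in> sets B" "E \<subseteq> (\<Union>i. S i \<times> T i)"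
    and sum: "(\<Sum>i. emeasure A (S i) * emeasure B (T i)) < ?\<mu> E + ennreal (e / 2)"
    by (rule rect_outer_lessE[OF lt]) blast
  \<comment> \<open>A side of infinite measure occurs only with a null set \<open>S i\<close>, since
    each product in the sum is finite. Emptying such sides changes the cover by a null set.\<close>
  define T' where "T' i = (if emeasure B (T i) = \<infinity> then {} else T i)" for i
  have T' [measurable]: "T' i \<in> sets B" and T'fin: "emeasure B (T' i) < \<infinity>" for i
    using ST(2) by (auto simp: T'_def less_top)
  note [measurable] = ST(1,2) E
  define U where "U = (\<Union>i. S i \<times> T i)"
  define R where "R n = (\<Union>i<n. S i \<times> T' i)" for n
  define V where "V = (\<Union>i. S i \<times> T' i)"
  have [measurable]: "U \<in> sets (cprod A B)" "R n \<in> sets (cprod A B)" "V \<in> sets (cprod A B)" for n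
    unfolding U_def R_def V_def by (auto intro!: sets.countable_UN sets.finite_UN rect_in_sets_cprod ST)
  have "?\<mu> U \<le> (\<Sum>i. ?\<mu> (S i \<times> T i))"
    unfolding U_def by (rule emeasure_subadditive_countably) (auto intro!: rect_in_sets_cprod ST)
  also have "\<dots> = (\<Sum>i. emeasure A (S i) * emeasure B (T i))" by (simp add: emeasure_cprod_rect ST)
  finally have U: "?\<mu> U < ?\<mu> E + ennreal (e / 2)" using sum by (rule le_less_trans)
  have prodfin: "emeasure A (S i) * emeasure B (T i) < \<infinity>" for i
  proof -
    have "(\<Sum>i. emeasure A (S i) * emeasure B (T i)) < top"
      using sum fin by (auto intro: less_trans)
    then show ?thesis unfolding infinity_ennreal_def by (rule ennreal_suminf_lessD)
  qed
  have UV: "U - V \<in> null_sets (cprod A B)"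
  proof (rule null_sets_subset)
    show "(\<Union>i. S i \<times> (T i - T' i)) \<in> null_sets (cprod A B)"
    proof (intro null_sets_UN)
      fix i
      have "emeasure A (S i) * emeasure B (T i - T' i) = 0"
        using prodfin[of i] by (auto simp: T'_def ennreal_mult_less_top)
      then show "S i \<times> (T i - T' i) \<in> null_sets (cprod A B)"
        using ST by (auto simp: null_sets_def rect_in_sets_cprod emeasure_cprod_rect)
    qed
  qed (auto simp: U_def V_def)
  have UE: "?\<mu> (U - E) < ennreal (e / 2)"
  proof -
    have "?\<mu> E + ?\<mu> (U - E) = ?\<mu> U"
      using plus_emeasure[of E "cprod A B" "U - E"] ST(3) by (simp add: U_def Un_absorb1)
    then show ?thesis using U fin by (metis ennreal_add_left_cancel_less infinity_ennreal_def)
  qed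
  have VU: "V \<subseteq> U" by (auto simp: U_def V_def T'_def split: if_splits)
  have "?\<mu> V \<le> ?\<mu> U" by (rule emeasure_mono[OF VU]) simp
  also have "\<dots> < \<infinity>" using U fin by (auto intro: less_trans)
  finally have Vfin: "?\<mu> V < \<infinity>" .
  have "(\<lambda>n. ?\<mu> (V - R n)) \<longlonglongrightarrow> ?\<mu> (\<Inter>n. V - R n)"
  proof (rule Lim_emeasure_decseq)
    show "decseq (\<lambda>n. V - R n)" by (force simp: decseq_def R_def)
    show "?\<mu> (V - R n) \<noteq> \<infinity>" for n
      using emeasure_mono[of "V - R n" V "cprod A B"] Vfin by (auto simp: top_unique less_top)
  qed auto
  moreover have "(\<Inter>n. V - R n) = {}" by (auto simp: V_def R_def)
  ultimately have "(\<lambda>n. ?\<mu> (V - R n)) \<longlonglongrightarrow> 0" by (simp only: emeasure_empty)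
  then have "eventually (\<lambda>n. ?\<mu> (V - R n) < ennreal (e / 2)) sequentially"
    using e by (intro order_tendstoD(2)) auto
  then obtain n where n: "?\<mu> (V - R n) < ennreal (e / 2)" by (auto simp: eventually_sequentially)
  have "R n \<subseteq> V" by (auto simp: V_def R_def)
  have "?\<mu> ((E - R n) \<union> (R n - E)) \<le> ?\<mu> ((U - E) \<union> (V - R n) \<union> (U - V))"
    by (rule emeasure_mono) (use ST(3) VU \<open>R n \<subseteq> V\<close> in \<open>auto simp: U_def[symmetric]\<close>)
  also have "\<dots> = ?\<mu> ((U - E) \<union> (V - R n))"
    by (rule emeasure_Un_null_set[OF _ UV]) simp
  also have "\<dots> \<le> ?\<mu> (U - E) + ?\<mu> (V - R n)" by (rule emeasure_subadditive) auto
  also have "\<dots> < ennreal (e / 2) + ennreal (e / 2)" by (intro add_strict_mono UE n)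
  also have "\<dots> = ennreal e" using e by (simp flip: ennreal_plus)
  finally show thesis unfolding R_def by (rule that[of S T' n, OF ST(1) T' T'fin])
qed

section \<open>Fubini for functions with finitely many sections\<close>

text \<open>For an indicator \<open>\<phi>\<close> this is the measure of a rectangle; linearity and
  monotone convergence do the rest. Separated variables are what frees it from
  \<sigma>-finiteness.\<close>

lemma nn_integral_cprod_strip:
  assumes S [measurable]: "S \<in> sets A" and \<phi>: "\<phi> \<in> borel_measurable B"
  shows "(\<integral>\<^sup>+z. indicator S (fst z) * \<phi> (snd z) \<partial>cprod A B) = emeasure A S * (\<integral>\<^sup>+y. \<phi> y \<partial>B)"
  using \<phi>
proof (induction rule: borel_measurable_induct)
  case (cong f g)
  have "(\<integral>\<^sup>+z. indicator S (fst z) * f (snd z) \<partial>cprod A B) = (\<integral>\<^sup>+z. indicator S (fst z) * g (snd z) \<partial>cprod A B)"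
    by (rule nn_integral_cong) (auto simp: space_cprod cong.hyps(3))
  moreover have "(\<integral>\<^sup>+y. f y \<partial>B) = (\<integral>\<^sup>+y. g y \<partial>B)" by (rule nn_integral_cong) (simp add: cong.hyps(3))
  ultimately show ?case using cong by simp
next
  case (set T)
  have "(\<integral>\<^sup>+z. indicator S (fst z) * indicator T (snd z) \<partial>cprod A B) = (\<integral>\<^sup>+z. indicator (S \<times> T) z \<partial>cprod A B)"
    by (rule nn_integral_cong) (auto split: split_indicator)
  then show ?case using set by (simp add: rect_in_sets_cprod emeasure_cprod_rect)
next
  case (mult u c)
  note [measurable] = mult(2)
  have "(\<integral>\<^sup>+z. indicator S (fst z) * (c * u (snd z)) \<partial>cprod A B) = (\<integral>\<^sup>+z. c * (indicator S (fst z) * u (snd z)) \<partial>cprod A B)"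
    by (simp add: ac_simps)
  also have "\<dots> = c * (\<integral>\<^sup>+z. (indicator S (fst z) * u (snd z)) \<partial>cprod A B)"
    by (rule nn_integral_cmult) measurable
  finally show ?case using mult by (simp add: nn_integral_cmult ac_simps)
next
  case (add u v)
  note [measurable] = add(1,3)
  show ?case using add by (simp add: distrib_left nn_integral_add)
next
  case (seq U)
  note [measurable] = seq(1)
  have inc: "incseq (\<lambda>i z. indicator S (fst z) * U i (snd z) :: ennreal)"
    using seq(3) by (auto simp: incseq_def le_fun_def intro: mult_left_mono)
  have "(\<integral>\<^sup>+z. indicator S (fst z) * (SUP i. U i) (snd z) \<partial>cprod A B)
      = (\<integral>\<^sup>+z. (SUP i. indicator S (fst z) * U i (snd z)) \<partial>cprod A B)"
    by (simp add: SUP_mult_left_ennreal image_comp)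
  also have "\<dots> = (SUP i. (\<integral>\<^sup>+z. indicator S (fst z) * U i (snd z) \<partial>cprod A B))"
    by (rule nn_integral_monotone_convergence_SUP[OF inc]) measurable
  also have "\<dots> = (SUP i. emeasure A S * (\<integral>\<^sup>+y. U i y \<partial>B))" using seq by simp
  also have "\<dots> = emeasure A S * (\<integral>\<^sup>+y. (SUP i. U i y) \<partial>B)"
    using nn_integral_monotone_convergence_SUP[OF seq(3,1)] by (simp add: SUP_mult_left_ennreal)
  finally show ?case by (simp add: image_comp)
qed

text \<open>A map with finitely many distinct sections is constant in the first variable on finitely
  many strips, so its preimages are finite unions of rectangles.\<close>

lemma measurable_cprod_curry:
  assumes c: "simple_function A (curry c)" and meas: "\<And>t. t \<in> space A \<Longrightarrow> curry c t \<in> B \<rightarrow>\<^sub>M N"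
  shows "c \<in> cprod A B \<rightarrow>\<^sub>M N"
proof (rule measurableI)
  fix z assume "z \<in> space (cprod A B)"
  then show "c z \<in> space N" using measurable_space[OF meas, of "fst z" "snd z"] by (auto simp: space_cprod)
next
  fix X assume X: "X \<in> sets N"
  have "c -` X \<inter> space (cprod A B) = (\<Union>\<phi>\<in>curry c ` space A. (curry c -` {\<phi>} \<inter> space A) \<times> (\<phi> -` X \<inter> space B))"
    by (auto simp: space_cprod curry_def fun_eq_iff)
  also have "\<dots> \<in> sets (cprod A B)"
    using simple_functionD[OF c] measurable_sets[OF meas X]
    by (intro sets.finite_UN rect_in_sets_cprod) auto
  finally show "c -` X \<inter> space (cprod A B) \<in> sets (cprod A B)" .
qed

text \<open>\<open>simple_function\<close> is applied to the function-valued map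
  \<open>curry f\<close>. With \<open>\<Phi>\<close> its finite set of sections,
  \<open>f (t, x)\<close> is the sum of \<open>indicator (S \<phi>) t * \<phi> x\<close>, and all
  three integrals become the same finite sum of products.\<close>

lemma nn_integral_cprod_curry:
  fixes f :: "'a \<times> 'b \<Rightarrow> ennreal"
  assumes f: "simple_function A (curry f)" and meas: "\<And>t. t \<in> space A \<Longrightarrow> curry f t \<in> borel_measurable B"
  shows nn_integral_cprod_fst: "(\<integral>\<^sup>+z. f z \<partial>cprod A B) = (\<integral>\<^sup>+t. \<integral>\<^sup>+x. f (t, x) \<partial>B \<partial>A)"
    and nn_integral_cprod_snd: "(\<integral>\<^sup>+z. f z \<partial>cprod A B) = (\<integral>\<^sup>+x. \<integral>\<^sup>+t. f (t, x) \<partial>A \<partial>B)"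
    and borel_measurable_cprod_snd: "(\<lambda>x. \<integral>\<^sup>+t. f (t, x) \<partial>A) \<in> borel_measurable B"
proof -
  define \<Phi> where "\<Phi> = curry f ` space A"
  define S where "S \<phi> = curry f -` {\<phi>} \<inter> space A" for \<phi>
  have fin: "finite \<Phi>" using simple_functionD(1)[OF f] by (simp add: \<Phi>_def)
  have S [measurable]: "S \<phi> \<in> sets A" for \<phi> using simple_functionD(2)[OF f] by (simp add: S_def)
  have \<Phi> [measurable]: "\<phi> \<in> borel_measurable B" if "\<phi> \<in> \<Phi>" for \<phi> using that meas by (auto simp: \<Phi>_def)
  have f_eq: "f (t, x) = (\<Sum>\<phi>\<in>\<Phi>. indicator (S \<phi>) t * \<phi> x)" if "t \<in> space A" for t x
  proof -
    have "(\<Sum>\<phi>\<in>\<Phi>. indicator (S \<phi>) t * \<phi> x) = (\<Sum>\<phi>\<in>\<Phi>. if \<phi> = curry f t then f (t, x) else 0)"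
      using that by (intro sum.cong) (auto simp: S_def split: split_indicator)
    then show ?thesis using that fin by (simp add: \<Phi>_def)
  qed
  have "(\<integral>\<^sup>+z. f z \<partial>cprod A B) = (\<integral>\<^sup>+z. (\<Sum>\<phi>\<in>\<Phi>. indicator (S \<phi>) (fst z) * \<phi> (snd z)) \<partial>cprod A B)"
    by (rule nn_integral_cong) (auto simp: space_cprod f_eq)
  also have "\<dots> = (\<Sum>\<phi>\<in>\<Phi>. \<integral>\<^sup>+z. indicator (S \<phi>) (fst z) * \<phi> (snd z) \<partial>cprod A B)"
    using \<Phi> by (intro nn_integral_sum) measurable
  finally have lhs: "(\<integral>\<^sup>+z. f z \<partial>cprod A B) = (\<Sum>\<phi>\<in>\<Phi>. emeasure A (S \<phi>) * (\<integral>\<^sup>+x. \<phi> x \<partial>B))"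
    using \<Phi> by (simp add: nn_integral_cprod_strip)
  have "(\<integral>\<^sup>+t. \<integral>\<^sup>+x. f (t, x) \<partial>B \<partial>A) = (\<integral>\<^sup>+t. (\<Sum>\<phi>\<in>\<Phi>. (\<integral>\<^sup>+x. \<phi> x \<partial>B) * indicator (S \<phi>) t) \<partial>A)"
    using \<Phi> by (intro nn_integral_cong) (simp add: f_eq nn_integral_sum nn_integral_cmult mult.commute[of _ "indicator _ _"])
  also have "\<dots> = (\<Sum>\<phi>\<in>\<Phi>. \<integral>\<^sup>+t. (\<integral>\<^sup>+x. \<phi> x \<partial>B) * indicator (S \<phi>) t \<partial>A)"
    by (intro nn_integral_sum) measurable
  also have "\<dots> = (\<Sum>\<phi>\<in>\<Phi>. emeasure A (S \<phi>) * (\<integral>\<^sup>+x. \<phi> x \<partial>B))"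
    by (simp add: nn_integral_cmult_indicator mult.commute)
  finally show "(\<integral>\<^sup>+z. f z \<partial>cprod A B) = (\<integral>\<^sup>+t. \<integral>\<^sup>+x. f (t, x) \<partial>B \<partial>A)" using lhs by simp
  have inner: "(\<integral>\<^sup>+t. f (t, x) \<partial>A) = (\<Sum>\<phi>\<in>\<Phi>. emeasure A (S \<phi>) * \<phi> x)" for x
  proof -
    have "(\<integral>\<^sup>+t. f (t, x) \<partial>A) = (\<integral>\<^sup>+t. (\<Sum>\<phi>\<in>\<Phi>. \<phi> x * indicator (S \<phi>) t) \<partial>A)"
      by (intro nn_integral_cong) (simp add: f_eq mult.commute)
    also have "\<dots> = (\<Sum>\<phi>\<in>\<Phi>. \<integral>\<^sup>+t. \<phi> x * indicator (S \<phi>) t \<partial>A)"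
      by (intro nn_integral_sum) measurable
    finally show ?thesis by (simp add: nn_integral_cmult_indicator mult.commute)
  qed
  show "(\<lambda>x. \<integral>\<^sup>+t. f (t, x) \<partial>A) \<in> borel_measurable B"
    unfolding inner using \<Phi> by measurable
  have "(\<integral>\<^sup>+x. \<integral>\<^sup>+t. f (t, x) \<partial>A \<partial>B) = (\<Sum>\<phi>\<in>\<Phi>. \<integral>\<^sup>+x. emeasure A (S \<phi>) * \<phi> x \<partial>B)"
    unfolding inner using \<Phi> by (intro nn_integral_sum) measurable
  then show "(\<integral>\<^sup>+z. f z \<partial>cprod A B) = (\<integral>\<^sup>+x. \<integral>\<^sup>+t. f (t, x) \<partial>A \<partial>B)"
    unfolding lhs using \<Phi> by (simp add: nn_integral_cmult)
qed

section \<open>Step maps\<close>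

text \<open>Of the interval only finiteness of its measure is kept. Fixing a representative
  \<open>h0\<close> allows pointwise constructions relative to the base map.\<close>

locale section_space = Lp_space N d p for N :: "'n set" and d p +
  fixes I :: "'t measure" and M :: "'m measure" and h0 :: "'m \<Rightarrow> 'n"
  assumes finI: "finite_measure I" and h0: "h0 \<in> L0_maps M N d" and N_nonempty: "N \<noteq> {}"
begin

abbreviation h where "h \<equiv> ae_class M h0"

lemma emeasure_I_finite: "emeasure I A < top"
  using finite_measure.emeasure_finite[OF finI, of A] by (simp add: less_top[symmetric])

lemma h_L0: "h \<in> L0 M N d" by (rule L0I[OF h0])

lemma hat_class_eq: "hat_class I M h = ae_class (cprod I M) (\<lambda>z. h0 (snd z))"
  unfolding hat_class_def ae_class_eq_iff
  using AE_cprod_snd[OF AE_class_rep, of M h0 I] by (simp add: case_prod_beta)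

lemma under_class_eq: "under_class I M h = ae_class M (\<lambda>x. ae_class I (\<lambda>_. h0 x))"
  unfolding under_class_def ae_class_eq_iff[of M]
  using AE_class_rep[of M h0] by eventually_elim simp

lemma hat_L0_maps: "(\<lambda>z. h0 (snd z)) \<in> L0_maps (cprod I M) N d"
  by (rule L0_maps_compose[OF h0 measurable_snd_cprod])

lemma hat_L0: "hat_class I M h \<in> L0 (cprod I M) N d"
  unfolding hat_class_eq by (rule L0I[OF hat_L0_maps])

text \<open>Representatives of almost simple classes for which the equality with \<open>h0\<close>
  off \<open>B\<close> holds at every point. Sections can then be overwritten and counted as
  functions, without null sets.\<close>

definition asimple :: "('m \<Rightarrow> 'n) set"
  where "asimple = {u \<in> L0_maps M N d. \<exists>B\<in>sets M. emeasure M B < \<infinity> \<and> finite (u ` B) \<and> (\<forall>x. x \<notin> B \<longrightarrow> u x = h0 x)}"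

text \<open>The rectangular almost simple maps in curried form: finitely many distinct sections,
  each almost simple. This is the form to which Fubini for finitely many sections applies.\<close>

definition step :: "('t \<times> 'm \<Rightarrow> 'n) \<Rightarrow> bool"
  where "step c \<longleftrightarrow> simple_function I (curry c) \<and> (\<forall>t\<in>space I. curry c t \<in> asimple)"

text \<open>Integrability is asked of every section, so that all values of the curve of sections lie
  in the L^p space; finiteness of the double integral would give it only for almost every
  \<open>t\<close>.\<close>

definition Lp_step :: "('t \<times> 'm \<Rightarrow> 'n) \<Rightarrow> bool"
  where "Lp_step c \<longleftrightarrow> step c \<and> (\<forall>t\<in>space I. (\<integral>\<^sup>+x. ennreal (d (c (t, x)) (h0 x) powr p) \<partial>M) < \<infinity>)"

section \<open>Operations on step maps\<close>

lemma asimple_L0_maps: "u \<in> asimple \<Longrightarrow> u \<in> L0_maps M N d"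
  by (simp add: asimple_def)

lemma h0_asimple: "h0 \<in> asimple"
  unfolding asimple_def using h0 by (auto intro!: bexI[of _ "{}"])

lemma asimple_upd:
  assumes u: "u \<in> asimple" and T: "T \<in> sets M" "emeasure M T < \<infinity>" and y: "y \<in> N"
  shows "(\<lambda>x. if x \<in> T then y else u x) \<in> asimple"
proof -
  obtain B where B: "B \<in> sets M" "emeasure M B < \<infinity>" "finite (u ` B)" "\<forall>x. x \<notin> B \<longrightarrow> u x = h0 x"
    using u by (auto simp: asimple_def)
  have "(\<lambda>x. if x \<in> T then y else u x) \<in> L0_maps M N d"
    by (intro L0_maps_If L0_maps_const y asimple_L0_maps u)
      (use T sets.sets_into_space[OF T(1)] in \<open>simp add: Collect_conj_eq Int_absorb1\<close>)
  moreover have "emeasure M (B \<union> T) < \<infinity>"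
    using emeasure_subadditive[OF B(1) T(1)] B(2) T(2) by (simp add: order_le_less_trans)
  moreover have "finite ((\<lambda>x. if x \<in> T then y else u x) ` (B \<union> T))"
    by (rule finite_subset[of _ "insert y (u ` B)"]) (use B(3) in auto)
  ultimately show ?thesis
    unfolding asimple_def using B T by (auto intro!: bexI[of _ "B \<union> T"])
qed

lemma step_hat: "step (\<lambda>z. h0 (snd z))"
  using h0_asimple by (simp add: step_def curry_def)

text \<open>Overwriting on a rectangle acts on the curried map by applying one fixed operation
  \<open>upd\<close> to the sections with \<open>t\<close> in \<open>S\<close>, so the number of
  sections stays finite.\<close>

lemma step_upd:
  assumes c: "step c" and S: "S \<in> sets I" and T: "T \<in> sets M" "emeasure M T < \<infinity>" and y: "y \<in> N"
  shows "step (\<lambda>z. if z \<in> S \<times> T then y else c z)"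
proof -
  define upd where "upd u = (\<lambda>x. if x \<in> T then y else u x)" for u
  have eq: "curry (\<lambda>z. if z \<in> S \<times> T then y else c z) = (\<lambda>t. if t \<in> S then (upd \<circ> curry c) t else curry c t)"
    by (auto simp: fun_eq_iff curry_def upd_def)
  have "simple_function I (curry (\<lambda>z. if z \<in> S \<times> T then y else c z))"
    unfolding eq using c S by (intro simple_function_If_set) (auto simp: step_def simp del: comp_apply)
  moreover have "curry (\<lambda>z. if z \<in> S \<times> T then y else c z) t \<in> asimple" if "t \<in> space I" for t
    unfolding eq using c that asimple_upd[OF _ T y] by (auto simp: step_def upd_def)
  ultimately show ?thesis by (simp add: step_def)
qed

lemma step_upd_UN:
  assumes c: "step c" and S: "\<And>i. S i \<in> sets I" and T: "\<And>i. T i \<in> sets M" "\<And>i. emeasure M (T i) < \<infinity>"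
    and y: "y \<in> N"
  shows "step (\<lambda>z. if z \<in> (\<Union>i<n::nat. S i \<times> T i) then y else c z)"
proof (induction n)
  case (Suc n)
  have "(\<lambda>z. if z \<in> (\<Union>i<Suc n. S i \<times> T i) then y else c z)
      = (\<lambda>z. if z \<in> S n \<times> T n then y else if z \<in> (\<Union>i<n. S i \<times> T i) then y else c z)"
    by (auto simp: fun_eq_iff less_Suc_eq)
  then show ?case using step_upd[OF Suc.IH S T y] by simp
qed (use c in simp)

lemma step_sections: "step c \<Longrightarrow> t \<in> space I \<Longrightarrow> (\<lambda>x. c (t, x)) \<in> L0_maps M N d"
  using asimple_L0_maps by (auto simp: step_def curry_def)

lemma step_L0_maps:
  assumes c: "step c" shows "c \<in> L0_maps (cprod I M) N d"
proof -
  have sf: "simple_function I (curry c)" using c by (simp add: step_def)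
  have m: "c \<in> cprod I M \<rightarrow>\<^sub>M mborel N d"
    by (rule measurable_cprod_curry[OF sf]) (use c in \<open>auto simp: step_def intro!: L0_maps_measurable asimple_L0_maps\<close>)
  have "\<forall>\<phi>\<in>curry c ` space I. \<exists>D. countable D \<and> D \<subseteq> N \<and> (\<forall>x\<in>space M. \<forall>e>0. \<exists>z\<in>D. d (\<phi> x) z < e)"
  proof
    fix \<phi> assume "\<phi> \<in> curry c ` space I"
    then have \<phi>: "\<phi> \<in> L0_maps M N d" using c by (auto simp: step_def intro: asimple_L0_maps)
    obtain D where "countable D" "D \<subseteq> \<phi> ` space M" "D \<subseteq> N"
      "\<And>x e. x \<in> space M \<Longrightarrow> 0 < e \<Longrightarrow> \<exists>z\<in>D. d (\<phi> x) z < e"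
      by (rule L0_maps_dense[OF \<phi>]) blast
    then show "\<exists>D. countable D \<and> D \<subseteq> N \<and> (\<forall>x\<in>space M. \<forall>e>0. \<exists>z\<in>D. d (\<phi> x) z < e)"
      by (intro exI[of _ D]) simp
  qed
  then obtain D where D: "\<And>\<phi>. \<phi> \<in> curry c ` space I \<Longrightarrow> countable (D \<phi>)" "\<And>\<phi>. \<phi> \<in> curry c ` space I \<Longrightarrow> D \<phi> \<subseteq> N"
    "\<And>\<phi> x e. \<phi> \<in> curry c ` space I \<Longrightarrow> x \<in> space M \<Longrightarrow> 0 < e \<Longrightarrow> \<exists>z\<in>D \<phi>. d (\<phi> x) z < e"
    by metis
  show ?thesis
  proof (rule L0_mapsI)
    show cN: "c \<in> space (cprod I M) \<rightarrow> N" using measurable_space[OF m] by (auto simp: space_mborel)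
    show "countable (\<Union>\<phi>\<in>curry c ` space I. D \<phi>)"
      using D(1) simple_functionD(1)[OF sf] by (intro countable_UN[OF countable_finite]) auto
    show DN: "(\<Union>\<phi>\<in>curry c ` space I. D \<phi>) \<subseteq> N" using D(2) by blast
    show "\<exists>w\<in>\<Union>\<phi>\<in>curry c ` space I. D \<phi>. d (c z) w < e" if "z \<in> space (cprod I M)" "0 < e" for z e
      using D(3)[of "curry c (fst z)" "snd z" e] that by (auto simp: space_cprod)
    show "(\<lambda>z. d (c z) w) \<in> borel_measurable (cprod I M)" if "w \<in> (\<Union>\<phi>\<in>curry c ` space I. D \<phi>)" for w
      using measurable_mborel_dist[OF m] that DN by blast
  qed
qed

text \<open>The rectangles are indexed by pairs of a section \<open>\<phi>\<close> and a value of
  \<open>\<phi>\<close> on \<open>B \<phi>\<close>: the first side collects the \<open>t\<close>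
  with section \<open>\<phi>\<close>, the second the points of \<open>B \<phi>\<close> where
  \<open>\<phi>\<close> takes that value.\<close>

lemma step_in_rect_almost_simple_classes:
  assumes c: "step c"
  shows "ae_class (cprod I M) c \<in> rect_almost_simple_classes I M N d h"
proof -
  have sf: "simple_function I (curry c)" using c by (simp add: step_def)
  define \<Phi> where "\<Phi> = curry c ` space I"
  have "\<forall>\<phi>\<in>\<Phi>. \<exists>B\<in>sets M. emeasure M B < \<infinity> \<and> finite (\<phi> ` B) \<and> (\<forall>x. x \<notin> B \<longrightarrow> \<phi> x = h0 x)"
    using c by (auto simp: step_def asimple_def \<Phi>_def)
  then obtain B where B: "\<And>\<phi>. \<phi> \<in> \<Phi> \<Longrightarrow> B \<phi> \<in> sets M" "\<And>\<phi>. \<phi> \<in> \<Phi> \<Longrightarrow> emeasure M (B \<phi>) < \<infinity>"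
    "\<And>\<phi>. \<phi> \<in> \<Phi> \<Longrightarrow> finite (\<phi> ` B \<phi>)" "\<And>\<phi> x. \<phi> \<in> \<Phi> \<Longrightarrow> x \<notin> B \<phi> \<Longrightarrow> \<phi> x = h0 x"
    by metis
  define K where "K = (SIGMA \<phi>:\<Phi>. \<phi> ` B \<phi>)"
  have "finite K" unfolding K_def \<Phi>_def
    by (intro finite_SigmaI) (use simple_functionD(1)[OF sf] B(3) in \<open>auto simp: \<Phi>_def\<close>)
  \<comment> \<open>The definition of rectangular almost simple classes wants index sets of natural
    numbers, so the finite set of pairs is enumerated.\<close>
  then obtain k where k: "bij_betw k {0..<card K} K" using ex_bij_betw_nat_finite by blast
  define S where "S j = curry c -` {fst (k j)} \<inter> space I" for j
  define T where "T j = {x \<in> B (fst (k j)). fst (k j) x = snd (k j)}" for j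
  have kK: "fst (k j) \<in> \<Phi>" "snd (k j) \<in> fst (k j) ` B (fst (k j))" if "j \<in> {0..<card K}" for j
  proof -
    have "k j \<in> K" using bij_betwE[OF k] that by blast
    then show "fst (k j) \<in> \<Phi>" "snd (k j) \<in> fst (k j) ` B (fst (k j))"
      by (cases "k j", auto simp: K_def)+
  qed
  have \<Phi>L: "\<phi> \<in> L0_maps M N d" if "\<phi> \<in> \<Phi>" for \<phi>
    using c that by (auto simp: step_def \<Phi>_def intro: asimple_L0_maps)
  have SI: "S j \<in> sets I" for j using simple_functionD(2)[OF sf] by (simp add: S_def)
  have yN: "snd (k j) \<in> N" if "j \<in> {0..<card K}" for j
    using kK[OF that] L0_maps_funcset[OF \<Phi>L[OF kK(1)[OF that]]] B(1) sets.sets_into_space[OF B(1)[OF kK(1)[OF that]]] by auto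
  have TM: "T j \<in> sets M" if j: "j \<in> {0..<card K}" for j
  proof -
    have "T j = B (fst (k j)) \<inter> (fst (k j) -` {snd (k j)} \<inter> space M)"
      using sets.sets_into_space[OF B(1)[OF kK(1)[OF j]]] by (auto simp: T_def)
    also have "\<dots> \<in> sets M"
      using measurable_sets[OF L0_maps_measurable[OF \<Phi>L[OF kK(1)[OF j]]] singleton_in_mborel[OF yN[OF j]]] B(1)[OF kK(1)[OF j]]
      by auto
    finally show ?thesis .
  qed
  have fin: "emeasure (cprod I M) (S j \<times> T j) < \<infinity>" if j: "j \<in> {0..<card K}" for j
  proof -
    have "emeasure M (T j) \<le> emeasure M (B (fst (k j)))"
      by (rule emeasure_mono) (use B(1)[OF kK(1)[OF j]] in \<open>auto simp: T_def\<close>)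
    then have "emeasure M (T j) < \<infinity>" using B(2)[OF kK(1)[OF j]] by (rule le_less_trans)
    then show ?thesis
      using emeasure_I_finite[of "S j"]
      by (simp only: emeasure_cprod_rect[OF SI TM[OF j]] ennreal_mult_less_top infinity_ennreal_def simp_thms)
  qed
  have disj: "disjoint_family_on (\<lambda>j. S j \<times> T j) {0..<card K}"
    unfolding disjoint_family_on_def
  proof (intro ballI impI)
    fix i j assume ij: "i \<in> {0..<card K}" "j \<in> {0..<card K}" "i \<noteq> j"
    then have "k i \<noteq> k j" using bij_betw_imp_inj_on[OF k] by (auto dest: inj_onD)
    then show "S i \<times> T i \<inter> S j \<times> T j = {}" by (auto simp: S_def T_def prod_eq_iff)
  qed
  have out: "c z = h0 (snd z)" if z: "z \<in> space (cprod I M)" "z \<notin> (\<Union>j\<in>{0..<card K}. S j \<times> T j)" for z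
  proof (rule ccontr)
    define \<phi> where "\<phi> = curry c (fst z)"
    assume "c z \<noteq> h0 (snd z)"
    then have ne: "\<phi> (snd z) \<noteq> h0 (snd z)" by (simp add: \<phi>_def)
    have t: "fst z \<in> space I" and \<phi>: "\<phi> \<in> \<Phi>" using z(1) by (auto simp: \<phi>_def \<Phi>_def space_cprod)
    have sB: "snd z \<in> B \<phi>" using B(4)[OF \<phi>] ne by blast
    then have "(\<phi>, \<phi> (snd z)) \<in> K" using \<phi> by (auto simp: K_def)
    then obtain j where j: "j \<in> {0..<card K}" "k j = (\<phi>, \<phi> (snd z))"
      using bij_betw_imp_surj_on[OF k] by (metis imageE)
    then have "z \<in> S j \<times> T j" using t sB by (auto simp: S_def T_def \<phi>_def mem_Times_iff)
    then show False using z(2) j(1) by blast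
  qed
  have val: "c z = snd (k j)" if "z \<in> S j \<times> T j" for z j
  proof -
    have "c z = curry c (fst z) (snd z)" by simp
    also have "\<dots> = snd (k j)" using that by (auto simp: S_def T_def mem_Times_iff simp del: curry_conv)
    finally show ?thesis .
  qed
  have AE: "AE z in cprod I M. z \<notin> (\<Union>j\<in>{0..<card K}. S j \<times> T j) \<longrightarrow> c z = class_rep (hat_class I M h) z"
    unfolding hat_class_eq using AE_class_rep[of "cprod I M" "\<lambda>z. h0 (snd z)"] AE_space
    by eventually_elim (use out in simp)
  show ?thesis
    unfolding rect_almost_simple_classes_def
  proof (intro imageI CollectI conjI L0_maps_measurable step_L0_maps c exI)
    show "finite {0..<card K}" by simp
    show "disjoint_family_on (\<lambda>j. S j \<times> T j) {0..<card K}" by (rule disj)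
    show "AE z in cprod I M. z \<notin> (\<Union>j\<in>{0..<card K}. S j \<times> T j) \<longrightarrow> c z = class_rep (hat_class I M h) z" by (rule AE)
    show "\<forall>j\<in>{0..<card K}. snd (k j) \<in> N \<and> S j \<in> sets I \<and> T j \<in> sets M \<and> emeasure (cprod I M) (S j \<times> T j) < \<infinity> \<and>
        (\<forall>z\<in>S j \<times> T j. c z = snd (k j))"
      using yN SI TM fin val by blast
  qed
qed

text \<open>The rectangles are pasted onto the base map one by one. Disjointness ensures that a new
  rectangle does not spoil the values assigned before.\<close>

lemma rect_almost_simple_classes_step:
  assumes F: "F \<in> rect_almost_simple_classes I M N d h"
  obtains c where "step c" "F = ae_class (cprod I M) c"
proof -
  obtain f and J :: "nat set" and y S T where F: "F = ae_class (cprod I M) f" and J: "finite J"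
    and j: "\<And>j. j \<in> J \<Longrightarrow> y j \<in> N" "\<And>j. j \<in> J \<Longrightarrow> S j \<in> sets I" "\<And>j. j \<in> J \<Longrightarrow> T j \<in> sets M"
      "\<And>j. j \<in> J \<Longrightarrow> emeasure (cprod I M) (S j \<times> T j) < \<infinity>" "\<And>j z. j \<in> J \<Longrightarrow> z \<in> S j \<times> T j \<Longrightarrow> f z = y j"
    and disj: "disjoint_family_on (\<lambda>j. S j \<times> T j) J"
    and out: "AE z in cprod I M. z \<notin> (\<Union>j\<in>J. S j \<times> T j) \<longrightarrow> f z = class_rep (hat_class I M h) z"
    using F unfolding rect_almost_simple_classes_def by blast
  define J' where "J' = {j \<in> J. emeasure M (T j) < \<infinity>}"
  have "\<exists>c. step c \<and> (\<forall>j\<in>K. \<forall>z\<in>S j \<times> T j. c z = y j) \<and> (\<forall>z. z \<notin> (\<Union>j\<in>K. S j \<times> T j) \<longrightarrow> c z = h0 (snd z))"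
    if "finite K" "K \<subseteq> J'" for K
    using that
  proof (induction K rule: finite_induct)
    case empty
    show ?case using step_hat by (intro exI[of _ "\<lambda>z. h0 (snd z)"]) auto
  next
    case (insert i K)
    then obtain c where c: "step c" "\<forall>j\<in>K. \<forall>z\<in>S j \<times> T j. c z = y j"
      "\<forall>z. z \<notin> (\<Union>j\<in>K. S j \<times> T j) \<longrightarrow> c z = h0 (snd z)" by auto
    have i: "i \<in> J" "emeasure M (T i) < \<infinity>" using insert.prems by (auto simp: J'_def)
    have "z \<notin> S i \<times> T i" if "z \<in> S k \<times> T k" "k \<in> K" for k z
      using disjoint_family_onD[OF disj, of i k] that i insert by (auto simp: J'_def)
    then show ?case
      using step_upd[OF c(1) j(2,3)[OF i(1)] i(2) j(1)[OF i(1)]] c(2,3)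
      by (intro exI[of _ "\<lambda>z. if z \<in> S i \<times> T i then y i else c z"]) auto
  qed
  from this[of J'] J obtain c where c: "step c" "\<forall>j\<in>J'. \<forall>z\<in>S j \<times> T j. c z = y j"
      "\<forall>z. z \<notin> (\<Union>j\<in>J'. S j \<times> T j) \<longrightarrow> c z = h0 (snd z)" by (auto simp: J'_def)
  have "(\<Union>j\<in>J - J'. S j \<times> T j) \<in> null_sets (cprod I M)"
  proof (rule null_sets_UN', rule countable_finite)
    fix i assume i: "i \<in> J - J'"
    then have "emeasure I (S i) * emeasure M (T i) = 0"
      using j(4)[of i] by (auto simp: J'_def emeasure_cprod_rect j ennreal_mult_less_top)
    then show "S i \<times> T i \<in> null_sets (cprod I M)"
      using i j by (auto simp: null_sets_def rect_in_sets_cprod emeasure_cprod_rect)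
  qed (use J in auto)
  then have "AE z in cprod I M. z \<notin> (\<Union>j\<in>J - J'. S j \<times> T j)" by (rule AE_not_in)
  then have "AE z in cprod I M. f z = c z"
    using out AE_class_rep[of "cprod I M" "\<lambda>z. h0 (snd z)"]
  proof eventually_elim
    case (elim z)
    show ?case
    proof (cases "z \<in> (\<Union>j\<in>J'. S j \<times> T j)")
      case True
      then show ?thesis using c(2) j(5) by (auto simp: J'_def)
    next
      case False
      then have "c z = h0 (snd z)" using c(3) by blast
      moreover have "z \<notin> (\<Union>j\<in>J. S j \<times> T j)" using False elim(1) by blast
      ultimately show ?thesis using elim by (simp add: hat_class_eq)
    qed
  qed
  then show thesis using that[OF c(1)] F by (simp add: ae_class_eq_iff)
qed

section \<open>Fubini and integrability for step maps\<close>

lemma step_dist_Fubini: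
  assumes c: "step c" and c': "step c'"
  defines "f \<equiv> \<lambda>z. ennreal (d (c z) (c' z) powr p)"
  shows "simple_function I (curry f)" and "\<And>t. t \<in> space I \<Longrightarrow> curry f t \<in> borel_measurable M"
proof -
  \<comment> \<open>The integrand's section depends only on the pair of sections of \<open>c\<close>
    and \<open>c'\<close>, which takes finitely many values.\<close>
  have "curry f = (\<lambda>(u, v) x. ennreal (d (u x) (v x) powr p)) \<circ> (\<lambda>t. (curry c t, curry c' t))"
    by (auto simp: f_def fun_eq_iff)
  then show "simple_function I (curry f)"
    using c c' by (simp only: step_def) (intro simple_function_compose simple_function_Pair, auto)
  fix t assume "t \<in> space I"
  then have [measurable]: "(\<lambda>x. d (c (t, x)) (c' (t, x))) \<in> borel_measurable M"
    by (intro borel_measurable_L0_dist step_sections c c')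
  show "curry f t \<in> borel_measurable M" unfolding f_def curry_def by measurable
qed

lemma step_int_fst:
  assumes c: "step c" and c': "step c'"
  shows "Lp_int (cprod I M) d p (ae_class (cprod I M) c) (ae_class (cprod I M) c')
    = (\<integral>\<^sup>+t. \<integral>\<^sup>+x. ennreal (d (c (t, x)) (c' (t, x)) powr p) \<partial>M \<partial>I)"
  unfolding Lp_int_ae_class by (rule nn_integral_cprod_fst[OF step_dist_Fubini[OF c c']])

lemma step_int_snd:
  assumes c: "step c" and c': "step c'"
  shows "Lp_int (cprod I M) d p (ae_class (cprod I M) c) (ae_class (cprod I M) c')
    = (\<integral>\<^sup>+x. \<integral>\<^sup>+t. ennreal (d (c (t, x)) (c' (t, x)) powr p) \<partial>I \<partial>M)"
  unfolding Lp_int_ae_class by (rule nn_integral_cprod_snd[OF step_dist_Fubini[OF c c']])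

lemma Lp_step_rect_simple_Lp:
  assumes c: "Lp_step c" shows "ae_class (cprod I M) c \<in> rect_simple_Lp I M N d p h"
proof -
  have st: "step c" using c by (simp add: Lp_step_def)
  define g where "g t = (\<integral>\<^sup>+x. ennreal (d (c (t, x)) (h0 x) powr p) \<partial>M)" for t
  have sf: "simple_function I (curry c)" using st by (simp add: step_def)
  have "g = (\<lambda>u. \<integral>\<^sup>+x. ennreal (d (u x) (h0 x) powr p) \<partial>M) \<circ> curry c"
    by (auto simp: g_def fun_eq_iff)
  then have "simple_function I g" using sf by (simp only:) (rule simple_function_compose)
  then have fin: "finite (g ` space I)" by (rule simple_functionD(1))
  define C where "C = Max (insert 0 (g ` space I))"
  have "C \<in> insert 0 (g ` space I)" unfolding C_def by (rule Max_in) (use fin in auto)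
  then have C: "C < \<infinity>" using c by (auto simp: Lp_step_def g_def)
  have "Lp_int (cprod I M) d p (ae_class (cprod I M) c) (hat_class I M h) = (\<integral>\<^sup>+t. g t \<partial>I)"
    unfolding hat_class_eq step_int_fst[OF st step_hat] g_def by simp
  also have "\<dots> \<le> (\<integral>\<^sup>+t. C \<partial>I)"
    by (rule nn_integral_mono) (use fin in \<open>auto simp: C_def\<close>)
  also have "\<dots> < \<infinity>"
    using C emeasure_I_finite[of "space I"] by (simp only: nn_integral_const ennreal_mult_less_top infinity_ennreal_def simp_thms)
  finally show ?thesis
    using step_in_rect_almost_simple_classes[OF st] L0I[OF step_L0_maps[OF st]]
    by (simp add: rect_simple_Lp_def Lp_def)
qed

lemma rect_simple_Lp_step:
  assumes F: "F \<in> rect_simple_Lp I M N d p h"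
  obtains c where "Lp_step c" "F = ae_class (cprod I M) c"
proof -
  obtain c where c: "step c" "F = ae_class (cprod I M) c"
    using F rect_almost_simple_classes_step by (auto simp: rect_simple_Lp_def)
  define G where "G u = (\<integral>\<^sup>+x. ennreal (d (u x) (h0 x) powr p) \<partial>M)" for u
  have sf: "simple_function I (curry c)" using c by (simp add: step_def)
  have "(\<integral>\<^sup>+t. G (curry c t) \<partial>I) < \<infinity>"
  proof -
    have "Lp_int (cprod I M) d p F (hat_class I M h) < \<infinity>" using F by (simp add: rect_simple_Lp_def Lp_def)
    then show ?thesis unfolding c(2) hat_class_eq step_int_fst[OF c(1) step_hat] by (simp add: G_def)
  qed
  moreover have "(\<lambda>t. G (curry c t)) \<in> borel_measurable I"
    using borel_measurable_simple_function[OF simple_function_compose[OF sf, of G]] by (simp add: comp_def)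
  ultimately have AE: "AE t in I. G (curry c t) \<noteq> \<infinity>" by (intro nn_integral_PInf_AE) auto
  \<comment> \<open>The sections of infinite distance to \<open>h0\<close> occur on a null set of
    \<open>t\<close> and are replaced by \<open>h0\<close>. The rule depends on the section only, so
    the curried map stays simple.\<close>
  define c' where "c' = (\<lambda>(t, x). if G (curry c t) < \<infinity> then c (t, x) else h0 x)"
  have cur: "curry c' = (\<lambda>u. if G u < \<infinity> then u else h0) \<circ> curry c"
    by (auto simp: c'_def fun_eq_iff)
  have "simple_function I (curry c')" unfolding cur using sf by (rule simple_function_compose)
  moreover have "curry c' t \<in> asimple" if "t \<in> space I" for t
    unfolding cur using c(1) h0_asimple that by (auto simp: step_def)
  moreover have "(\<integral>\<^sup>+x. ennreal (d (c' (t, x)) (h0 x) powr p) \<partial>M) < \<infinity>" for t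
  proof (cases "G (curry c t) < \<infinity>")
    case True then show ?thesis by (simp add: c'_def G_def)
  next
    case False
    have "(\<integral>\<^sup>+x. ennreal (d (c' (t, x)) (h0 x) powr p) \<partial>M) = (\<integral>\<^sup>+x. 0 \<partial>M)"
      using False L0_maps_funcset[OF h0] by (intro nn_integral_cong) (simp add: c'_def Pi_iff)
    then show ?thesis by simp
  qed
  ultimately have st: "Lp_step c'" by (simp add: Lp_step_def step_def)
  have "AE z in cprod I M. c z = c' z"
    using AE_cprod_fst[OF AE] by eventually_elim (auto simp: c'_def less_top split: prod.splits)
  then show thesis using that[OF st] c(2) by (simp add: ae_class_eq_iff)
qed

end

text \<open>Bundles finitely many simple functions into one simple tuple-valued function;
  \<open>restrict\<close> pins the components off \<open>V\<close>, so that only finitely many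
  tuples occur. It serves to show that a map assembled from finitely many simple curves has finitely
  many sections.\<close>

lemma simple_function_restrict:
  assumes "finite V" "\<And>v. v \<in> V \<Longrightarrow> simple_function I (s v)"
  shows "simple_function I (\<lambda>t. restrict (\<lambda>v. s v t) V)"
  using assms
proof (induction V rule: finite_induct)
  case (insert a V)
  have eq: "(\<lambda>t. restrict (\<lambda>v. s v t) (insert a V)) = (\<lambda>(y, g). g(a := y)) \<circ> (\<lambda>t. (s a t, restrict (\<lambda>v. s v t) V))"
    by (auto simp: fun_eq_iff)
  show ?case
    unfolding eq by (intro simple_function_compose simple_function_Pair insert.IH insert.prems) auto
qed (simp add: restrict_def)

section \<open>The section maps on step maps\<close>

context section_space
begin

abbreviation "Lp_h \<equiv> Lp M N d p h"
abbreviation "E_h \<equiv> almost_simple_classes M N d h \<inter> Lp_h"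
abbreviation "Lp_I \<equiv> Lp_const I N d p"
abbreviation "E_I \<equiv> simple_classes I N d"

section \<open>The inner L^p spaces and simple classes as metric targets\<close>

lemma Lp_space_Lp_h: "Lp_space Lp_h (Lp_dist M d p) p"
  using Metric_space_Lp[OF h_L0] p by (simp add: Lp_space_def Lp_space_axioms_def)

lemma Lp_I_eq: "z \<in> N \<Longrightarrow> Lp_I = Lp I N d p (ae_class I (\<lambda>_. z))"
  by (rule Lp_const_eq[OF finI])

lemma const_L0: "z \<in> N \<Longrightarrow> ae_class I (\<lambda>_. z) \<in> L0 I N d"
  by (rule L0I[OF L0_maps_const])

lemma Lp_space_Lp_I: "Lp_space Lp_I (Lp_dist I d p) p"
proof -
  obtain z where z: "z \<in> N" using N_nonempty by auto
  show ?thesis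
    unfolding Lp_I_eq[OF z] using Metric_space_Lp[OF const_L0[OF z]] p
    by (simp add: Lp_space_def Lp_space_axioms_def)
qed

lemma Lp_I_int_finite:
  assumes "F \<in> Lp_I" "F' \<in> Lp_I" shows "Lp_int I d p F F' < \<infinity>"
proof -
  obtain z where z: "z \<in> N" using N_nonempty by auto
  show ?thesis using Lp_int_finite[OF const_L0[OF z]] assms unfolding Lp_I_eq[OF z] by blast
qed

lemma Lp_space_E_h: "Lp_space E_h (Lp_dist M d p) p"
proof -
  interpret L: Lp_space Lp_h "Lp_dist M d p" p by (rule Lp_space_Lp_h)
  show ?thesis using L.subspace[of E_h] p by (simp add: Lp_space_def Lp_space_axioms_def)
qed

lemma E_I_subset: "E_I \<subseteq> Lp_I"
  by (rule simple_classes_subset_Lp_const[OF finI order_refl N_nonempty])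

lemma Lp_space_E_I: "Lp_space E_I (Lp_dist I d p) p"
proof -
  interpret L: Lp_space Lp_I "Lp_dist I d p" p by (rule Lp_space_Lp_I)
  show ?thesis using L.subspace[OF E_I_subset] p by (simp add: Lp_space_def Lp_space_axioms_def)
qed

lemma asimple_class:
  assumes "u \<in> asimple" shows "ae_class M u \<in> almost_simple_classes M N d h"
proof -
  obtain B where B: "B \<in> sets M" "emeasure M B < \<infinity>" "finite (u ` B)" "\<forall>x. x \<notin> B \<longrightarrow> u x = h0 x"
    using assms by (auto simp: asimple_def)
  have "AE x in M. x \<notin> B \<longrightarrow> u x = class_rep h x"
    using AE_class_rep[of M h0] by eventually_elim (simp add: B(4))
  then show ?thesis using B asimple_L0_maps[OF assms] unfolding almost_simple_classes_def by blast
qed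

lemma almost_simple_classes_asimple:
  assumes "v \<in> almost_simple_classes M N d h" shows "\<exists>u\<in>asimple. v = ae_class M u"
proof -
  obtain f B where f: "f \<in> L0_maps M N d" "B \<in> sets M" "emeasure M B < \<infinity>" "finite (f ` B)"
    "AE x in M. x \<notin> B \<longrightarrow> f x = class_rep h x" "v = ae_class M f"
    using assms unfolding almost_simple_classes_def by blast
  define u where "u x = (if x \<in> B then f x else h0 x)" for x
  have "u \<in> L0_maps M N d" unfolding u_def
    by (intro L0_maps_If f h0) (use f(2) sets.sets_into_space[OF f(2)] in \<open>simp add: Collect_conj_eq Int_absorb1\<close>)
  moreover have "u ` B = f ` B" by (auto simp: u_def)
  moreover have "\<forall>x. x \<notin> B \<longrightarrow> u x = h0 x" by (simp add: u_def)
  ultimately have "u \<in> asimple" using f unfolding asimple_def by auto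
  moreover have "AE x in M. f x = u x"
    using f(5) AE_class_rep[of M h0] by eventually_elim (simp add: u_def)
  ultimately show ?thesis using f(6) by (auto simp: ae_class_eq_iff)
qed

lemma Lp_step_section:
  assumes c: "Lp_step c" and t: "t \<in> space I"
  shows "ae_class M (\<lambda>x. c (t, x)) \<in> E_h"
proof -
  have u: "(\<lambda>x. c (t, x)) \<in> asimple" using c t by (auto simp: Lp_step_def step_def curry_def)
  then have "ae_class M (\<lambda>x. c (t, x)) \<in> Lp_h"
    using c t L0I[OF asimple_L0_maps[OF u]] by (simp add: Lp_def Lp_int_ae_class Lp_step_def)
  then show ?thesis using asimple_class[OF u] by simp
qed

lemma sec_fst_simple_curves:
  assumes c: "Lp_step c"
  shows "sec_fst I M (ae_class (cprod I M) c) \<in> simple_curves I M N d p h"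
proof -
  interpret E: Lp_space E_h "Lp_dist M d p" p by (rule Lp_space_E_h)
  have eq: "(\<lambda>t. ae_class M (\<lambda>x. c (t, x))) = ae_class M \<circ> curry c" by (auto simp: curry_def)
  have sf: "simple_function I (\<lambda>t. ae_class M (\<lambda>x. c (t, x)))"
    unfolding eq using c by (intro simple_function_compose) (simp add: Lp_step_def step_def)
  have "(\<lambda>t. ae_class M (\<lambda>x. c (t, x))) \<in> L0_maps I E_h (Lp_dist M d p)"
    by (rule E.L0_maps_simple_function[OF sf]) (use Lp_step_section[OF c] in blast)
  then show ?thesis
    unfolding sec_fst_ae_class simple_curves_def simple_classes_def
    using E.L0_maps_measurable simple_functionD(1)[OF sf] by blast
qed

text \<open>One representative is chosen per class rather than per \<open>t\<close>: then
  \<open>curry c = u \<circ> f\<close> inherits the finite range of \<open>f\<close>.\<close>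

lemma simple_curves_Lp_step:
  assumes C: "C \<in> simple_curves I M N d p h"
  obtains c where "Lp_step c" "sec_fst I M (ae_class (cprod I M) c) = C"
proof -
  interpret E: Lp_space E_h "Lp_dist M d p" p by (rule Lp_space_E_h)
  obtain f where f: "f \<in> I \<rightarrow>\<^sub>M mborel E_h (Lp_dist M d p)" "finite (f ` space I)" "C = ae_class I f"
    using C unfolding simple_curves_def simple_classes_def by blast
  have sf: "simple_function I f" by (rule E.L0_maps_simple_functionD[OF f(1,2)])
  have fE: "f t \<in> E_h" if "t \<in> space I" for t using measurable_space[OF f(1) that] by (simp add: E.space_mborel)
  have "\<forall>v\<in>E_h. \<exists>u\<in>asimple. v = ae_class M u" using almost_simple_classes_asimple by blast
  then obtain u where u: "\<And>v. v \<in> E_h \<Longrightarrow> u v \<in> asimple" "\<And>v. v \<in> E_h \<Longrightarrow> v = ae_class M (u v)" by metis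
  define c where "c = (\<lambda>(t, x). u (f t) x)"
  have cur: "curry c = u \<circ> f" by (auto simp: c_def fun_eq_iff)
  have "simple_function I (curry c)" unfolding cur using sf by (rule simple_function_compose)
  moreover have "curry c t \<in> asimple" if "t \<in> space I" for t
    unfolding cur using u(1) fE[OF that] by simp
  moreover have "(\<integral>\<^sup>+x. ennreal (d (c (t, x)) (h0 x) powr p) \<partial>M) < \<infinity>" if "t \<in> space I" for t
  proof -
    have "Lp_int M d p (ae_class M (u (f t))) h < \<infinity>"
      using fE[OF that] u(2)[OF fE[OF that]] by (auto simp: Lp_def)
    then show ?thesis by (simp add: Lp_int_ae_class c_def)
  qed
  ultimately have st: "Lp_step c" by (simp add: Lp_step_def step_def)
  have "AE t in I. ae_class M (\<lambda>x. c (t, x)) = f t"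
    by (rule AE_I2) (use u(2) fE in \<open>simp add: c_def\<close>)
  then show thesis using that[OF st] by (simp add: sec_fst_ae_class f(3) ae_class_eq_iff)
qed

lemma sec_fst_image: "sec_fst I M ` rect_simple_Lp I M N d p h = simple_curves I M N d p h"
proof (intro equalityI subsetI)
  fix C assume "C \<in> sec_fst I M ` rect_simple_Lp I M N d p h"
  then show "C \<in> simple_curves I M N d p h" using rect_simple_Lp_step sec_fst_simple_curves by blast
next
  fix C assume "C \<in> simple_curves I M N d p h"
  then show "C \<in> sec_fst I M ` rect_simple_Lp I M N d p h"
    using simple_curves_Lp_step Lp_step_rect_simple_Lp by blast
qed

text \<open>All sections of an \<open>Lp_step\<close> map lie at finite distance from
  \<open>h\<close>, so the outer integrand is the inner integral at every \<open>t\<close>, and the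
  claim is Fubini for step maps.\<close>

lemma sec_fst_int:
  assumes F: "F \<in> rect_simple_Lp I M N d p h" and F': "F' \<in> rect_simple_Lp I M N d p h"
  shows "Lp_int I (Lp_dist M d p) p (sec_fst I M F) (sec_fst I M F') = Lp_int (cprod I M) d p F F'"
proof -
  obtain c where c: "Lp_step c" "F = ae_class (cprod I M) c" using F by (rule rect_simple_Lp_step)
  obtain c' where c': "Lp_step c'" "F' = ae_class (cprod I M) c'" using F' by (rule rect_simple_Lp_step)
  have "Lp_int I (Lp_dist M d p) p (sec_fst I M F) (sec_fst I M F')
      = (\<integral>\<^sup>+t. Lp_int M d p (ae_class M (\<lambda>x. c (t, x))) (ae_class M (\<lambda>x. c' (t, x))) \<partial>I)"
    unfolding c c' sec_fst_ae_class Lp_int_ae_class[of I]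
  proof (rule nn_integral_cong)
    fix t assume t: "t \<in> space I"
    show "ennreal (Lp_dist M d p (ae_class M (\<lambda>x. c (t, x))) (ae_class M (\<lambda>x. c' (t, x))) powr p)
      = Lp_int M d p (ae_class M (\<lambda>x. c (t, x))) (ae_class M (\<lambda>x. c' (t, x)))"
      using Lp_step_section[OF c(1) t] Lp_step_section[OF c'(1) t]
      by (intro Lp_int_eq_dist[symmetric] Lp_int_finite[OF h_L0]) auto
  qed
  also have "\<dots> = Lp_int (cprod I M) d p F F'"
    unfolding Lp_int_ae_class[of M] c(2) c'(2)
    by (rule step_int_fst[symmetric]) (use c c' in \<open>auto simp: Lp_step_def\<close>)
  finally show ?thesis .
qed

section \<open>Sections at fixed points of \<open>M\<close>\<close>

lemma step_section_snd:
  assumes c: "step c" and x: "x \<in> space M"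
  shows "ae_class I (\<lambda>t. c (t, x)) \<in> E_I"
proof -
  have sf: "simple_function I (\<lambda>t. c (t, x))"
    using simple_function_compose[of I "curry c" "\<lambda>u. u x"] c by (simp add: step_def comp_def)
  have "(\<lambda>t. c (t, x)) \<in> L0_maps I N d"
    by (rule L0_maps_simple_function[OF sf]) (use L0_maps_funcset[OF step_sections[OF c]] x in auto)
  then show ?thesis
    unfolding simple_classes_def using L0_maps_measurable simple_functionD(1)[OF sf] by blast
qed

text \<open>No integrability is assumed: sections at fixed \<open>x\<close> are simple curves over a
  finite measure and thus at finite distance from each other. This allows the identity to be used
  for step maps whose membership in L^p is still to be proved.\<close>

lemma sec_snd_int:
  assumes c: "step c" and c': "step c'"
  shows "Lp_int M (Lp_dist I d p) p (sec_snd I M (ae_class (cprod I M) c)) (sec_snd I M (ae_class (cprod I M) c'))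
    = Lp_int (cprod I M) d p (ae_class (cprod I M) c) (ae_class (cprod I M) c')"
proof -
  have "Lp_int M (Lp_dist I d p) p (sec_snd I M (ae_class (cprod I M) c)) (sec_snd I M (ae_class (cprod I M) c'))
      = (\<integral>\<^sup>+x. Lp_int I d p (ae_class I (\<lambda>t. c (t, x))) (ae_class I (\<lambda>t. c' (t, x))) \<partial>M)"
    unfolding sec_snd_ae_class Lp_int_ae_class[of M]
  proof (rule nn_integral_cong)
    fix x assume x: "x \<in> space M"
    show "ennreal (Lp_dist I d p (ae_class I (\<lambda>t. c (t, x))) (ae_class I (\<lambda>t. c' (t, x))) powr p)
      = Lp_int I d p (ae_class I (\<lambda>t. c (t, x))) (ae_class I (\<lambda>t. c' (t, x)))"
      using step_section_snd[OF c x] step_section_snd[OF c' x] E_I_subset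
      by (intro Lp_int_eq_dist[symmetric] Lp_I_int_finite) auto
  qed
  also have "\<dots> = Lp_int (cprod I M) d p (ae_class (cprod I M) c) (ae_class (cprod I M) c')"
    unfolding Lp_int_ae_class[of I] by (rule step_int_snd[OF c c', symmetric])
  finally show ?thesis .
qed

text \<open>The base field is itself a section of a step map, so integrability relative to the base
  is transported by \<open>sec_snd_int\<close> as well.\<close>

lemma under_class_sec_snd: "under_class I M h = sec_snd I M (hat_class I M h)"
  unfolding under_class_eq hat_class_eq sec_snd_ae_class by simp

text \<open>The countable set that approximates the sections consists of the step curves taking values in
  a countable set and constant where \<open>c (t, _)\<close> is.\<close>

lemma step_sections_L0:
  assumes c: "step c"
  shows "(\<lambda>x. ae_class I (\<lambda>t. c (t, x))) \<in> L0_maps M Lp_I (Lp_dist I d p)"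
proof -
  interpret F: Lp_space Lp_I "Lp_dist I d p" p by (rule Lp_space_Lp_I)
  have sf: "simple_function I (curry c)" using c by (simp add: step_def)
  define \<Phi> where "\<Phi> = curry c ` space I"
  have fin\<Phi>: "finite \<Phi>" using simple_functionD(1)[OF sf] by (simp add: \<Phi>_def)
  have \<Phi>L: "\<phi> \<in> L0_maps M N d" if "\<phi> \<in> \<Phi>" for \<phi>
    using c that by (auto simp: step_def \<Phi>_def intro: asimple_L0_maps)
  have "\<forall>\<phi>\<in>\<Phi>. \<exists>D. countable D \<and> D \<subseteq> N \<and> (\<forall>x\<in>space M. \<forall>e>0. \<exists>z\<in>D. d (\<phi> x) z < e)"
  proof
    fix \<phi> assume \<phi>: "\<phi> \<in> \<Phi>"
    obtain D where "countable D" "D \<subseteq> \<phi> ` space M" "D \<subseteq> N"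
      "\<And>x e. x \<in> space M \<Longrightarrow> 0 < e \<Longrightarrow> \<exists>z\<in>D. d (\<phi> x) z < e"
      by (rule L0_maps_dense[OF \<Phi>L[OF \<phi>]]) blast
    then show "\<exists>D. countable D \<and> D \<subseteq> N \<and> (\<forall>x\<in>space M. \<forall>e>0. \<exists>z\<in>D. d (\<phi> x) z < e)"
      by (intro exI[of _ D]) simp
  qed
  then obtain D where D: "\<And>\<phi>. \<phi> \<in> \<Phi> \<Longrightarrow> countable (D \<phi>)" "\<And>\<phi>. \<phi> \<in> \<Phi> \<Longrightarrow> D \<phi> \<subseteq> N"
    "\<And>\<phi> x e. \<phi> \<in> \<Phi> \<Longrightarrow> x \<in> space M \<Longrightarrow> 0 < e \<Longrightarrow> \<exists>z\<in>D \<phi>. d (\<phi> x) z < e"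
    by metis
  \<comment> \<open>A choice of one value from \<open>D \<phi>\<close> for each of the finitely many
    sections \<open>\<phi>\<close>; there are countably many such choices.\<close>
  define W where "W = PiE \<Phi> D"
  have WN: "w (curry c t) \<in> N" if "w \<in> W" "t \<in> space I" for w t
    using that D(2) by (auto simp: W_def \<Phi>_def)
  have wsf: "simple_function I (\<lambda>t. w (curry c t))" for w :: "('m \<Rightarrow> 'n) \<Rightarrow> 'n"
    using simple_function_compose[OF sf, of w] by (simp add: comp_def)
  show ?thesis
  proof (rule F.L0_mapsI)
    show "(\<lambda>x. ae_class I (\<lambda>t. c (t, x))) \<in> space M \<rightarrow> Lp_I"
      using step_section_snd[OF c] E_I_subset by blast
    show "countable ((\<lambda>w. ae_class I (\<lambda>t. w (curry c t))) ` W)"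
      unfolding W_def by (intro countable_image countable_PiE fin\<Phi> D(1))
    show "(\<lambda>w. ae_class I (\<lambda>t. w (curry c t))) ` W \<subseteq> Lp_I"
      using WN by (auto intro!: simple_function_in_Lp_const[OF finI wsf _ N_nonempty])
  next
    fix x e assume x: "x \<in> space M" and e: "0 < (e::real)"
    define m where "m = enn2real (emeasure I (space I))"
    have m: "emeasure I (space I) = ennreal m" "0 \<le> m"
      using emeasure_I_finite[of "space I"] by (auto simp: m_def)
    \<comment> \<open>Chosen so that \<open>\<delta> powr p\<close> times the total measure
      \<open>m\<close> is at most \<open>(e / 2) powr p\<close>; \<open>1 + m\<close> avoids a
      division by zero.\<close>
    define \<delta> where "\<delta> = e / 2 / (1 + m) powr (1 / p)"
    have \<delta>: "0 < \<delta>" using e m by (simp add: \<delta>_def)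
    have "\<forall>\<phi>\<in>\<Phi>. \<exists>z\<in>D \<phi>. d (\<phi> x) z < \<delta>" using D(3) x \<delta> by blast
    then obtain w0 where w0: "\<And>\<phi>. \<phi> \<in> \<Phi> \<Longrightarrow> w0 \<phi> \<in> D \<phi>" "\<And>\<phi>. \<phi> \<in> \<Phi> \<Longrightarrow> d (\<phi> x) (w0 \<phi>) < \<delta>" by metis
    define w where "w = restrict w0 \<Phi>"
    have w: "w \<in> W" using w0(1) by (auto simp: w_def W_def)
    have "Lp_int I d p (ae_class I (\<lambda>t. c (t, x))) (ae_class I (\<lambda>t. w (curry c t))) \<le> (\<integral>\<^sup>+t. ennreal (\<delta> powr p) \<partial>I)"
      unfolding Lp_int_ae_class
    proof (intro nn_integral_mono ennreal_leI powr_mono2)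
      fix t assume "t \<in> space I"
      then have "curry c t \<in> \<Phi>" by (simp add: \<Phi>_def)
      then show "d (c (t, x)) (w (curry c t)) \<le> \<delta>" using w0(2)[of "curry c t"] by (simp add: w_def)
    qed (use p in auto)
    also have "\<dots> = ennreal (\<delta> powr p * m)" using m by (simp add: ennreal_mult)
    also have "\<dots> \<le> ennreal ((e / 2) powr p)"
    proof (rule ennreal_leI)
      have "\<delta> powr p = (e / 2) powr p / (1 + m)"
        using e m p by (simp add: \<delta>_def powr_divide powr_mult powr_powr)
      moreover have "(e / 2) powr p * m \<le> (e / 2) powr p * (1 + m)" by (intro mult_left_mono) auto
      ultimately show "\<delta> powr p * m \<le> (e / 2) powr p" using m by (simp add: divide_le_eq)
    qed
    finally have "Lp_dist I d p (ae_class I (\<lambda>t. c (t, x))) (ae_class I (\<lambda>t. w (curry c t))) \<le> e / 2"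
      using e by (intro Lp_dist_le) auto
    then show "\<exists>z\<in>(\<lambda>w. ae_class I (\<lambda>t. w (curry c t))) ` W. Lp_dist I d p (ae_class I (\<lambda>t. c (t, x))) z < e"
      using w e by (intro bexI[of _ "ae_class I (\<lambda>t. w (curry c t))"]) auto
  next
    fix z assume "z \<in> (\<lambda>w. ae_class I (\<lambda>t. w (curry c t))) ` W"
    then obtain w where w: "w \<in> W" "z = ae_class I (\<lambda>t. w (curry c t))" by auto
    define f where "f = (\<lambda>(t, x). ennreal (d (c (t, x)) (w (curry c t)) powr p))"
    have cur: "curry f = (\<lambda>u x. ennreal (d (u x) (w u) powr p)) \<circ> curry c" by (auto simp: f_def fun_eq_iff)
    have "(\<lambda>x. \<integral>\<^sup>+t. f (t, x) \<partial>I) \<in> borel_measurable M"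
    proof (rule borel_measurable_cprod_snd)
      show "simple_function I (curry f)" unfolding cur using sf by (rule simple_function_compose)
      fix t assume t: "t \<in> space I"
      have [measurable]: "(\<lambda>x. d (c (t, x)) (w (curry c t))) \<in> borel_measurable M"
        by (rule L0_maps_dist[OF step_sections[OF c t] WN[OF w(1) t]])
      have "curry f t = (\<lambda>x. ennreal (d (c (t, x)) (w (curry c t)) powr p))" by (simp add: f_def fun_eq_iff)
      then show "curry f t \<in> borel_measurable M" by (simp only:) measurable
    qed
    then have "(\<lambda>x. enn2real (\<integral>\<^sup>+t. f (t, x) \<partial>I) powr (1 / p)) \<in> borel_measurable M" by measurable
    then show "(\<lambda>x. Lp_dist I d p (ae_class I (\<lambda>t. c (t, x))) z) \<in> borel_measurable M"
      by (simp add: Lp_dist_def w(2) Lp_int_ae_class f_def)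
  qed
qed

lemma under_L0: "under_class I M h \<in> L0 M Lp_I (Lp_dist I d p)"
  unfolding under_class_eq using step_sections_L0[OF step_hat] by (simp add: L0_def)

lemma sec_snd_Lp_fields:
  assumes F: "F \<in> rect_simple_Lp I M N d p h" shows "sec_snd I M F \<in> Lp_fields I M N d p h"
proof -
  obtain c where c: "Lp_step c" "F = ae_class (cprod I M) c" using F by (rule rect_simple_Lp_step)
  then have st: "step c" by (simp add: Lp_step_def)
  have "Lp_int M (Lp_dist I d p) p (sec_snd I M F) (under_class I M h) = Lp_int (cprod I M) d p F (hat_class I M h)"
    unfolding under_class_sec_snd hat_class_eq c(2) by (rule sec_snd_int[OF st step_hat])
  also have "\<dots> < \<infinity>" using F by (simp add: rect_simple_Lp_def Lp_def)
  finally show ?thesis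
    using step_sections_L0[OF st] by (simp add: Lp_fields_def Lp_def c(2) sec_snd_ae_class L0_def)
qed

text \<open>On \<open>B\<close> the field takes finitely many values, each represented by a simple
  curve. Together these curves take finitely many tuples of values as \<open>t\<close> varies, so
  reading them as a map on the product gives finitely many sections in the other direction.\<close>

lemma simple_fields_subset: "simple_fields I M N d p h \<subseteq> sec_snd I M ` rect_simple_Lp I M N d p h"
proof
  interpret E: Lp_space E_I "Lp_dist I d p" p by (rule Lp_space_E_I)
  fix F assume F: "F \<in> simple_fields I M N d p h"
  then obtain f B where f: "f \<in> L0_maps M E_I (Lp_dist I d p)" and B: "B \<in> sets M" "emeasure M B < \<infinity>" "finite (f ` B)"
    and AE: "AE x in M. x \<notin> B \<longrightarrow> f x = class_rep (under_class I M h) x" and Ff: "F = ae_class M f"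
    unfolding simple_fields_def almost_simple_classes_def by blast
  have Bsub: "B \<subseteq> space M" by (rule sets.sets_into_space[OF B(1)])
  obtain z where z: "z \<in> N" using N_nonempty by auto
  have "(\<lambda>_. z) \<in> L0_maps I N d" by (rule L0_maps_const[OF z])
  then have v0: "ae_class I (\<lambda>_. z) \<in> E_I" (is "?v0 \<in> _")
    unfolding simple_classes_def using L0_maps_measurable by (intro imageI) (auto simp: image_constant_conv)
  \<comment> \<open>Off \<open>B\<close> the field may take infinitely many values
    \<open>under_class\<close>; a fixed value there makes \<open>f2\<close> simple on all of
    \<open>M\<close>, and only its values on \<open>B\<close> enter \<open>c\<close>.\<close>
  define f2 where "f2 x = (if x \<in> B then f x else ?v0)" for x
  have "f2 \<in> L0_maps M E_I (Lp_dist I d p)" unfolding f2_def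
    by (intro E.L0_maps_If f E.L0_maps_const v0) (use B Bsub in \<open>simp add: Collect_conj_eq Int_absorb1\<close>)
  moreover have "finite (f2 ` space M)"
    by (rule finite_subset[of _ "insert ?v0 (f ` B)"]) (use B(3) in \<open>auto simp: f2_def\<close>)
  ultimately have f2: "simple_function M f2" and f2E: "f2 \<in> space M \<rightarrow> E_I"
    using E.L0_maps_simple_functionD E.L0_maps_measurable E.L0_maps_funcset by blast+
  have "\<forall>v\<in>E_I. \<exists>s. simple_function I s \<and> s \<in> space I \<rightarrow> N \<and> v = ae_class I s"
  proof
    fix v assume "v \<in> E_I"
    then obtain s where s: "s \<in> I \<rightarrow>\<^sub>M mborel N d" "finite (s ` space I)" "v = ae_class I s"
      unfolding simple_classes_def by blast
    then show "\<exists>s. simple_function I s \<and> s \<in> space I \<rightarrow> N \<and> v = ae_class I s"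
      using L0_maps_simple_functionD[OF s(1,2)] measurable_space[OF s(1)] by (auto simp: space_mborel)
  qed
  then obtain s where s: "\<And>v. v \<in> E_I \<Longrightarrow> simple_function I (s v)" "\<And>v. v \<in> E_I \<Longrightarrow> s v \<in> space I \<rightarrow> N"
    "\<And>v. v \<in> E_I \<Longrightarrow> v = ae_class I (s v)" by metis
  define V where "V = f2 ` space M"
  have V: "finite V" "V \<subseteq> E_I" using simple_functionD(1)[OF f2] f2E by (auto simp: V_def)
  define c where "c = (\<lambda>(t, x). if x \<in> B then s (f2 x) t else h0 x)"
  \<comment> \<open>The section at \<open>t\<close> depends on \<open>t\<close> only through the
    tuple of the values \<open>s v t\<close> with \<open>v\<close> in the finite set
    \<open>V\<close>.\<close>
  have cur: "curry c = (\<lambda>g x. if x \<in> B then g (f2 x) else h0 x) \<circ> (\<lambda>t. restrict (\<lambda>v. s v t) V)"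
    using Bsub by (auto simp: c_def fun_eq_iff V_def)
  have "simple_function I (curry c)"
    unfolding cur by (intro simple_function_compose simple_function_restrict V s(1)) (use V in auto)
  moreover have "curry c t \<in> asimple" if t: "t \<in> space I" for t
  proof -
    have sf: "simple_function M (\<lambda>x. s (f2 x) t)"
      using simple_function_compose[OF f2, of "\<lambda>v. s v t"] by (simp add: comp_def)
    have "(\<lambda>x. s (f2 x) t) \<in> L0_maps M N d"
      by (rule L0_maps_simple_function[OF sf]) (use s(2) t f2E in \<open>auto simp: Pi_iff\<close>)
    then have "curry c t \<in> L0_maps M N d"
      unfolding c_def curry_def prod.case
      by (intro L0_maps_If h0) (use B Bsub in \<open>simp_all add: Collect_conj_eq Int_absorb1\<close>)
    moreover have "finite (curry c t ` B)"
      by (rule finite_subset[of _ "(\<lambda>v. s v t) ` V"]) (use V Bsub in \<open>auto simp: c_def V_def\<close>)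
    moreover have "\<forall>x. x \<notin> B \<longrightarrow> curry c t x = h0 x" by (simp add: c_def)
    ultimately show ?thesis unfolding asimple_def using B by blast
  qed
  ultimately have st: "step c" by (simp add: step_def)
  have "AE x in M. ae_class I (\<lambda>t. c (t, x)) = f x"
    using AE AE_class_rep[of M "\<lambda>x. ae_class I (\<lambda>_. h0 x)"] AE_space
  proof eventually_elim
    case (elim x)
    show ?case
    proof (cases "x \<in> B")
      case True
      then show ?thesis using s(3)[of "f x"] E.L0_maps_funcset[OF f] elim(3) by (auto simp: c_def f2_def)
    next
      case False
      then show ?thesis using elim by (simp add: c_def under_class_eq)
    qed
  qed
  then have sec: "sec_snd I M (ae_class (cprod I M) c) = F"
    by (simp add: sec_snd_ae_class Ff ae_class_eq_iff)
  \<comment> \<open>Integrability of \<open>c\<close> on the product is read back from that of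
    \<open>F\<close>.\<close>
  have "Lp_int (cprod I M) d p (ae_class (cprod I M) c) (hat_class I M h)
      = Lp_int M (Lp_dist I d p) p F (under_class I M h)"
    unfolding under_class_sec_snd hat_class_eq sec[symmetric] by (rule sec_snd_int[OF st step_hat, symmetric])
  also have "\<dots> < \<infinity>" using F by (simp add: simple_fields_def Lp_fields_def Lp_def)
  finally have "ae_class (cprod I M) c \<in> rect_simple_Lp I M N d p h"
    using step_in_rect_almost_simple_classes[OF st] L0I[OF step_L0_maps[OF st]]
    by (simp add: rect_simple_Lp_def Lp_def)
  then show "F \<in> sec_snd I M ` rect_simple_Lp I M N d p h" using sec by blast
qed

end

section \<open>Density of rectangular almost simple classes\<close>

context section_space
begin

text \<open>Induction on the set of values: each level set is approximated by finitely many
  rectangles, on which the previous step map is overwritten. The last conjunct restricts the values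
  even on the exceptional set \<open>E\<close>, which keeps the error there bounded.\<close>

lemma step_approx_truncated:
  assumes u: "u \<in> L0_maps (cprod I M) N d" and B: "B \<in> sets (cprod I M)" "emeasure (cprod I M) B < \<infinity>"
    and X: "X \<in> sets M" and V: "finite V" "V \<subseteq> N" and e: "0 < (e::real)"
  shows "\<exists>c E. step c \<and> E \<in> sets (cprod I M) \<and> emeasure (cprod I M) E < ennreal e
    \<and> (\<forall>z\<in>space (cprod I M) - E. c z = (if z \<in> B \<and> snd z \<in> X \<and> u z \<in> V then u z else h0 (snd z)))
    \<and> (\<forall>z. c z = h0 (snd z) \<or> c z \<in> V \<and> snd z \<in> X)"
  using V e
proof (induction V arbitrary: e rule: finite_induct)
  case empty
  then show ?case using step_hat by (intro exI[of _ "\<lambda>z. h0 (snd z)"] exI[of _ "{}"]) auto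
next
  case (insert y V)
  let ?\<mu> = "emeasure (cprod I M)"
  have y: "y \<in> N" using insert.prems by simp
  obtain c E where c: "step c" and E: "E \<in> sets (cprod I M)" "?\<mu> E < ennreal (e / 2)"
    and c_off: "\<And>z. z \<in> space (cprod I M) - E \<Longrightarrow> c z = (if z \<in> B \<and> snd z \<in> X \<and> u z \<in> V then u z else h0 (snd z))"
    and c_val: "\<And>z. c z = h0 (snd z) \<or> c z \<in> V \<and> snd z \<in> X"
    using insert.IH[of "e / 2"] insert.prems by auto
  define A where "A = {z \<in> B. snd z \<in> X \<and> u z = y}"
  have Bs: "B \<subseteq> space (cprod I M)" by (rule sets.sets_into_space[OF B(1)])
  have "A = B \<inter> (snd -` X \<inter> space (cprod I M)) \<inter> (u -` {y} \<inter> space (cprod I M))"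
    using Bs by (auto simp: A_def)
  then have A: "A \<in> sets (cprod I M)"
    using B(1) measurable_sets[OF measurable_snd_cprod X]
      measurable_sets[OF L0_maps_measurable[OF u] singleton_in_mborel[OF y]] by auto
  have "?\<mu> A \<le> ?\<mu> B" by (rule emeasure_mono) (use B in \<open>auto simp: A_def\<close>)
  then have Afin: "?\<mu> A < \<infinity>" using B(2) by (rule le_less_trans)
  have e2: "0 < e / 2" using insert.prems by simp
  obtain n :: nat and S T where S: "\<And>i. S i \<in> sets I" and T: "\<And>i. T i \<in> sets M" "\<And>i. emeasure M (T i) < \<infinity>"
    and R: "?\<mu> ((A - (\<Union>i<n. S i \<times> T i)) \<union> ((\<Union>i<n. S i \<times> T i) - A)) < ennreal (e / 2)"
    by (rule cprod_approx_rectangles[OF A Afin e2]) blast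
  let ?D = "(A - (\<Union>i<n. S i \<times> T i)) \<union> ((\<Union>i<n. S i \<times> T i) - A)"
  have D: "?D \<in> sets (cprod I M)"
    using A S T by (intro sets.Un sets.Diff sets.finite_UN rect_in_sets_cprod) auto
  have TX: "T i \<inter> X \<in> sets M" "emeasure M (T i \<inter> X) < \<infinity>" for i
  proof -
    have "emeasure M (T i \<inter> X) \<le> emeasure M (T i)" by (rule emeasure_mono) (use T in auto)
    then show "emeasure M (T i \<inter> X) < \<infinity>" using T(2) by (rule le_less_trans)
  qed (use T X in auto)
  \<comment> \<open>Cutting the rectangles down to \<open>X\<close> ensures that nothing is changed
    over points where the base map may be far away.\<close>
  define c' where "c' z = (if z \<in> (\<Union>i<n. S i \<times> (T i \<inter> X)) then y else c z)" for z
  have st: "step c'" unfolding c'_def by (rule step_upd_UN[OF c S TX y])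
  have "?\<mu> (E \<union> ?D) \<le> ?\<mu> E + ?\<mu> ?D" by (rule emeasure_subadditive[OF E(1) D])
  also have "\<dots> < ennreal (e / 2) + ennreal (e / 2)" by (intro add_strict_mono E R)
  also have "\<dots> = ennreal e" using insert.prems by (simp flip: ennreal_plus)
  finally have small: "?\<mu> (E \<union> ?D) < ennreal e" .
  have off: "c' z = (if z \<in> B \<and> snd z \<in> X \<and> u z \<in> insert y V then u z else h0 (snd z))"
    if z: "z \<in> space (cprod I M) - (E \<union> ?D)" for z
  proof -
    \<comment> \<open>Off the symmetric difference, membership in the rectangles is membership in
      the level set, so overwriting never destroys a correct value.\<close>
    have "z \<in> A \<longleftrightarrow> z \<in> (\<Union>i<n. S i \<times> T i)" using z by blast
    then have iff: "z \<in> (\<Union>i<n. S i \<times> (T i \<inter> X)) \<longleftrightarrow> z \<in> A" by (auto simp: A_def)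
    show ?thesis
    proof (cases "z \<in> A")
      case True
      then show ?thesis unfolding c'_def iff by (auto simp: A_def)
    next
      case False
      have "z \<in> space (cprod I M) - E" using z by blast
      from c_off[OF this] show ?thesis using False unfolding c'_def iff by (auto simp: A_def)
    qed
  qed
  have val: "c' z = h0 (snd z) \<or> c' z \<in> insert y V \<and> snd z \<in> X" for z
    using c_val[of z] by (auto simp: c'_def)
  show ?case
    using st E(1) D small off val by (intro exI[of _ c'] exI[of _ "E \<union> ?D"]) blast
qed

text \<open>Three errors, each at most \<open>e / 4\<close>: from \<open>f\<close> to an almost
  simple map \<open>u\<close>, from \<open>u\<close> to its truncation \<open>v\<close>, and from
  \<open>v\<close> to a step map \<open>c\<close>. The truncation is needed because on the
  exceptional set one of \<open>v\<close> and \<open>c\<close> may be \<open>h0\<close> and the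
  other not, and \<open>h0\<close> may be unbounded.\<close>

lemma rect_simple_Lp_dense:
  assumes F: "F \<in> Lp (cprod I M) N d p (hat_class I M h)" and e: "0 < (e::real)"
  shows "\<exists>F'\<in>rect_simple_Lp I M N d p h. Lp_dist (cprod I M) d p F F' < e"
proof -
  let ?P = "cprod I M"
  let ?hat = "\<lambda>z. h0 (snd z)"
  have ae_hat: "ae_class ?P ?hat \<in> L0 ?P N d" by (rule L0I[OF hat_L0_maps])
  obtain f where f: "f \<in> L0_maps ?P N d" "F = ae_class ?P f" using F by (auto simp: Lp_def elim: L0E)
  have FL: "F \<in> L0 ?P N d" using F by (simp add: Lp_def)
  have Fhat: "Lp_int ?P d p F (ae_class ?P ?hat) < \<infinity>" using F by (simp add: Lp_def hat_class_eq)
  then have fin: "(\<integral>\<^sup>+z. ennreal (d (f z) (h0 (snd z)) powr p) \<partial>?P) < \<infinity>" by (simp add: f Lp_int_ae_class)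
  have pos: "0 < (e / 4) powr p" using e by simp
  have dn: "\<exists>w\<in>N. d z w < r" if "z \<in> N" "0 < r" for z r using that by (intro bexI[of _ z]) auto
  obtain u B where u: "u \<in> L0_maps ?P N d" "B \<in> sets ?P" "emeasure ?P B < \<infinity>" "finite (u ` B)"
    "\<forall>z. z \<notin> B \<longrightarrow> u z = h0 (snd z)" "(\<integral>\<^sup>+z. ennreal (d (f z) (u z) powr p) \<partial>?P) < ennreal ((e / 4) powr p)"
    by (rule almost_simple_approx[OF f(1) hat_L0_maps order_refl dn fin pos]) blast
  have uL: "ae_class ?P u \<in> L0 ?P N d" by (rule L0I[OF u(1)])
  have Fu: "Lp_int ?P d p F (ae_class ?P u) \<le> ennreal ((e / 4) powr p)"
    using u(6) by (simp add: f Lp_int_ae_class less_imp_le)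
  then have "Lp_int ?P d p (ae_class ?P u) F < \<infinity>" by (subst Lp_int_commute) (auto intro: le_less_trans)
  from Lp_int_finite_trans[OF uL FL ae_hat this Fhat]
  have ufin: "(\<integral>\<^sup>+z. ennreal (d (u z) (h0 (snd z)) powr p) \<partial>?P) < \<infinity>" by (simp add: Lp_int_ae_class)
  obtain z0 where z0: "z0 \<in> N" using N_nonempty by auto
  define X where "X n = {x \<in> space M. d (h0 x) z0 \<le> real n}" for n
  have [measurable]: "(\<lambda>x. d (h0 x) z0) \<in> borel_measurable M" by (rule L0_maps_dist[OF h0 z0])
  have X [measurable]: "X n \<in> sets M" for n unfolding X_def by measurable
  define Y where "Y n = {z \<in> space ?P. snd z \<notin> X n}" for n
  have Y [measurable]: "Y n \<in> sets ?P" for n unfolding Y_def by measurable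
  note [measurable] = borel_measurable_L0_dist[OF u(1) hat_L0_maps]
  have "(\<lambda>n. \<integral>\<^sup>+z. ennreal (d (u z) (h0 (snd z)) powr p) * indicator (Y n) z \<partial>?P) \<longlonglongrightarrow> 0"
  proof (rule nn_integral_vanishing_indicators)
    fix z assume z: "z \<in> space ?P"
    obtain k :: nat where "d (h0 (snd z)) z0 \<le> k" using real_arch_simple by blast
    then show "eventually (\<lambda>n. z \<notin> Y n) sequentially"
      using z by (auto simp: Y_def X_def eventually_sequentially space_cprod intro!: exI[of _ k])
  qed (use ufin in auto)
  then have "eventually (\<lambda>n. (\<integral>\<^sup>+z. ennreal (d (u z) (h0 (snd z)) powr p) * indicator (Y n) z \<partial>?P)
      < ennreal ((e / 4) powr p)) sequentially"
    by (rule order_tendstoD(2)) (use pos in simp)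
  then obtain n where n: "(\<integral>\<^sup>+z. ennreal (d (u z) (h0 (snd z)) powr p) * indicator (Y n) z \<partial>?P) < ennreal ((e / 4) powr p)"
    by (auto simp: eventually_sequentially)
  \<comment> \<open>Where \<open>h0\<close> is farther than \<open>n\<close> from \<open>z0\<close>
    the map is reset to the base map; the cost is the tail integral over \<open>Y n\<close>.\<close>
  define v where "v z = (if snd z \<in> X n then u z else h0 (snd z))" for z
  have v: "v \<in> L0_maps ?P N d" unfolding v_def by (intro L0_maps_If u hat_L0_maps) measurable
  have vL: "ae_class ?P v \<in> L0 ?P N d" by (rule L0I[OF v])
  have hN: "h0 (snd z) \<in> N" and uN: "u z \<in> N" if "z \<in> space ?P" for z
    using L0_maps_funcset[OF hat_L0_maps] L0_maps_funcset[OF u(1)] that by auto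
  have "Lp_int ?P d p (ae_class ?P u) (ae_class ?P v)
      = (\<integral>\<^sup>+z. ennreal (d (u z) (h0 (snd z)) powr p) * indicator (Y n) z \<partial>?P)"
    unfolding Lp_int_ae_class
    by (rule nn_integral_cong) (use uN in \<open>auto simp: v_def Y_def split: split_indicator\<close>)
  then have uv: "Lp_int ?P d p (ae_class ?P u) (ae_class ?P v) \<le> ennreal ((e / 4) powr p)" using n by simp
  define V where "V = u ` B"
  have V: "finite V" "V \<subseteq> N" using u(2,4) uN sets.sets_into_space[OF u(2)] by (auto simp: V_def)
  \<comment> \<open>Over \<open>X n\<close> both \<open>v\<close> and \<open>c\<close> take values
    in \<open>V\<close> or equal to \<open>h0\<close>, hence within \<open>C\<close> of
    \<open>z0\<close> and within \<open>2 * C\<close> of each other.\<close>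
  define C where "C = Max (insert (real n) ((\<lambda>w. d w z0) ` V))"
  have C: "real n \<le> C" "\<And>w. w \<in> V \<Longrightarrow> d w z0 \<le> C" using V(1) by (auto simp: C_def)
  \<comment> \<open>The measure allowed for the exceptional set, so that
    \<open>(2 * C) powr p * r\<close> is at most \<open>(e / 4) powr p\<close>; the summand 1 keeps
    the denominator positive.\<close>
  define r where "r = (e / 4) powr p / (1 + (2 * C) powr p)"
  have r: "0 < r" "(2 * C) powr p * r \<le> (e / 4) powr p"
  proof -
    have D: "0 < 1 + (2 * C) powr p" by (simp add: add_pos_nonneg)
    then show "0 < r" using pos by (simp add: r_def)
    have "(2 * C) powr p * (e / 4) powr p \<le> (1 + (2 * C) powr p) * (e / 4) powr p"
      by (intro mult_right_mono) auto
    then show "(2 * C) powr p * r \<le> (e / 4) powr p" using D by (simp add: r_def divide_le_eq mult.commute)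
  qed
  obtain c E where c: "step c" and E: "E \<in> sets ?P" "emeasure ?P E < ennreal r"
    and c_off: "\<And>z. z \<in> space ?P - E \<Longrightarrow> c z = (if z \<in> B \<and> snd z \<in> X n \<and> u z \<in> V then u z else h0 (snd z))"
    and c_val: "\<And>z. c z = h0 (snd z) \<or> c z \<in> V \<and> snd z \<in> X n"
    using step_approx_truncated[OF u(1-3) X V r(1)] by blast
  have cL: "ae_class ?P c \<in> L0 ?P N d" by (rule L0I[OF step_L0_maps[OF c]])
  have "Lp_int ?P d p (ae_class ?P v) (ae_class ?P c) \<le> (\<integral>\<^sup>+z. ennreal ((2 * C) powr p) * indicator E z \<partial>?P)"
    unfolding Lp_int_ae_class
  proof (rule nn_integral_mono)
    fix z assume z: "z \<in> space ?P"
    have vN: "v z \<in> N" using L0_maps_funcset[OF v] z by auto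
    have cN: "c z \<in> N" using L0_maps_funcset[OF step_L0_maps[OF c]] z by auto
    show "ennreal (d (v z) (c z) powr p) \<le> ennreal ((2 * C) powr p) * indicator E z"
    proof (cases "z \<in> E")
      case False
      moreover have "z \<notin> B \<Longrightarrow> u z = h0 (snd z)" using u(5) by blast
      ultimately have "c z = v z" using c_off[of z] z by (auto simp: v_def V_def)
      then show ?thesis using vN by simp
    next
      case True
      show ?thesis
      proof (cases "snd z \<in> X n")
        case False
        then have "c z = v z" using c_val[of z] by (auto simp: v_def)
        then show ?thesis using vN by simp
      next
        case inX: True
        then have hC: "d (h0 (snd z)) z0 \<le> C" using C(1) by (simp add: X_def)
        have "u z \<in> V \<or> u z = h0 (snd z)" unfolding V_def using u(5) by blast
        then have vC: "d (v z) z0 \<le> C" using inX C(2) hC by (auto simp: v_def)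
        have cC: "d (c z) z0 \<le> C" using c_val[of z] C(2) hC by auto
        have "d (v z) (c z) \<le> d (v z) z0 + d (c z) z0" using vN cN z0 by (intro triangle')
        also have "\<dots> \<le> 2 * C" using vC cC by simp
        finally have "d (v z) (c z) powr p \<le> (2 * C) powr p" using p by (intro powr_mono2) auto
        then show ?thesis using True by (simp add: ennreal_leI)
      qed
    qed
  qed
  also have "\<dots> = ennreal ((2 * C) powr p) * emeasure ?P E" by (rule nn_integral_cmult_indicator[OF E(1)])
  also have "\<dots> \<le> ennreal ((2 * C) powr p) * ennreal r" by (intro mult_left_mono less_imp_le[OF E(2)]) auto
  also have "\<dots> = ennreal ((2 * C) powr p * r)" using r(1) by (simp add: ennreal_mult)
  also have "\<dots> \<le> ennreal ((e / 4) powr p)" by (rule ennreal_leI[OF r(2)])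
  finally have vc: "Lp_int ?P d p (ae_class ?P v) (ae_class ?P c) \<le> ennreal ((e / 4) powr p)" .
  have e4: "0 < e / 4" "0 < e / 4 + e / 4" using e by auto
  have "Lp_int ?P d p F (ae_class ?P v) \<le> ennreal ((e / 4 + e / 4) powr p)"
    by (rule Lp_int_triangle[OF FL uL vL e4(1) e4(1) Fu uv])
  then have Fc: "Lp_int ?P d p F (ae_class ?P c) \<le> ennreal ((e / 4 + e / 4 + e / 4) powr p)"
    by (rule Lp_int_triangle[OF FL vL cL e4(2) e4(1) _ vc])
  then have "Lp_dist ?P d p F (ae_class ?P c) \<le> e / 4 + e / 4 + e / 4" using e by (intro Lp_dist_le) auto
  then have close: "Lp_dist ?P d p F (ae_class ?P c) < e" using e by simp
  have "Lp_int ?P d p (ae_class ?P c) F < \<infinity>" using Fc by (subst Lp_int_commute) (auto intro: le_less_trans)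
  from Lp_int_finite_trans[OF cL FL ae_hat this Fhat]
  have "ae_class ?P c \<in> rect_simple_Lp I M N d p h"
    using step_in_rect_almost_simple_classes[OF c] cL by (simp add: rect_simple_Lp_def Lp_def hat_class_eq)
  then show ?thesis using close by blast
qed

end

section \<open>Extension of isometries by density\<close>

lemma (in Metric_space) MCauchy_harmonic:
  assumes x: "\<And>n. x n \<in> M" and le: "\<And>m n. d (x m) (x n) \<le> 1 / Suc m + 1 / Suc n"
  shows "MCauchy x"
  unfolding MCauchy_def
proof (intro conjI allI impI)
  fix e :: real assume "0 < e"
  then obtain k where k: "1 / Suc k < e / 2" using nat_approx_posE[of "e / 2"] by auto
  have "d (x m) (x n) < e" if "k \<le> m" "k \<le> n" for m n
  proof -
    have "1 / real (Suc m) \<le> 1 / Suc k" "1 / real (Suc n) \<le> 1 / Suc k"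
      using that by (auto intro!: divide_left_mono)
    then show ?thesis using le[of m n] k by linarith
  qed
  then show "\<exists>N. \<forall>n n'. N \<le> n \<longrightarrow> N \<le> n' \<longrightarrow> d (x n) (x n') < e" by blast
qed (use x in auto)

lemma (in Metric_space) self_dense: "z \<in> M \<Longrightarrow> 0 < e \<Longrightarrow> \<exists>w\<in>M. d z w < e"
  by (rule bexI[of _ z]) auto

lemma tendsto_harmonic: "(\<lambda>n. 1 / real (Suc n)) \<longlonglongrightarrow> 0"
  using LIMSEQ_inverse_real_of_nat by (simp add: divide_inverse)

lemma distance_preserving_agree:
  assumes X: "Metric_space X d" and Y: "Metric_space Y e" and AX: "A \<subseteq> X"
    and dense: "\<And>x r. x \<in> X \<Longrightarrow> 0 < r \<Longrightarrow> \<exists>a\<in>A. d x a < r"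
    and \<psi>: "distance_preserving X d Y e \<psi>" and \<theta>: "distance_preserving X d Y e \<theta>"
    and agree: "\<And>a. a \<in> A \<Longrightarrow> \<psi> a = \<theta> a" and x: "x \<in> X"
  shows "\<psi> x = \<theta> x"
proof (rule ccontr)
  interpret X: Metric_space X d by (rule X)
  interpret Y: Metric_space Y e by (rule Y)
  have Y: "\<psi> y \<in> Y" "\<theta> y \<in> Y" if "y \<in> X" for y
    using \<psi> \<theta> that by (auto simp: distance_preserving_def)
  assume "\<psi> x \<noteq> \<theta> x"
  then have "0 < e (\<psi> x) (\<theta> x) / 2" using Y[OF x] by simp
  then obtain a where a: "a \<in> A" "d x a < e (\<psi> x) (\<theta> x) / 2" using dense[OF x] by blast
  then have aX: "a \<in> X" using AX by auto
  have "e (\<psi> x) (\<theta> x) \<le> e (\<psi> x) (\<psi> a) + e (\<theta> x) (\<psi> a)"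
    using Y x aX by (intro Y.triangle') auto
  also have "\<dots> = d x a + d x a"
  proof -
    have "e (\<psi> x) (\<psi> a) = d x a" "e (\<theta> x) (\<theta> a) = d x a"
      using \<psi> \<theta> x aX by (simp_all add: distance_preserving_def)
    then show ?thesis by (simp only: agree[OF a(1)])
  qed
  finally show False using a(2) by simp
qed

text \<open>The point of \<open>Y\<close> assigned to \<open>x\<close> is characterised by its distances to the image of \<open>A\<close>.\<close>

lemma distance_preserving_extension:
  assumes X: "Metric_space X d" and Y: "Metric_space Y e" and complete: "Metric_space.mcomplete Y e"
    and AX: "A \<subseteq> X" and dense: "\<And>x r. x \<in> X \<Longrightarrow> 0 < r \<Longrightarrow> \<exists>a\<in>A. d x a < r"
    and \<phi>: "distance_preserving A d Y e \<phi>"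
  shows "\<exists>\<psi>. \<psi> \<in> extensional X \<and> distance_preserving X d Y e \<psi> \<and> extends_map A \<phi> X \<psi>"
proof -
  interpret X: Metric_space X d by (rule X)
  interpret Y: Metric_space Y e by (rule Y)
  have \<phi>Y: "\<phi> a \<in> Y" if "a \<in> A" for a using \<phi> that by (auto simp: distance_preserving_def)
  have \<phi>d: "e (\<phi> a) (\<phi> b) = d a b" if "a \<in> A" "b \<in> A" for a b
    using \<phi> that by (auto simp: distance_preserving_def)
  have "\<exists>y\<in>Y. \<forall>a\<in>A. e y (\<phi> a) = d x a" if x: "x \<in> X" for x
  proof -
    have "\<forall>n. \<exists>a\<in>A. d x a < 1 / Suc n" using dense[OF x] by simp
    then obtain s where s: "\<And>n. s n \<in> A" "\<And>n. d x (s n) < 1 / Suc n" by metis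
    have "Y.MCauchy (\<lambda>n. \<phi> (s n))"
    proof (rule Y.MCauchy_harmonic)
      fix m n
      have "d (s m) (s n) \<le> d x (s m) + d x (s n)"
        using s(1) AX x by (intro X.triangle'') auto
      then show "e (\<phi> (s m)) (\<phi> (s n)) \<le> 1 / Suc m + 1 / Suc n"
        using s(2)[of m] s(2)[of n] by (simp add: \<phi>d s(1))
    qed (use s(1) \<phi>Y in auto)
    then obtain y where "limitin Y.mtopology (\<lambda>n. \<phi> (s n)) y sequentially"
      using complete by (auto simp: Y.mcomplete_def)
    then have y: "y \<in> Y" "(\<lambda>n. e (\<phi> (s n)) y) \<longlonglongrightarrow> 0" by (auto simp: Y.limitin_metric_dist_null)
    have "e y (\<phi> a) = d x a" if a: "a \<in> A" for a
    proof -
      have "\<bar>e y (\<phi> a) - d x a\<bar> \<le> e (\<phi> (s n)) y + 1 / Suc n" for n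
      proof -
        have 1: "\<bar>e (\<phi> (s n)) (\<phi> a) - e (\<phi> a) y\<bar> \<le> e (\<phi> (s n)) y"
          using \<phi>Y s(1) a y by (intro Y.mdist_reverse_triangle) auto
        have 2: "\<bar>d x a - d a (s n)\<bar> \<le> d x (s n)"
          using AX s(1) a x by (intro X.mdist_reverse_triangle) auto
        show ?thesis using 1 2 s(2)[of n] by (simp add: \<phi>d s(1) a Y.commute X.commute)
      qed
      moreover have "(\<lambda>n. e (\<phi> (s n)) y + 1 / Suc n) \<longlonglongrightarrow> 0"
        using tendsto_add[OF y(2) tendsto_harmonic] by simp
      ultimately have "\<bar>e y (\<phi> a) - d x a\<bar> \<le> 0" by (intro LIMSEQ_le_const) auto
      then show ?thesis by simp
    qed
    then show ?thesis using y(1) by blast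
  qed
  then obtain \<psi> where \<psi>: "\<And>x. x \<in> X \<Longrightarrow> \<psi> x \<in> Y" "\<And>x a. x \<in> X \<Longrightarrow> a \<in> A \<Longrightarrow> e (\<psi> x) (\<phi> a) = d x a"
    by metis
  have dp: "e (\<psi> x) (\<psi> x') = d x x'" if x: "x \<in> X" "x' \<in> X" for x x'
  proof -
    \<comment> \<open>Only \<open>x\<close> is approximated: the distance from
      \<open>\<psi> x'\<close> to the image of a point of \<open>A\<close> is already known
      exactly.\<close>
    have "\<bar>e (\<psi> x) (\<psi> x') - d x x'\<bar> \<le> r" if r: "0 < r" for r
    proof -
      obtain a where a: "a \<in> A" "d x a < r / 2" using dense[OF x(1), of "r / 2"] r by auto
      have aX: "a \<in> X" using a AX by auto
      have "e (\<psi> x) (\<psi> x') \<le> e (\<psi> x) (\<phi> a) + e (\<psi> x') (\<phi> a)" using \<psi>(1) \<phi>Y a x by (intro Y.triangle') auto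
      moreover have "e (\<psi> x') (\<phi> a) \<le> e (\<psi> x) (\<psi> x') + e (\<psi> x) (\<phi> a)" using \<psi>(1) \<phi>Y a x by (intro Y.triangle'') auto
      moreover have "d x x' \<le> d x a + d x' a" using aX x by (intro X.triangle') auto
      moreover have "d x' a \<le> d x x' + d x a" using aX x by (intro X.triangle'') auto
      ultimately show ?thesis using a(2) \<psi>(2)[OF x(1) a(1)] \<psi>(2)[OF x(2) a(1)] by linarith
    qed
    then have "\<bar>e (\<psi> x) (\<psi> x') - d x x'\<bar> \<le> 0" by (rule dense_ge)
    then show ?thesis by simp
  qed
  have ext: "\<psi> a = \<phi> a" if a: "a \<in> A" for a
  proof -
    have "a \<in> X" using a AX by auto
    then have "e (\<psi> a) (\<phi> a) = 0" using \<psi>(2)[of a a] a by simp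
    then show ?thesis using \<psi>(1)[OF \<open>a \<in> X\<close>] \<phi>Y[OF a] by simp
  qed
  show ?thesis
    using \<psi>(1) dp ext AX
    by (intro exI[of _ "restrict \<psi> X"]) (auto simp: distance_preserving_def extends_map_def)
qed

text \<open>Density gives uniqueness on \<open>X\<close>, and \<open>extensional\<close> fixes the
  values elsewhere, so the definite description denotes the extension that completeness
  provides.\<close>

lemma isometric_extension:
  assumes "Metric_space X d" and "Metric_space Y e" and "Metric_space.mcomplete Y e"
    and "A \<subseteq> X" and "\<And>x r. x \<in> X \<Longrightarrow> 0 < r \<Longrightarrow> \<exists>a\<in>A. d x a < r"
    and "distance_preserving A d Y e \<phi>"
  shows "distance_preserving X d Y e (isometric_extension A \<phi> X d Y e)"
    and "extends_map A \<phi> X (isometric_extension A \<phi> X d Y e)"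
proof -
  let ?P = "\<lambda>\<psi>. \<psi> \<in> extensional X \<and> distance_preserving X d Y e \<psi> \<and> extends_map A \<phi> X \<psi>"
  obtain \<psi> where \<psi>: "?P \<psi>" using distance_preserving_extension[OF assms] by blast
  have unique: "\<theta> = \<psi>" if "?P \<theta>" for \<theta>
  proof (rule extensionalityI)
    fix x assume "x \<in> X"
    then show "\<theta> x = \<psi> x"
      by (intro distance_preserving_agree[OF assms(1,2,4,5), of \<theta> \<psi> x]) (use that \<psi> in \<open>auto simp: extends_map_def\<close>)
  qed (use that \<psi> in auto)
  have "isometric_extension A \<phi> X d Y e = \<psi>"
    unfolding isometric_extension_def by (rule the_equality[where P = ?P, OF \<psi> unique])
  then show "distance_preserving X d Y e (isometric_extension A \<phi> X d Y e)"
    and "extends_map A \<phi> X (isometric_extension A \<phi> X d Y e)" using \<psi> by auto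
qed

text \<open>The image of a complete space is complete: points mapped ever closer to \<open>y\<close>
  form a Cauchy sequence in \<open>X\<close>, and its limit is sent to \<open>y\<close>.\<close>

lemma distance_preserving_surj:
  assumes X: "Metric_space X d" and Y: "Metric_space Y e" and complete: "Metric_space.mcomplete X d"
    and \<psi>: "distance_preserving X d Y e \<psi>"
    and dense: "\<And>y r. y \<in> Y \<Longrightarrow> 0 < r \<Longrightarrow> \<exists>x\<in>X. e y (\<psi> x) < r"
  shows "isometry X d Y e \<psi>"
proof -
  interpret X: Metric_space X d by (rule X)
  interpret Y: Metric_space Y e by (rule Y)
  have \<psi>Y: "\<psi> x \<in> Y" if "x \<in> X" for x using \<psi> that by (auto simp: distance_preserving_def)
  have \<psi>d: "e (\<psi> a) (\<psi> b) = d a b" if "a \<in> X" "b \<in> X" for a b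
    using \<psi> that by (auto simp: distance_preserving_def)
  have "y \<in> \<psi> ` X" if y: "y \<in> Y" for y
  proof -
    have "\<forall>n. \<exists>x\<in>X. e y (\<psi> x) < 1 / Suc n" using dense[OF y] by simp
    then obtain s where s: "\<And>n. s n \<in> X" "\<And>n. e y (\<psi> (s n)) < 1 / Suc n" by metis
    have "X.MCauchy s"
    proof (rule X.MCauchy_harmonic)
      fix m n
      have "e (\<psi> (s m)) (\<psi> (s n)) \<le> e y (\<psi> (s m)) + e y (\<psi> (s n))"
        using s(1) \<psi>Y y by (intro Y.triangle'') auto
      then show "d (s m) (s n) \<le> 1 / Suc m + 1 / Suc n"
        using s(2)[of m] s(2)[of n] by (simp add: \<psi>d s(1))
    qed (use s(1) in auto)
    then obtain x where "limitin X.mtopology s x sequentially"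
      using complete by (auto simp: X.mcomplete_def)
    then have x: "x \<in> X" "(\<lambda>n. d (s n) x) \<longlonglongrightarrow> 0" by (auto simp: X.limitin_metric_dist_null)
    have "e y (\<psi> x) \<le> d (s n) x + 1 / Suc n" for n
    proof -
      have "e y (\<psi> x) \<le> e y (\<psi> (s n)) + e (\<psi> (s n)) (\<psi> x)" using s(1) x \<psi>Y y by (intro Y.triangle) auto
      then show ?thesis using s(2)[of n] \<psi>d[OF s(1) x(1)] by (simp add: less_imp_le)
    qed
    moreover have "(\<lambda>n. d (s n) x + 1 / Suc n) \<longlonglongrightarrow> 0"
      using tendsto_add[OF x(2) tendsto_harmonic] by simp
    ultimately have "e y (\<psi> x) \<le> 0" by (intro LIMSEQ_le_const) auto
    then have "e y (\<psi> x) = 0" using Y.nonneg[of y "\<psi> x"] by simp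
    then show ?thesis using y \<psi>Y[OF x(1)] x(1) by auto
  qed
  then show ?thesis using \<psi> \<psi>Y by (auto simp: isometry_def)
qed

lemma distance_preserving_inj_on:
  assumes "Metric_space X d" "Metric_space Y e" "distance_preserving X d Y e \<psi>"
  shows "inj_on \<psi> X"
proof
  interpret X: Metric_space X d by (rule assms)
  interpret Y: Metric_space Y e by (rule assms)
  fix x x' assume x: "x \<in> X" "x' \<in> X" "\<psi> x = \<psi> x'"
  have "d x x' = e (\<psi> x) (\<psi> x')" using assms(3) x(1,2) by (simp add: distance_preserving_def)
  moreover have "\<psi> x' \<in> Y" using assms(3) x(2) by (auto simp: distance_preserving_def)
  ultimately have "d x x' = 0" using x(3) by simp
  then show "x = x'" using x by simp
qed

lemma distance_preserving_comp_inv: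
  assumes "inj_on f X" "distance_preserving X d P dP f" "distance_preserving X d Q dQ g"
  shows "distance_preserving (f ` X) dP Q dQ (g \<circ> inv_into X f)"
  using assms by (auto simp: distance_preserving_def)

text \<open>The metric core, free of measure theory. The images of \<open>R\<close> under
  \<open>f\<close> and \<open>g\<close> are required only to be dense in the targets, which
  accommodates a \<open>g\<close> whose image is not known explicitly.\<close>

theorem isometric_extension_comp_inv:
  assumes L: "Metric_space L d" "Metric_space.mcomplete L d"
    and P: "Metric_space P dP" "Metric_space.mcomplete P dP"
    and Q: "Metric_space Q dQ" "Metric_space.mcomplete Q dQ"
    and RL: "R \<subseteq> L" and R: "\<And>x r. x \<in> L \<Longrightarrow> 0 < r \<Longrightarrow> \<exists>a\<in>R. d x a < r"
    and f: "distance_preserving R d P dP f" and fR: "\<And>y r. y \<in> P \<Longrightarrow> 0 < r \<Longrightarrow> \<exists>a\<in>f ` R. dP y a < r"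
    and g: "distance_preserving R d Q dQ g" and gR: "\<And>y r. y \<in> Q \<Longrightarrow> 0 < r \<Longrightarrow> \<exists>a\<in>g ` R. dQ y a < r"
  defines "i \<equiv> g \<circ> inv_into R f"
    and "j \<equiv> isometric_extension R g L d Q dQ \<circ> inv_into L (isometric_extension R f L d P dP)"
  shows "distance_preserving (f ` R) dP Q dQ i" and "i ` f ` R = g ` R" and "isometry P dP Q dQ j"
    and "extends_map (f ` R) i P j"
    and "\<And>\<psi> c. distance_preserving P dP Q dQ \<psi> \<Longrightarrow> extends_map (f ` R) i P \<psi> \<Longrightarrow> c \<in> P \<Longrightarrow> \<psi> c = j c"
proof -
  have RM: "Metric_space R d" using Metric_space.subspace[OF L(1) RL] .
  have inj: "inj_on f R" by (rule distance_preserving_inj_on[OF RM P(1) f])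
  show "distance_preserving (f ` R) dP Q dQ i"
    unfolding i_def by (rule distance_preserving_comp_inv[OF inj f g])
  show "i ` f ` R = g ` R"
    unfolding i_def using inj by (simp add: image_image cong: image_cong_simp)
  define F where "F = isometric_extension R f L d P dP"
  define G where "G = isometric_extension R g L d Q dQ"
  have F: "distance_preserving L d P dP F" "extends_map R f L F"
    unfolding F_def using isometric_extension[OF L(1) P RL R f] by auto
  have G: "distance_preserving L d Q dQ G" "extends_map R g L G"
    unfolding G_def using isometric_extension[OF L(1) Q RL R g] by auto
  have isoF: "isometry L d P dP F"
  proof (rule distance_preserving_surj[OF L(1) P(1) L(2) F(1)])
    fix y r assume "y \<in> P" "0 < (r::real)"
    then obtain a where "a \<in> R" "dP y (f a) < r" using fR by blast
    then show "\<exists>x\<in>L. dP y (F x) < r" using F(2) by (intro bexI[of _ a]) (auto simp: extends_map_def)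
  qed
  have isoG: "isometry L d Q dQ G"
  proof (rule distance_preserving_surj[OF L(1) Q(1) L(2) G(1)])
    fix y r assume "y \<in> Q" "0 < (r::real)"
    then obtain a where "a \<in> R" "dQ y (g a) < r" using gR by blast
    then show "\<exists>x\<in>L. dQ y (G x) < r" using G(2) by (intro bexI[of _ a]) (auto simp: extends_map_def)
  qed
  have injF: "inj_on F L" by (rule distance_preserving_inj_on[OF L(1) P(1) F(1)])
  have j: "j = G \<circ> inv_into L F" by (simp add: j_def F_def G_def)
  have FL: "F ` L = P" and GL: "G ` L = Q" using isoF isoG by (auto simp: isometry_def)
  have dp: "distance_preserving P dP Q dQ j"
    using distance_preserving_comp_inv[OF injF F(1) G(1)] by (simp add: j FL)
  have "j ` P = Q" unfolding j FL[symmetric] GL[symmetric] using injF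
    by (simp add: image_image cong: image_cong_simp)
  then show "isometry P dP Q dQ j" using dp by (simp add: isometry_def)
  have j_eq: "j c = i c" if cR: "c \<in> f ` R" for c
  proof -
    obtain a where a: "c = f a" "a \<in> R" using cR by (rule imageE)
    then have "c = F a" "a \<in> L" using F(2) RL by (auto simp: extends_map_def)
    then have "inv_into L F c = a" using injF by simp
    moreover have "inv_into R f c = a" using inj a by simp
    ultimately show ?thesis using G(2) a by (simp add: j i_def extends_map_def)
  qed
  have sub: "f ` R \<subseteq> P" using f by (auto simp: distance_preserving_def)
  then show "extends_map (f ` R) i P j" using j_eq by (simp add: extends_map_def)
  fix \<psi> c assume \<psi>: "distance_preserving P dP Q dQ \<psi>" "extends_map (f ` R) i P \<psi>" and c: "c \<in> P"
  show "\<psi> c = j c"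
  proof (rule distance_preserving_agree[OF P(1) Q(1) sub fR \<psi>(1) dp _ c])
    show "\<psi> a = j a" if "a \<in> f ` R" for a using \<psi>(2) that unfolding extends_map_def j_eq[OF that] by blast
  qed
qed

section \<open>The spaces of curves and of fields\<close>

context section_space
begin

lemma E_h_dense:
  assumes "F \<in> Lp_h" "0 < e" shows "\<exists>F'\<in>E_h. Lp_dist M d p F F' < e"
  by (rule almost_simple_dense[OF h0 order_refl self_dense refl assms])

lemma Lp_curves_eq: "Lp_curves I M N d p h = Lp I Lp_h (Lp_dist M d p) p (ae_class I (\<lambda>_. h))"
proof -
  interpret L: Lp_space Lp_h "Lp_dist M d p" p by (rule Lp_space_Lp_h)
  show ?thesis unfolding Lp_curves_def by (rule L.Lp_const_eq[OF finI base_in_Lp[OF h_L0]])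
qed

text \<open>Completeness is applied twice, to the inner L^p space over \<open>N\<close> and then to
  the curves in it; the fields below repeat this with the roles of \<open>I\<close> and
  \<open>M\<close> exchanged.\<close>

lemma Lp_curves_metric:
  shows "Metric_space (Lp_curves I M N d p h) (curve_dist I M d p)"
    and "mcomplete \<Longrightarrow> Metric_space.mcomplete (Lp_curves I M N d p h) (curve_dist I M d p)"
proof -
  interpret L: Lp_space Lp_h "Lp_dist M d p" p by (rule Lp_space_Lp_h)
  have "ae_class I (\<lambda>_. h) \<in> L0 I Lp_h (Lp_dist M d p)"
    by (intro L.L0I L.L0_maps_const base_in_Lp h_L0)
  then show "Metric_space (Lp_curves I M N d p h) (curve_dist I M d p)"
    and "mcomplete \<Longrightarrow> Metric_space.mcomplete (Lp_curves I M N d p h) (curve_dist I M d p)"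
    unfolding Lp_curves_eq curve_dist_def using L.Metric_space_Lp L.mcomplete_Lp mcomplete_Lp[OF _ h_L0] by blast+
qed

lemma Lp_fields_metric:
  shows "Metric_space (Lp_fields I M N d p h) (field_dist I M d p)"
    and "mcomplete \<Longrightarrow> Metric_space.mcomplete (Lp_fields I M N d p h) (field_dist I M d p)"
proof -
  interpret L: Lp_space Lp_I "Lp_dist I d p" p by (rule Lp_space_Lp_I)
  obtain z where z: "z \<in> N" using N_nonempty by auto
  have "mcomplete \<Longrightarrow> L.mcomplete" using mcomplete_Lp[OF _ const_L0[OF z]] by (simp add: Lp_I_eq[OF z])
  then show "Metric_space (Lp_fields I M N d p h) (field_dist I M d p)"
    and "mcomplete \<Longrightarrow> Metric_space.mcomplete (Lp_fields I M N d p h) (field_dist I M d p)"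
    unfolding Lp_fields_def field_dist_def using L.Metric_space_Lp[OF under_L0] L.mcomplete_Lp[OF _ under_L0] by blast+
qed

lemma simple_curves_subset: "simple_curves I M N d p h \<subseteq> Lp_curves I M N d p h"
proof -
  interpret L: Lp_space Lp_h "Lp_dist M d p" p by (rule Lp_space_Lp_h)
  show ?thesis
    unfolding simple_curves_def Lp_curves_def
    by (rule L.simple_classes_subset_Lp_const[OF finI]) (use base_in_Lp[OF h_L0] in auto)
qed

lemma simple_curves_dense:
  assumes "F \<in> Lp_curves I M N d p h" "0 < e"
  shows "\<exists>F'\<in>simple_curves I M N d p h. curve_dist I M d p F F' < e"
proof -
  interpret L: Lp_space Lp_h "Lp_dist M d p" p by (rule Lp_space_Lp_h)
  show ?thesis
    unfolding simple_curves_def curve_dist_def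
    by (rule L.simple_classes_dense[OF finI _ E_h_dense]) (use assms in \<open>auto simp: Lp_curves_def\<close>)
qed

lemma simple_fields_dense:
  assumes "F \<in> Lp_fields I M N d p h" "0 < e"
  shows "\<exists>F'\<in>simple_fields I M N d p h. field_dist I M d p F F' < e"
proof -
  interpret L: Lp_space Lp_I "Lp_dist I d p" p by (rule Lp_space_Lp_I)
  \<comment> \<open>Constant curves are simple, so the base field takes values in the dense subset
    \<open>E_I\<close>, as the density lemma requires of its base map.\<close>
  have g: "(\<lambda>x. ae_class I (\<lambda>_. h0 x)) \<in> L0_maps M E_I (Lp_dist I d p)"
    using step_section_snd[OF step_hat] step_sections_L0[OF step_hat]
    by (intro L.L0_maps_subset[OF _ _ E_I_subset]) auto
  have dense: "\<exists>w\<in>E_I. Lp_dist I d p z w < r" if "z \<in> Lp_I" "0 < r" for z r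
    by (rule simple_classes_dense[OF finI order_refl self_dense that])
  show ?thesis
    unfolding simple_fields_def field_dist_def Lp_fields_def
    by (rule L.almost_simple_dense[OF g E_I_subset dense under_class_eq]) (use assms in \<open>auto simp: Lp_fields_def\<close>)
qed

lemma sec_fst_distance_preserving:
  "distance_preserving (rect_simple_Lp I M N d p h) (Lp_dist (cprod I M) d p)
    (Lp_curves I M N d p h) (curve_dist I M d p) (sec_fst I M)"
  unfolding distance_preserving_def curve_dist_def
proof (intro conjI funcsetI ballI)
  show "sec_fst I M F \<in> Lp_curves I M N d p h" if "F \<in> rect_simple_Lp I M N d p h" for F
    using that sec_fst_image simple_curves_subset by blast
qed (simp add: Lp_dist_def sec_fst_int)

lemma sec_snd_distance_preserving:
  "distance_preserving (rect_simple_Lp I M N d p h) (Lp_dist (cprod I M) d p)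
    (Lp_fields I M N d p h) (field_dist I M d p) (sec_snd I M)"
  unfolding distance_preserving_def field_dist_def
proof (intro conjI funcsetI ballI sec_snd_Lp_fields)
  fix F F' assume F: "F \<in> rect_simple_Lp I M N d p h" and F': "F' \<in> rect_simple_Lp I M N d p h"
  obtain c where c: "Lp_step c" "F = ae_class (cprod I M) c" using F by (rule rect_simple_Lp_step)
  obtain c' where c': "Lp_step c'" "F' = ae_class (cprod I M) c'" using F' by (rule rect_simple_Lp_step)
  show "Lp_dist M (Lp_dist I d p) p (sec_snd I M F) (sec_snd I M F') = Lp_dist (cprod I M) d p F F'"
    using sec_snd_int[of c c'] c c' by (simp add: Lp_dist_def Lp_step_def)
qed

end

text \<open>At the simple level \<open>i\<close> is stated to preserve distances into
  \<open>Y\<close> with an image containing \<open>B\<close>; being an isometry onto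
  \<open>B\<close> is tied to the inclusion of the sections in \<open>B\<close>, which can fail for
  an \<open>h\<close> with infinitely many values. The extension is unaffected, since
  \<open>B\<close> alone is dense in \<open>Y\<close>.\<close>

theorem theorem3p13:
  fixes M :: "'m measure" and N :: "'n set" and d :: "'n \<Rightarrow> 'n \<Rightarrow> real"
    and a b p :: real and h :: "('m \<Rightarrow> 'n) set"
  assumes "space M \<noteq> {}"
    and "Metric_space N d" and "N \<noteq> {}" and "Metric_space.mcomplete N d"
    and "a < b" and "1 \<le> p"
    and "h \<in> L0 M N d"
  shows
    "let I = lebesgue_on {a..b};
         A = simple_curves I M N d p h; B = simple_fields I M N d p h;
         X = Lp_curves I M N d p h; dX = curve_dist I M d p;
         Y = Lp_fields I M N d p h; dY = field_dist I M d p;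
         i = i_map I M N d p h; ibar = i_ext I M N d p h
     in
       distance_preserving A dX Y dY i \<and> B \<subseteq> i ` A \<and>
       (sec_snd I M ` rect_simple_Lp I M N d p h \<subseteq> B \<longrightarrow> isometry A dX B dY i) \<and>
       isometry X dX Y dY ibar \<and>
       extends_map A i X ibar \<and>
       (\<forall>\<psi>. distance_preserving X dX Y dY \<psi> \<and> extends_map A i X \<psi> \<longrightarrow> (\<forall>c\<in>X. \<psi> c = ibar c))"
proof -
  obtain h0 where h0_rep: "h0 \<in> L0_maps M N d" "h = ae_class M h0" using assms(7) by (auto simp: L0_def)
  define I where "I = lebesgue_on {a..b}"
  have "finite_measure I" unfolding I_def by (rule finite_measure_lebesgue_on) simp
  then interpret section_space N d p I M h0
    using assms(2,3,6) h0_rep(1)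
    by (simp add: section_space_def section_space_axioms_def Lp_space_def Lp_space_axioms_def)
  let ?R = "rect_simple_Lp I M N d p h"
  let ?A = "simple_curves I M N d p h" and ?B = "simple_fields I M N d p h"
  let ?X = "Lp_curves I M N d p h" and ?dX = "curve_dist I M d p"
  let ?Y = "Lp_fields I M N d p h" and ?dY = "field_dist I M d p"
  let ?i = "i_map I M N d p h" and ?ibar = "i_ext I M N d p h"
  have fR: "\<exists>a\<in>sec_fst I M ` ?R. ?dX y a < r" if "y \<in> ?X" "0 < r" for y r
    using simple_curves_dense that unfolding sec_fst_image h0_rep(2) by blast
  have gR: "\<exists>a\<in>sec_snd I M ` ?R. ?dY y a < r" if "y \<in> ?Y" "0 < r" for y r
    using simple_fields_dense simple_fields_subset that unfolding h0_rep(2) by blast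
  have RL: "?R \<subseteq> Lp (cprod I M) N d p (hat_class I M h)" by (simp add: rect_simple_Lp_def)
  have i: "?i = sec_snd I M \<circ> inv_into ?R (sec_fst I M)" by (simp add: i_map_def)
  \<comment> \<open>The locale speaks of \<open>ae_class M h0\<close> and the goal of
    \<open>h\<close>; folding restores \<open>h\<close> and recognises the abstract extensions and
    composites as \<open>i_map\<close> and \<open>i_ext\<close>.\<close>
  note * = isometric_extension_comp_inv[OF Metric_space_Lp[OF hat_L0] mcomplete_Lp[OF assms(4) hat_L0]
      Lp_curves_metric(1) Lp_curves_metric(2)[OF assms(4)] Lp_fields_metric(1) Lp_fields_metric(2)[OF assms(4)]
      RL[unfolded h0_rep(2)] rect_simple_Lp_dense sec_fst_distance_preserving fR[unfolded h0_rep(2)]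
      sec_snd_distance_preserving gR[unfolded h0_rep(2)],
      folded h0_rep(2) sec_fst_ext_def sec_snd_ext_def i_map_def i_ext_def, unfolded sec_fst_image[folded h0_rep(2)]]
  have iA: "?i ` ?A = sec_snd I M ` ?R" by (rule *(2))
  have B: "?B \<subseteq> ?i ` ?A" unfolding iA using simple_fields_subset by (simp add: h0_rep(2))
  have iso: "isometry ?A ?dX ?B ?dY ?i" if "sec_snd I M ` ?R \<subseteq> ?B"
  proof -
    have img: "?i ` ?A = ?B" using B that by (simp only: iA)
    then have "?i \<in> ?A \<rightarrow> ?B" by blast
    then show ?thesis using *(1) img by (simp add: isometry_def distance_preserving_def)
  qed
  have unique: "\<psi> c = ?ibar c"
    if "distance_preserving ?X ?dX ?Y ?dY \<psi> \<and> extends_map ?A ?i ?X \<psi>" "c \<in> ?X" for \<psi> c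
    using that *(5) by blast
  show ?thesis
    unfolding Let_def I_def[symmetric] by (intro conjI allI impI ballI *(1,3,4) B iso unique) blast+
qed

end
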